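(* For every complex number $\nu$ with $\operatorname{Re}\nu>-1$, the following identities hold: $$\int_{-1}^1\frac{[P_{\nu}(x)]^3}{(1-x^{2})^{(1-\nu)/2}}\,dx=[3-2\cos(\nu\pi)]\int_{-1}^1\frac{[P_{\nu}(x)]^2P_{\nu}(-x)}{(1-x^{2})^{(1-\nu)/2}}\,dx=\frac{3-2\cos(\nu\pi)}{\pi}\left(\frac{\cos\frac{\nu\pi}{2}}{2^{\nu}}\right)^3\left[ \frac{\Gamma(\frac{1+\nu}{2})}{\Gamma(1+\frac{\nu}{2})} \right]^{4},$$ and $$\int_{-1}^1\frac{x[P_{\nu+1}(x)]^3}{(1-x^{2})^{(1-\nu)/2}}\,dx=[2\cos(\nu\pi)-3]\int_{-1}^1\frac{x[P_{\nu+1}(x)]^2P_{\nu+1}(-x)}{(1-x^{2})^{(1-\nu)/2}}\,dx=\frac{3}{8}\,\frac{3-2\cos(\nu\pi)}{\pi}\left(\frac{\cos\frac{\nu\pi}{2}}{2^{\nu}}\right)^3\left[ \frac{\Gamma(\frac{1+\nu}{2})}{\Gamma(1+\frac{\nu}{2})} \right]^{4}.$$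
   Context: For $\mu\in\mathbb C$, $P_\mu$ denotes the Legendre function of the first kind of degree $\mu$, defined on $(-1,1]$ by $P_{\mu}(1-2z)={}_2F_1(-\mu,\mu+1;1;z)$, where ${}_2F_1$ is the Gauss hypergeometric function. $\Gamma$ is the Euler gamma function. *)

theory Defs
  imports "HOL-Analysis.Analysis"
begin

(* In the library's fps_hypergeo as bs s, the last argument s is a scaling factor of the
   formal variable (not a denominator parameter), hence s = 1 here. The sum of the series is
   meaningful for norm z < 1, which is all that is used below. *)
definition hypergeo_2F1 :: "complex \<Rightarrow> complex \<Rightarrow> complex \<Rightarrow> complex \<Rightarrow> complex" where
  "hypergeo_2F1 a b c z = eval_fps (fps_hypergeo [a, b] [c] 1) z"

lemma hypergeo_2F1_series:
  "hypergeo_2F1 a b c z =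
     (\<Sum>n. pochhammer a n * pochhammer b n / (pochhammer c n * fact n) * z ^ n)"
  by (simp add: hypergeo_2F1_def eval_fps_def)

(* The substitution x = 1 - 2z in P_mu(1 - 2z) = 2F1(-mu, mu + 1; 1; z); for x in (-1, 1] the
   argument (1 - x) / 2 lies in [0, 1). *)
definition legendre_P :: "complex \<Rightarrow> real \<Rightarrow> complex" where
  "legendre_P \<mu> x = hypergeo_2F1 (- \<mu>) (\<mu> + 1) 1 (of_real ((1 - x) / 2))"

end

theory Submission
  imports Defs "HOL-Complex_Analysis.Complex_Analysis" "HOL-Real_Asymp.Real_Asymp"
begin

text \<open>
  Put n = \<nu> + 1. The pairs (P_\<nu>(x), P_{\<nu>+1}(x)) and (P_\<nu>(-x), -P_{\<nu>+1}(-x)) solve the first-order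
  system (1 - x^2) u' = n (x u - U), (1 - x^2) U' = n (u - x U). On the circle y = e^{i\<theta>}, x = cos \<theta>,
  two further solutions are y^{\<nu>+1} 2F1(1/2, \<nu>+1; \<nu>+3/2; y^2) and y^{-\<nu>} 2F1(1/2, -\<nu>; 1/2-\<nu>; y^2);
  constancy of Wronskians, evaluated at the endpoints, expresses them through P_\<nu>(\<plusminus>cos \<theta>).
  For 0 < \<nu> < 1/2, Cauchy's theorem on the upper half disc applied to two cubic products of these
  functions gives the factor 3 - 2 cos(\<nu>\<pi>) and reduces the integral of P_\<nu>(x)^2 P_\<nu>(-x) to
  J(\<nu>) = \<integral> x^{2\<nu>+2} 2F1(1/2, \<nu>+1; \<nu>+3/2; x^2)^3 (1 - x^2)^\<nu> dx over [0, 1].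
  Creative telescoping yields a first-order recurrence for J in steps of 2, and elementary bounds by
  Beta integrals fix its asymptotics as \<nu> tends to infinity, hence J itself. Analytic continuation in \<nu>
  covers Re \<nu> > -1, and the identities for P_{\<nu>+1} follow from the system above by integration by parts.
\<close>

section \<open>Zero-balanced hypergeometric series\<close>

text \<open>Every hypergeometric function involved is zero-balanced, 2F1(a, b; a + b; z): a =
  -\<nu>, b = \<nu> + 1 for the Legendre function, a = 1/2 for the two solutions on the circle. One
  study of a merely logarithmic singularity at 1 serves all of them. It has to include the boundary
  of the disc, because the contour integrals run over the circle itself. The cubic products are
  dictated by the weight. With x = cos \<theta>, (1 - x^2)^((\<nu> - 1)/2) dx becomes sin^\<nu>
  \<theta> d\<theta>, and sin^\<nu> \<theta> is y^(-\<nu>) (1 - y^2)^\<nu> up to a constant. In the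
  product of two copies of the first solution and one of the second, the non-integral powers of y
  cancel; the integrand is then odd on the real axis and its integral vanishes. The cube of the
  first solution leaves y^(2\<nu>+2), whose branches on the two halves of the diameter add up to a
  cosine times J. By the reflection \<theta> -> pi - \<theta> only two integrals are unknown, so
  these two equations determine them. For \<nu> <= 0 the weight does not tame the logarithms at y =
  1 and y = -1, and at \<nu> = 1/2 the second solution breaks down; an interval in between is enough
  for continuation.\<close>

text \<open>
  The coefficients of 2F1(a, b; a+b; z) satisfy n c_n \<longrightarrow> zb_kappa a b, so subtracting
  the logarithm leaves an absolutely convergent series: zb_F extends 2F1(a, b; a+b; z) continuously to
  the closed unit disc minus the point 1, and zb_H = (1 - z) zb_F' is continuous on all of it.
\<close>

definition zb_coeff :: "complex \<Rightarrow> complex \<Rightarrow> nat \<Rightarrow> complex" where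
  "zb_coeff a b n = pochhammer a n * pochhammer b n / (pochhammer (a + b) n * fact n)"

definition zb_kappa :: "complex \<Rightarrow> complex \<Rightarrow> complex" where
  "zb_kappa a b = rGamma a * rGamma b * Gamma (a + b)"

definition zb_diff :: "complex \<Rightarrow> complex \<Rightarrow> nat \<Rightarrow> complex" where
  "zb_diff a b n = of_nat (Suc n) * zb_coeff a b (Suc n) - of_nat n * zb_coeff a b n"

definition zb_H :: "complex \<Rightarrow> complex \<Rightarrow> complex \<Rightarrow> complex" where
  "zb_H a b z = (\<Sum>n. zb_diff a b n * z ^ n)"

definition zb_rem :: "complex \<Rightarrow> complex \<Rightarrow> nat \<Rightarrow> complex" where
  "zb_rem a b n = zb_coeff a b n - zb_kappa a b / of_nat n"

definition zb_F :: "complex \<Rightarrow> complex \<Rightarrow> complex \<Rightarrow> complex" where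
  "zb_F a b z = (\<Sum>n. zb_rem a b n * z ^ n) - zb_kappa a b * Ln (1 - z)"

lemma zb_coeff_0 [simp]: "zb_coeff a b 0 = 1"
  by (simp add: zb_coeff_def)

lemma not_nonpos_Int_add_nat:
  fixes c :: complex
  assumes "c \<notin> \<int>\<^sub>\<le>\<^sub>0"
  shows "c + of_nat n \<noteq> 0"
  proof
  assume "c + of_nat n = 0"
  hence "c = - of_nat n" by (simp add: eq_neg_iff_add_eq_0)
  thus False using assms by simp
qed

lemma pochhammer_nonzero:
  fixes c :: complex
  assumes "c \<notin> \<int>\<^sub>\<le>\<^sub>0"
  shows "pochhammer c n \<noteq> 0"
  using assms by (auto simp: pochhammer_eq_0_iff)

lemma zb_coeff_Suc:
  assumes "a + b \<notin> \<int>\<^sub>\<le>\<^sub>0"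
  shows "of_nat (Suc n) * zb_coeff a b (Suc n) * (a + b + of_nat n) =
           zb_coeff a b n * (a + of_nat n) * (b + of_nat n)"
proof -
  have "a + b + of_nat n \<noteq> 0" "pochhammer (a + b) n \<noteq> 0"
    using not_nonpos_Int_add_nat[OF assms] pochhammer_nonzero[OF assms] by auto
  moreover have "of_nat (Suc n) \<noteq> (0::complex)"
    by (metis of_nat_eq_0_iff old.nat.distinct(2))
  ultimately show ?thesis
    by (simp add: zb_coeff_def pochhammer_Suc divide_simps del: of_nat_Suc)
qed

lemma zb_diff_eq:
  assumes "a + b \<notin> \<int>\<^sub>\<le>\<^sub>0"
  shows "zb_diff a b n = zb_coeff a b n * (a * b) / (a + b + of_nat n)"
proof -
  have nz: "a + b + of_nat n \<noteq> 0"
    using not_nonpos_Int_add_nat[OF assms] by auto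
  have "zb_diff a b n * (a + b + of_nat n) = zb_coeff a b n * (a * b)"
    unfolding zb_diff_def left_diff_distrib zb_coeff_Suc[OF assms] by (simp add: algebra_simps)
  thus ?thesis using nz by (simp add: field_simps)
qed

text \<open>With the index shifted by one, n c_n is exactly a quotient of the sequences
  \<open>rGamma_series\<close>, which converge to the reciprocal Gamma function. If a + b is a pole
  of Gamma, division by zero makes all but finitely many coefficients 0, and \<open>zb_kappa\<close>
  is 0 because \<open>Gamma\<close> is 0 at its poles.\<close>

lemma zb_coeff_asymp:
  "(\<lambda>n. of_nat n * zb_coeff a b n) \<longlonglongrightarrow> zb_kappa a b"
proof (cases "a + b \<in> \<int>\<^sub>\<le>\<^sub>0")
  case True
  then obtain m where m: "a + b = - of_nat m" by (auto elim: nonpos_Ints_cases')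
  have "pochhammer (a + b) n = 0" if "n \<ge> Suc m" for n
    using that m by (simp add: pochhammer_of_nat_eq_0_iff)
  hence "eventually (\<lambda>n. of_nat n * zb_coeff a b n = 0) sequentially"
    by (intro eventually_sequentiallyI[of "Suc m"]) (simp add: zb_coeff_def)
  moreover have "zb_kappa a b = 0" using True by (simp add: zb_kappa_def Gamma_eq_zero_iff)
  ultimately show ?thesis by (simp add: tendsto_eventually)
next
  case False
  have "(\<lambda>n. rGamma_series a n * rGamma_series b n / rGamma_series (a + b) n) \<longlonglongrightarrow>
          rGamma a * rGamma b / rGamma (a + b)"
    using False by (intro tendsto_intros rGamma_series_LIMSEQ) (auto simp: rGamma_eq_zero_iff)
  also have "rGamma a * rGamma b / rGamma (a + b) = zb_kappa a b"
    by (simp add: zb_kappa_def Gamma_def divide_inverse)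
  finally have "(\<lambda>n. rGamma_series a n * rGamma_series b n / rGamma_series (a + b) n) \<longlonglongrightarrow> zb_kappa a b" .
  moreover have "rGamma_series a n * rGamma_series b n / rGamma_series (a + b) n =
                   of_nat (Suc n) * zb_coeff a b (Suc n)" for n
    by (simp add: rGamma_series_def zb_coeff_def ring_distribs exp_add field_simps del: of_nat_Suc)
  ultimately have "(\<lambda>n. of_nat (Suc n) * zb_coeff a b (Suc n)) \<longlonglongrightarrow> zb_kappa a b"
    by simp
  thus ?thesis by (rule LIMSEQ_imp_Suc)
qed

text \<open>By \<open>zb_diff_eq\<close> the difference is c_n a b / (a + b + n), of order 1/n^2.
  The denominator n (n + 1) is preferred to n^2 because it telescopes, which
  \<open>zb_rem_summable\<close> exploits.\<close>

lemma zb_diff_bound: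
  assumes "a + b \<notin> \<int>\<^sub>\<le>\<^sub>0"
  obtains C where "C \<ge> 0" "\<And>n. n \<ge> 1 \<Longrightarrow> norm (zb_diff a b n) \<le> C / (real n * (real n + 1))"
proof -
  have 1: "(\<lambda>n. (1 + 1 / of_nat n) / ((a + b) / of_nat n + 1)) \<longlonglongrightarrow> (1 + 0) / (0 + 1 :: complex)"
    by (intro tendsto_intros) auto
  have "(\<lambda>n. (of_nat n * zb_coeff a b n) * (a * b) * ((1 + 1 / of_nat n) / ((a + b) / of_nat n + 1)))
          \<longlonglongrightarrow> zb_kappa a b * (a * b) * ((1 + 0) / (0 + 1))"
    by (intro tendsto_intros zb_coeff_asymp 1)
  hence "convergent (\<lambda>n. (of_nat n * zb_coeff a b n) * (a * b) * ((1 + 1 / of_nat n) / ((a + b) / of_nat n + 1)))"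
    by (auto simp: convergent_def)
  then obtain C where C: "C > 0" "\<And>n. norm ((of_nat n * zb_coeff a b n) * (a * b) * ((1 + 1 / of_nat n) / ((a + b) / of_nat n + 1))) \<le> C"
    by (meson BseqE convergent_imp_Bseq)
  show thesis
  proof (rule that[of C])
    fix n :: nat assume n: "n \<ge> 1"
    have nz: "a + b + of_nat n \<noteq> 0"
      using not_nonpos_Int_add_nat[OF assms] by auto
    have "(of_nat n * zb_coeff a b n) * (a * b) * ((1 + 1 / of_nat n) / ((a + b) / of_nat n + 1))
           = zb_diff a b n * (of_nat n * (of_nat n + 1))"
      unfolding zb_diff_eq[OF assms] using n nz by (simp add: divide_simps)
    with C(2)[of n] have "norm (zb_diff a b n * (of_nat n * (of_nat n + 1))) \<le> C" by simp
    moreover have "norm (of_nat n * (of_nat n + 1) :: complex) = real n * (real n + 1)"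
      by (metis norm_mult norm_of_nat of_nat_Suc add.commute)
    ultimately show "norm (zb_diff a b n) \<le> C / (real n * (real n + 1))"
      using n by (simp only: norm_mult) (simp add: pos_le_divide_eq)
  qed (use C in auto)
qed

lemma summable_inverse_consecutive: "summable (\<lambda>n. C / (real n * (real n + 1)))"
proof (rule summable_comparison_test)
  show "summable (\<lambda>n. \<bar>C\<bar> * inverse (real n ^ 2))"
    by (intro summable_mult inverse_power_summable) auto
  show "\<exists>N. \<forall>n\<ge>N. norm (C / (real n * (real n + 1))) \<le> \<bar>C\<bar> * inverse (real n ^ 2)"
    by (intro exI[of _ 1]) (auto simp: divide_simps power2_eq_square abs_mult mult_left_mono)
qed

lemma zb_diff_summable:
  assumes "a + b \<notin> \<int>\<^sub>\<le>\<^sub>0"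
  shows "summable (\<lambda>n. norm (zb_diff a b n))"
proof -
  obtain C where C: "C \<ge> 0" "\<And>n. n \<ge> 1 \<Longrightarrow> norm (zb_diff a b n) \<le> C / (real n * (real n + 1))"
    using zb_diff_bound[OF assms] by blast
  show ?thesis
    by (rule summable_comparison_test[OF _ summable_inverse_consecutive[of C]])
       (use C in \<open>auto intro!: exI[of _ 1]\<close>)
qed

text \<open>The terms \<open>zb_diff\<close> are the increments of d n = n c_n, whose limit is
  \<open>zb_kappa\<close>. Telescoping their bound shows that d n differs from its limit by O(1/n),
  and \<open>zb_rem\<close> is this error divided by n, hence O(1/n^2).\<close>

lemma zb_rem_summable:
  assumes "a + b \<notin> \<int>\<^sub>\<le>\<^sub>0"
  shows "summable (\<lambda>n. norm (zb_rem a b n))"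
proof -
  obtain C where C: "C \<ge> 0" "\<And>n. n \<ge> 1 \<Longrightarrow> norm (zb_diff a b n) \<le> C / (real n * (real n + 1))"
    using zb_diff_bound[OF assms] by blast
  define d where "d n = of_nat n * zb_coeff a b n" for n
  have d_diff: "norm (d (n + m) - d n) \<le> C * (1 / real n - 1 / real (n + m))" if "n \<ge> 1" for n m
  proof (induction m)
    case (Suc m)
    have "d (n + Suc m) - d n = zb_diff a b (n + m) + (d (n + m) - d n)"
      by (simp add: d_def zb_diff_def)
    also have "norm \<dots> \<le> C / (real (n + m) * (real (n + m) + 1)) + C * (1 / real n - 1 / real (n + m))"
      by (rule order.trans[OF norm_triangle_ineq], rule add_mono[OF C(2) Suc]) (use that in auto)
    also have "\<dots> = C * (1 / real n - 1 / real (n + Suc m))"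
      using that by (simp add: divide_simps) (simp add: algebra_simps)
    finally show ?case .
  qed auto
  have bound: "norm (zb_rem a b n) \<le> C * inverse (real n ^ 2)" if "n \<ge> 1" for n
  proof -
    have lim: "(\<lambda>m. norm (d (n + m) - d n)) \<longlonglongrightarrow> norm (zb_kappa a b - d n)"
    proof -
      have "d \<longlonglongrightarrow> zb_kappa a b"
        using zb_coeff_asymp[of a b] by (simp add: d_def[abs_def])
      hence "(\<lambda>m. d (n + m)) \<longlonglongrightarrow> zb_kappa a b"
        using LIMSEQ_ignore_initial_segment[of d _ n] by (simp add: add.commute)
      thus ?thesis by (intro tendsto_intros)
    qed
    have "norm (d (n + m) - d n) \<le> C / real n" for m
    proof -
      have "C * (1 / real n - 1 / real (n + m)) \<le> C * (1 / real n)"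
        using C(1) by (intro mult_left_mono) auto
      with d_diff[OF that, of m] show ?thesis by simp
    qed
    hence "norm (zb_kappa a b - d n) \<le> C / real n"
      by (intro LIMSEQ_le_const2[OF lim]) auto
    moreover have "zb_rem a b n = - (zb_kappa a b - d n) / of_nat n"
      using that by (simp add: zb_rem_def d_def field_simps)
    hence "norm (zb_rem a b n) = norm (zb_kappa a b - d n) / real n"
      by (simp add: norm_divide norm_minus_commute)
    ultimately show ?thesis
      using that by (simp add: field_simps power2_eq_square)
  qed
  show ?thesis
  proof (rule summable_comparison_test)
    show "summable (\<lambda>n. C * inverse (real n ^ 2))"
      by (intro summable_mult inverse_power_summable) auto
  qed (use bound in \<open>auto intro!: exI[of _ 1]\<close>)
qed

lemma power_series_cball:
  fixes c :: "nat \<Rightarrow> complex"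
  assumes "summable (\<lambda>n. norm (c n))"
  shows "continuous_on (cball 0 1) (\<lambda>z. \<Sum>n. c n * z ^ n)"
    and "\<And>z. norm z \<le> 1 \<Longrightarrow> norm (\<Sum>n. c n * z ^ n) \<le> (\<Sum>n. norm (c n))"
    and "\<And>z. norm z \<le> 1 \<Longrightarrow> summable (\<lambda>n. c n * z ^ n)"
proof -
  have le: "norm (c n * z ^ n) \<le> norm (c n)" if "norm z \<le> 1" for n z
    using that by (simp add: norm_mult norm_power mult_left_le power_le_one)
  have "uniform_limit (cball 0 1) (\<lambda>n z. \<Sum>i<n. c i * z ^ i) (\<lambda>z. \<Sum>n. c n * z ^ n) sequentially"
    by (rule Weierstrass_m_test[OF _ assms]) (use le in auto)
  thus "continuous_on (cball 0 1) (\<lambda>z. \<Sum>n. c n * z ^ n)"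
    by (rule uniform_limit_theorem[rotated]) (auto intro!: always_eventually continuous_intros)
  fix z :: complex assume z: "norm z \<le> 1"
  have s: "summable (\<lambda>n. norm (c n * z ^ n))"
    by (rule summable_comparison_test[OF _ assms]) (use le z in auto)
  thus "summable (\<lambda>n. c n * z ^ n)" by (rule summable_norm_cancel)
  show "norm (\<Sum>n. c n * z ^ n) \<le> (\<Sum>n. norm (c n))"
    using summable_norm[OF s] suminf_le[OF _ s assms] le[OF z] by (meson order.trans)
qed

lemma continuous_on_zb_H:
  assumes "a + b \<notin> \<int>\<^sub>\<le>\<^sub>0"
  shows "continuous_on (cball 0 1) (zb_H a b)"
  using power_series_cball(1)[OF zb_diff_summable[OF assms]] unfolding zb_H_def .

text \<open>At z = 1 the series telescopes to the limit of n c_n. This value, the coefficient of the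
  logarithm in \<open>zb_F\<close> up to sign, is what the Wronskians produce at the
  endpoints.\<close>

lemma zb_H_1: "zb_H a b 1 = zb_kappa a b"
proof -
  have "(\<lambda>n. zb_diff a b n) sums (zb_kappa a b - of_nat 0 * zb_coeff a b 0)"
    unfolding zb_diff_def by (rule telescope_sums[OF zb_coeff_asymp])
  thus ?thesis by (simp add: zb_H_def sums_iff)
qed

lemma continuous_on_zb_F:
  assumes "a + b \<notin> \<int>\<^sub>\<le>\<^sub>0"
  shows "continuous_on (cball 0 1 - {1}) (zb_F a b)"
proof -
  have "1 - z \<notin> \<real>\<^sub>\<le>\<^sub>0" if "z \<in> cball 0 1 - {1}" for z :: complex
  proof
    assume "1 - z \<in> \<real>\<^sub>\<le>\<^sub>0"
    hence "Re z \<ge> 1" "Im z = 0" by (auto simp: complex_nonpos_Reals_iff)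
    moreover have "Re z \<le> 1" using that complex_Re_le_cmod[of z] by auto
    ultimately show False using that by (auto simp: complex_eq_iff)
  qed
  thus ?thesis unfolding zb_F_def
    by (intro continuous_intros
          continuous_on_subset[OF power_series_cball(1)[OF zb_rem_summable[OF assms]]]) auto
qed

lemma zb_F_bound:
  assumes "a + b \<notin> \<int>\<^sub>\<le>\<^sub>0"
  obtains C where "C > 0" "\<And>z. norm z \<le> 1 \<Longrightarrow> norm (zb_F a b z) \<le> C * (1 + norm (Ln (1 - z)))"
proof
  define M where "M = (\<Sum>n. norm (zb_rem a b n))"
  have M: "M \<ge> 0" unfolding M_def by (intro suminf_nonneg zb_rem_summable assms) auto
  show "1 + M + norm (zb_kappa a b) > 0" using M by (smt (verit) norm_ge_zero)
  fix z :: complex assume z: "norm z \<le> 1"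
  have "norm (zb_F a b z) \<le> M + norm (zb_kappa a b) * norm (Ln (1 - z))"
    unfolding zb_F_def M_def norm_mult[symmetric]
    using power_series_cball(2)[OF zb_rem_summable[OF assms] z]
    by (meson add_mono norm_triangle_ineq4 order.trans order_refl)
  also have "\<dots> \<le> (1 + M + norm (zb_kappa a b)) * (1 + norm (Ln (1 - z)))"
    using M by (simp add: algebra_simps)
  finally show "norm (zb_F a b z) \<le> (1 + M + norm (zb_kappa a b)) * (1 + norm (Ln (1 - z)))" .
qed

lemma zb_F_sums:
  assumes "a + b \<notin> \<int>\<^sub>\<le>\<^sub>0" "norm z < 1"
  shows "(\<lambda>n. zb_coeff a b n * z ^ n) sums zb_F a b z"
proof -
  have "(\<lambda>n. zb_rem a b n * z ^ n) sums (\<Sum>n. zb_rem a b n * z ^ n)"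
    using power_series_cball(3)[OF zb_rem_summable[OF assms(1)]] assms(2)
    by (intro summable_sums) auto
  moreover have "(\<lambda>n. zb_kappa a b * (- ((- (-z)) ^ n) / of_nat n)) sums (zb_kappa a b * Ln (1 + (-z)))"
    using assms(2) by (intro sums_mult Ln_series') auto
  ultimately have "(\<lambda>n. zb_rem a b n * z ^ n - zb_kappa a b * (- ((- (-z)) ^ n) / of_nat n)) sums zb_F a b z"
    unfolding zb_F_def by (intro sums_diff) auto
  \<comment> \<open>This holds for n = 0 as well: both quotients by \<open>of_nat 0\<close> are 0,
    so the constant term is untouched.\<close>
  moreover have "zb_rem a b n * z ^ n - zb_kappa a b * (- ((- (-z)) ^ n) / of_nat n) = zb_coeff a b n * z ^ n" for n
    by (simp add: zb_rem_def algebra_simps)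
  ultimately show ?thesis by simp
qed

lemma zb_F_eq_hypergeo:
  assumes "a + b \<notin> \<int>\<^sub>\<le>\<^sub>0" "norm z < 1"
  shows "hypergeo_2F1 a b (a + b) z = zb_F a b z"
  using zb_F_sums[OF assms] unfolding hypergeo_2F1_series zb_coeff_def by (simp add: sums_iff)

lemma zb_F_0:
  assumes "a + b \<notin> \<int>\<^sub>\<le>\<^sub>0"
  shows "zb_F a b 0 = 1"
  using zb_F_sums[OF assms, of 0] sums_unique2[OF _ powser_sums_zero[of "zb_coeff a b"]] by simp

lemma powser_shift_sums:
  fixes f :: "nat \<Rightarrow> complex"
  assumes "(\<lambda>n. f n * z ^ n) sums s"
  shows "(\<lambda>n. (case n of 0 \<Rightarrow> 0 | Suc m \<Rightarrow> f m) * z ^ n) sums (z * s)"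
proof -
  have "(\<lambda>n. z * (f n * z ^ n)) sums (z * s)" by (intro sums_mult assms)
  hence "(\<lambda>n. (case Suc n of 0 \<Rightarrow> 0 | Suc m \<Rightarrow> f m) * z ^ Suc n) sums (z * s)"
    by (simp add: algebra_simps)
  thus ?thesis by (subst (asm) sums_Suc_iff) simp
qed

lemma one_minus_times_powser_sums:
  fixes f :: "nat \<Rightarrow> complex"
  assumes "(\<lambda>n. f n * z ^ n) sums s"
  shows "(\<lambda>n. (f n - (case n of 0 \<Rightarrow> 0 | Suc m \<Rightarrow> f m)) * z ^ n) sums ((1 - z) * s)"
  using sums_diff[OF assms powser_shift_sums[OF assms]] by (simp add: algebra_simps)

lemma zb_F_has_field_derivative_ball:
  assumes "a + b \<notin> \<int>\<^sub>\<le>\<^sub>0" "norm z < 1"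
  shows "(zb_F a b has_field_derivative zb_H a b z / (1 - z)) (at z)"
proof -
  let ?f = "\<lambda>w. \<Sum>n. zb_coeff a b n * w ^ n"
  have sm: "summable (\<lambda>n. zb_coeff a b n * w ^ n)" if "norm w < 1" for w
    using zb_F_sums[OF assms(1) that] by (simp add: sums_iff)
  have "((?f) has_field_derivative (\<Sum>n. diffs (zb_coeff a b) n * z ^ n)) (at z)"
    by (rule termdiffs_strong'[OF sm assms(2)])
  hence D: "(zb_F a b has_field_derivative (\<Sum>n. diffs (zb_coeff a b) n * z ^ n)) (at z)"
    by (rule has_field_derivative_transform_within_open[where S = "ball 0 1"])
       (use assms zb_F_sums[OF assms(1)] in \<open>auto simp: sums_iff\<close>)
  have "summable (\<lambda>n. diffs (zb_coeff a b) n * z ^ n)"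
    by (rule termdiff_converges[OF assms(2) sm])
  hence "(\<lambda>n. diffs (zb_coeff a b) n * z ^ n) sums (\<Sum>n. diffs (zb_coeff a b) n * z ^ n)"
    by (rule summable_sums)
  note one_minus_times_powser_sums[OF this]
  moreover have "(\<lambda>n. diffs (zb_coeff a b) n - (case n of 0 \<Rightarrow> 0 | Suc m \<Rightarrow> diffs (zb_coeff a b) m)) = zb_diff a b"
    by (auto simp: diffs_def zb_diff_def fun_eq_iff split: nat.splits)
  ultimately have "(1 - z) * (\<Sum>n. diffs (zb_coeff a b) n * z ^ n) = zb_H a b z"
    unfolding zb_H_def sums_iff fun_eq_iff by simp
  moreover have "1 - z \<noteq> 0" using assms(2) by auto
  ultimately have "(\<Sum>n. diffs (zb_coeff a b) n * z ^ n) = zb_H a b z / (1 - z)"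
    by (metis nonzero_mult_div_cancel_left)
  with D show ?thesis by simp
qed

text \<open>At boundary points the power series gives no derivative. But zb_H / (1 - z) is
  continuous up to the boundary away from 1, so it has a primitive on a convex piece of the closed
  disc, differentiable relative to that piece. The primitive differs from \<open>zb_F\<close> by a
  constant inside the disc, and by continuity on the whole piece.\<close>

lemma zb_F_has_field_derivative:
  assumes "a + b \<notin> \<int>\<^sub>\<le>\<^sub>0" "norm z \<le> 1" "z \<noteq> 1"
  shows "(zb_F a b has_field_derivative zb_H a b z / (1 - z)) (at z within cball 0 1)"
proof -
  have Re_lt: "Re z < 1" if "norm z \<le> 1" "z \<noteq> 1" for z :: complex
    using that complex_Re_le_cmod[of z] by (smt (verit) cmod_eq_Re complex_eq_iff one_complex.sel cmod_def
        real_le_rsqrt real_sqrt_le_1_iff zero_less_power2 power2_less_eq_zero_iff one_power2)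
  \<comment> \<open>The half-plane Re w < c cuts off the point 1 and keeps z. Giving 1 the weight
    two thirds makes c positive even when Re z = -1, so that the centre 0 lies in the piece.\<close>
  define c where "c = (2 + Re z) / 3"
  have c: "Re z < c" "c < 1" using Re_lt[OF assms(2,3)] by (auto simp: c_def)
  define S :: "complex set" where "S = cball 0 1 \<inter> {w. Re w < c}"
  have S: "convex S" unfolding S_def by (intro convex_Int convex_halfspace_Re_lt) auto
  have ball: "{w. norm w < 1 \<and> Re w < c} = ball 0 1 \<inter> {w. Re w < c}" by auto
  have int: "interior S \<subseteq> ball 0 1" unfolding S_def
    using interior_mono[of "cball 0 1 \<inter> {w. Re w < c}" "cball (0::complex) 1"] by auto
  have fd: "(zb_F a b has_field_derivative zb_H a b x / (1 - x)) (at x)" if "x \<in> ball 0 1" for x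
    using zb_F_has_field_derivative_ball[OF assms(1)] that by auto
  have cont: "continuous_on S (\<lambda>z. zb_H a b z / (1 - z))"
    unfolding S_def using c
    by (intro continuous_intros continuous_on_subset[OF continuous_on_zb_H[OF assms(1)]]) auto
  have hol: "(\<lambda>z. zb_H a b z / (1 - z)) holomorphic_on ball 0 1"
  proof -
    have "(deriv (zb_F a b)) holomorphic_on ball 0 1"
      using fd by (intro holomorphic_deriv) (auto simp: holomorphic_on_open simp del: mem_ball, blast)
    thus ?thesis
      by (rule holomorphic_transform) (use fd DERIV_imp_deriv in blast)
  qed
  obtain g where g: "\<And>x. x \<in> S \<Longrightarrow> (g has_field_derivative zb_H a b x / (1 - x)) (at x within S)"
  proof (rule holomorphic_convex_primitive[OF S finite.emptyI cont])
    fix x assume "x \<in> interior S - {}"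
    hence "x \<in> ball 0 1" using int by auto
    thus "(\<lambda>z. zb_H a b z / (1 - z)) field_differentiable at x"
      using hol by (auto intro: holomorphic_on_imp_differentiable_at)
  qed blast
  define T where "T = S \<inter> ball 0 1"
  have openT: "open T"
  proof -
    have "T = ball 0 1 \<inter> {w. Re w < c}" by (auto simp: T_def S_def)
    thus ?thesis by (simp add: open_Int open_halfspace_Re_lt)
  qed
  have convT: "convex T" unfolding T_def using S by (intro convex_Int) auto
  have zS: "z \<in> S" using assms c by (auto simp: S_def)
  obtain k where k: "\<And>w. w \<in> T \<Longrightarrow> zb_F a b w - g w = k"
  proof -
    have "\<exists>k. \<forall>w\<in>T. zb_F a b w - g w = k"
    proof (rule has_field_derivative_zero_constant[OF convT])
      fix x assume x: "x \<in> T"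
      have "(g has_field_derivative zb_H a b x / (1 - x)) (at x within T)"
        by (rule has_field_derivative_subset[OF g]) (use x in \<open>auto simp: T_def\<close>)
      moreover have "(zb_F a b has_field_derivative zb_H a b x / (1 - x)) (at x within T)"
        by (rule has_field_derivative_at_within[OF fd]) (use x in \<open>auto simp: T_def\<close>)
      ultimately have "((\<lambda>w. zb_F a b w - g w) has_field_derivative (zb_H a b x / (1 - x) - zb_H a b x / (1 - x))) (at x within T)"
        by (rule DERIV_diff[rotated])
      thus "((\<lambda>w. zb_F a b w - g w) has_field_derivative 0) (at x within T)" by simp
    qed
    thus thesis using that by blast
  qed
  have eqS: "zb_F a b w = g w + k" if w: "w \<in> S" for w
  proof -
    define p :: complex where "p = 0"
    have p: "p \<in> T"
      using c assms(2) abs_Re_le_cmod[of z] by (auto simp: p_def T_def S_def c_def)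
    \<comment> \<open>Contracting w towards the interior point p gives points of T that converge to
      w.\<close>
    define x where "x n = (1 - 1 / (real n + 2)) *\<^sub>R w + (1 / (real n + 2)) *\<^sub>R p" for n
    have lim0: "(\<lambda>n. 1 / (real n + 2)) \<longlonglongrightarrow> 0" by real_asymp
    have "x \<longlonglongrightarrow> (1 - 0) *\<^sub>R w + 0 *\<^sub>R p"
      unfolding x_def by (intro tendsto_intros lim0)
    hence lim: "x \<longlonglongrightarrow> w" by simp
    have xT: "x n \<in> T" for n
    proof -
      have 1: "x n \<in> S"
        unfolding x_def using S w p by (intro convexD) (auto simp: T_def)
      have "norm (x n) \<le> norm ((1 - 1 / (real n + 2)) *\<^sub>R w) + norm ((1 / (real n + 2)) *\<^sub>R p)"
        unfolding x_def by (rule norm_triangle_ineq)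
      also have "\<dots> = (1 - 1 / (real n + 2)) * norm w + (1 / (real n + 2)) * norm p"
        by simp
      also have "\<dots> < (1 - 1 / (real n + 2)) * 1 + (1 / (real n + 2)) * 1"
        using w p by (intro add_le_less_mono mult_left_mono mult_strict_left_mono) (auto simp: S_def T_def)
      finally show ?thesis using 1 by (simp add: T_def)
    qed
    have "continuous_on S g"
      by (rule DERIV_continuous_on[OF g])
    moreover have "continuous_on S (zb_F a b)"
      by (rule continuous_on_subset[OF continuous_on_zb_F[OF assms(1)]]) (use c in \<open>auto simp: S_def\<close>)
    ultimately have "continuous_on S (\<lambda>w. zb_F a b w - g w)"
      by (rule continuous_on_diff[rotated])
    hence "(\<lambda>n. zb_F a b (x n) - g (x n)) \<longlonglongrightarrow> zb_F a b w - g w"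
      by (rule continuous_on_tendsto_compose[OF _ lim w]) (use xT in \<open>auto simp: T_def\<close>)
    hence "(\<lambda>n. k) \<longlonglongrightarrow> zb_F a b w - g w"
      using k xT by simp
    hence "zb_F a b w - g w = k" by (simp add: LIMSEQ_const_iff)
    thus ?thesis by (simp add: algebra_simps)
  qed
  have "((\<lambda>w. g w + k) has_field_derivative zb_H a b z / (1 - z)) (at z within S)"
    using g[OF zS] by (auto intro!: derivative_eq_intros)
  hence "(zb_F a b has_field_derivative zb_H a b z / (1 - z)) (at z within S)"
    by (rule has_field_derivative_transform_within[of _ _ _ _ 1]) (use eqS zS in auto)
  moreover have "at z within S = at z within cball 0 1"
    unfolding S_def using c
    by (intro at_within_nhd[where S = "{w. Re w < c}"]) (auto simp: open_halfspace_Re_lt)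
  ultimately show ?thesis by simp
qed

text \<open>Radial approach from inside. It carries identities between power series over to the
  circle, where the connection formulas live.\<close>

lemma eq_on_cball_minus_1:
  fixes f g :: "complex \<Rightarrow> complex"
  assumes "continuous_on (cball 0 1 - {1}) f" "continuous_on (cball 0 1 - {1}) g"
    and eq: "\<And>z. norm z < 1 \<Longrightarrow> f z = g z"
    and z: "norm z \<le> 1" "z \<noteq> 1"
  shows "f z = g z"
proof -
  define x where "x n = of_real (1 - 1 / (real n + 2)) * z" for n
  have "(\<lambda>n. 1 - 1 / (real n + 2)) \<longlonglongrightarrow> 1" by real_asymp
  hence "x \<longlonglongrightarrow> of_real 1 * z" unfolding x_def by (intro tendsto_intros)
  hence lim: "x \<longlonglongrightarrow> z" by simp
  have x: "norm (x n) < 1" for n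
  proof -
    have "norm (x n) = (1 - 1 / (real n + 2)) * norm z"
      by (simp add: x_def norm_mult flip: of_real_diff of_real_divide)
    also have "\<dots> \<le> (1 - 1 / (real n + 2)) * 1"
      using z by (intro mult_left_mono) auto
    also have "\<dots> < 1" by simp
    finally show ?thesis .
  qed
  have xne: "x n \<noteq> 1" for n using x[of n] by auto
  have "(\<lambda>n. f (x n) - g (x n)) \<longlonglongrightarrow> f z - g z"
    by (rule continuous_on_tendsto_compose[OF continuous_on_diff[OF assms(1,2)] lim])
       (use x xne z in \<open>auto intro!: always_eventually less_imp_le\<close>)
  hence "(\<lambda>n. 0) \<longlonglongrightarrow> f z - g z"
    using eq[OF x] by simp
  thus ?thesis by (simp add: LIMSEQ_const_iff)
qed

lemma zb_H_sums:
  assumes "a + b \<notin> \<int>\<^sub>\<le>\<^sub>0" "norm z \<le> 1"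
  shows "(\<lambda>n. zb_diff a b n * z ^ n) sums zb_H a b z"
  unfolding zb_H_def
  by (intro summable_sums power_series_cball(3) zb_diff_summable assms)

section \<open>Contiguous relations and the ladder system\<close>

text \<open>Raising b raises a + b too, so the neighbour is again zero-balanced and its coefficients
  differ only by a rational factor in n.\<close>

lemma zb_coeff_contiguous:
  assumes "a + b \<notin> \<int>\<^sub>\<le>\<^sub>0" "b \<notin> \<int>\<^sub>\<le>\<^sub>0"
  shows "zb_coeff a (b + 1) n = zb_coeff a b n * ((b + of_nat n) * (a + b)) / (b * (a + b + of_nat n))"
proof -
  have nz: "b \<noteq> 0" "a + b \<noteq> 0" "a + b + of_nat n \<noteq> 0"
     "pochhammer (a + b) n \<noteq> 0" "pochhammer b n \<noteq> 0"
    using assms not_nonpos_Int_add_nat[OF assms(1)] pochhammer_nonzero by auto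
  have 1: "b * pochhammer (b + 1) n = pochhammer b n * (b + of_nat n)"
    by (metis pochhammer_Suc pochhammer_rec)
  have 2: "(a + b) * pochhammer (a + (b + 1)) n = pochhammer (a + b) n * (a + b + of_nat n)"
    by (metis pochhammer_Suc pochhammer_rec add.assoc)
  have 3: "pochhammer (b + 1) n = pochhammer b n * (b + of_nat n) / b"
    using 1 nz by (simp add: field_simps)
  have 4: "pochhammer (a + (b + 1)) n = pochhammer (a + b) n * (a + b + of_nat n) / (a + b)"
    using 2 nz by (simp add: field_simps)
  show ?thesis
    unfolding zb_coeff_def 3 4 using nz by (simp add: divide_simps)
qed

lemma add_1_not_nonpos_Int:
  fixes c :: complex
  shows "c \<notin> \<int>\<^sub>\<le>\<^sub>0 \<Longrightarrow> c + 1 \<notin> \<int>\<^sub>\<le>\<^sub>0"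
  using plus_one_in_nonpos_Ints_imp by blast

text \<open>Both relations are comparisons of coefficients, extended to the boundary by continuity.
  Since \<open>zb_H\<close> is (1 - z) times the derivative, they form a first-order system for the
  parameters b and b + 1: the ladder system of the solutions on the circle, before the power of y is
  attached.\<close>

lemma zb_H_contiguous:
  assumes ab: "a + b \<notin> \<int>\<^sub>\<le>\<^sub>0" and b: "b \<notin> \<int>\<^sub>\<le>\<^sub>0" and z: "norm z \<le> 1" "z \<noteq> 1"
  shows "zb_H a b z = b * (zb_F a b z - b / (a + b) * zb_F a (b + 1) z)"
    and "z * zb_H a (b + 1) z = (a + b) * (zb_F a b z - zb_F a (b + 1) z) + a * z * zb_F a (b + 1) z"
proof -
  have ab1: "a + (b + 1) \<notin> \<int>\<^sub>\<le>\<^sub>0"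
    using add_1_not_nonpos_Int[OF ab] by (simp add: add.assoc)
  have nz: "b \<noteq> 0" "a + b \<noteq> 0" using ab b by auto
  have contH: "continuous_on (cball 0 1 - {1}) (zb_H a b)" "continuous_on (cball 0 1 - {1}) (zb_H a (b + 1))"
    using continuous_on_zb_H[OF ab] continuous_on_zb_H[OF ab1] by (auto intro: continuous_on_subset)
  note cont = contH continuous_on_zb_F[OF ab] continuous_on_zb_F[OF ab1]
  show "zb_H a b z = b * (zb_F a b z - b / (a + b) * zb_F a (b + 1) z)"
  proof (rule eq_on_cball_minus_1[OF _ _ _ z])
    fix w :: complex assume w: "norm w < 1"
    have "(\<lambda>n. b * (zb_coeff a b n * w ^ n - b / (a + b) * (zb_coeff a (b + 1) n * w ^ n))) sums
            (b * (zb_F a b w - b / (a + b) * zb_F a (b + 1) w))"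
      by (intro sums_mult sums_diff zb_F_sums ab ab1 w)
    moreover have "b * (zb_coeff a b n * w ^ n - b / (a + b) * (zb_coeff a (b + 1) n * w ^ n)) = zb_diff a b n * w ^ n" for n
      unfolding zb_diff_eq[OF ab] zb_coeff_contiguous[OF ab b]
      using nz not_nonpos_Int_add_nat[OF ab, of n] by (simp add: divide_simps) (simp add: algebra_simps)
    ultimately have "(\<lambda>n. zb_diff a b n * w ^ n) sums (b * (zb_F a b w - b / (a + b) * zb_F a (b + 1) w))"
      by simp
    thus "zb_H a b w = b * (zb_F a b w - b / (a + b) * zb_F a (b + 1) w)"
      using zb_H_sums[OF ab, of w] w by (intro sums_unique2) auto
  qed (intro continuous_intros cont)+
  show "z * zb_H a (b + 1) z = (a + b) * (zb_F a b z - zb_F a (b + 1) z) + a * z * zb_F a (b + 1) z"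
  proof (rule eq_on_cball_minus_1[OF _ _ _ z])
    fix w :: complex assume w: "norm w < 1"
    let ?s = "\<lambda>(c :: nat \<Rightarrow> complex) n. (case n of 0 \<Rightarrow> 0 | Suc m \<Rightarrow> c m)"
    have "(\<lambda>n. (a + b) * (zb_coeff a b n * w ^ n - zb_coeff a (b + 1) n * w ^ n)
               + a * (?s (zb_coeff a (b + 1)) n * w ^ n)) sums
            ((a + b) * (zb_F a b w - zb_F a (b + 1) w) + a * (w * zb_F a (b + 1) w))"
      by (intro sums_mult sums_diff sums_add powser_shift_sums zb_F_sums ab ab1 w)
    moreover have "(\<lambda>n. ?s (zb_diff a (b + 1)) n * w ^ n) sums (w * zb_H a (b + 1) w)"
      by (rule powser_shift_sums[OF zb_H_sums[OF ab1]]) (use w in auto)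
    moreover have "(a + b) * (zb_coeff a b n * w ^ n - zb_coeff a (b + 1) n * w ^ n)
               + a * (?s (zb_coeff a (b + 1)) n * w ^ n) = ?s (zb_diff a (b + 1)) n * w ^ n" for n
    proof (cases n)
      case (Suc m)
      have n1: "a + b + 1 + of_nat m \<noteq> 0" "b + 1 + of_nat m \<noteq> 0"
        using not_nonpos_Int_add_nat[OF ab, of "Suc m"] not_nonpos_Int_add_nat[OF b, of "Suc m"]
        by (auto simp: add_ac)
      define D1 where "D1 = b + 1 + of_nat m"
      define D2 where "D2 = a + b + 1 + of_nat m"
      have D: "D1 \<noteq> 0" "D2 \<noteq> 0" using n1 by (auto simp: D1_def D2_def)
      have c1: "zb_coeff a (b + 1) (Suc m) = zb_coeff a b (Suc m) * (D1 * (a + b)) / (b * D2)"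
        using zb_coeff_contiguous[OF ab b, of "Suc m"] by (simp add: D1_def D2_def add_ac)
      have c1': "(a + b) * zb_coeff a b (Suc m) = zb_coeff a (b + 1) (Suc m) * (b * (a + b + 1 + of_nat m)) / (b + 1 + of_nat m)"
        unfolding c1 D1_def[symmetric] D2_def[symmetric] using nz D by simp
      have c2: "(1 + of_nat m) * zb_coeff a (b + 1) (Suc m) * (a + b + 1 + of_nat m) = zb_coeff a (b + 1) m * (a + of_nat m) * (b + 1 + of_nat m)"
        using zb_coeff_Suc[OF ab1, of m] by (simp add: add_ac)
      have c2': "zb_coeff a (b + 1) m * (a + of_nat m) = (1 + of_nat m) * zb_coeff a (b + 1) (Suc m) * (a + b + 1 + of_nat m) / (b + 1 + of_nat m)"
        using c2 n1 by (simp add: field_simps)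
      have "(a + b) * (zb_coeff a b (Suc m) - zb_coeff a (b + 1) (Suc m)) + a * zb_coeff a (b + 1) m
            = (1 + of_nat m) * zb_coeff a (b + 1) (Suc m) - of_nat m * zb_coeff a (b + 1) m"
      proof -
        have "(a + b) * (zb_coeff a b (Suc m) - zb_coeff a (b + 1) (Suc m)) + (zb_coeff a (b + 1) m * (a + of_nat m))
           = (1 + of_nat m) * zb_coeff a (b + 1) (Suc m)"
          unfolding c2' right_diff_distrib c1' using n1 by (simp add: divide_simps) (simp add: algebra_simps)
        thus ?thesis by (simp add: algebra_simps)
      qed
      from arg_cong[OF this, of "\<lambda>t. t * w ^ n"] show ?thesis
        unfolding Suc by (simp add: zb_diff_def algebra_simps)
    qed (auto)
    ultimately have "w * zb_H a (b + 1) w = (a + b) * (zb_F a b w - zb_F a (b + 1) w) + a * (w * zb_F a (b + 1) w)"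
      by (simp only: sums_unique2)
    thus "w * zb_H a (b + 1) w = (a + b) * (zb_F a b w - zb_F a (b + 1) w) + a * w * zb_F a (b + 1) w"
      by (simp add: mult.assoc)
  qed (intro continuous_intros cont)+
qed

text \<open>With z = (1 - x)/2 one has 1 - x^2 = 4 z (1 - z) and d/dx = - (1/2) d/dz, so - 2 z
  \<open>zb_H\<close> is (1 - x^2) times the x-derivative. These are the two ladder equations of
  P_\<nu> and P_(\<nu>+1), free of denominators.\<close>

lemma zb_F_legendre_ladder:
  fixes \<nu> z :: complex
  assumes z: "norm z < 1"
  defines "n \<equiv> \<nu> + 1"
  shows "- (2 * z * zb_H (-\<nu>) (\<nu> + 1) z) = n * ((1 - 2 * z) * zb_F (-\<nu>) (\<nu> + 1) z - zb_F (-(\<nu> + 1)) (\<nu> + 1 + 1) z)"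
    and "- (2 * z * zb_H (-(\<nu> + 1)) (\<nu> + 1 + 1) z) = n * (zb_F (-\<nu>) (\<nu> + 1) z - (1 - 2 * z) * zb_F (-(\<nu> + 1)) (\<nu> + 1 + 1) z)"
proof -
  let ?s = "\<lambda>(c :: nat \<Rightarrow> complex) n. (case n of 0 \<Rightarrow> 0 | Suc m \<Rightarrow> c m)"
  define p where "p = zb_coeff (-\<nu>) (\<nu> + 1)"
  define r where "r = zb_coeff (-(\<nu> + 1)) (\<nu> + 1 + 1)"
  \<comment> \<open>A common factor from which p and r at the indices m and m + 1 are obtained by
    polynomial factors, so that the recurrences become polynomial identities. At index m the
    relations stay in product form because n + m and n - m may vanish.\<close>
  define e where "e m = pochhammer (-\<nu>) m * pochhammer (\<nu> + 2) m / (fact (Suc m) ^ 2)" for m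
  have one: "- \<nu> + (\<nu> + 1) \<notin> \<int>\<^sub>\<le>\<^sub>0" "-(\<nu> + 1) + (\<nu> + 1 + 1) \<notin> \<int>\<^sub>\<le>\<^sub>0" by auto
  have fs: "pochhammer (1 :: complex) m = fact m" for m by (simp add: pochhammer_fact)
  have Sm: "of_nat (Suc m) \<noteq> (0 :: complex)" for m by (metis of_nat_eq_0_iff old.nat.distinct(2))
  have p1: "p (Suc m) = e m * n * (of_nat m - \<nu>)" for m
  proof -
    have "pochhammer (\<nu> + 1) (Suc m) = (\<nu> + 1) * pochhammer (\<nu> + 2) m"
      by (simp add: pochhammer_rec add.assoc)
    thus ?thesis
      by (simp add: p_def zb_coeff_def fs e_def n_def pochhammer_Suc[of "-\<nu>"] power2_eq_square del: fact_Suc)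
  qed
  have r1: "r (Suc m) = - e m * n * (of_nat m + 1 + n)" for m
  proof -
    have "pochhammer (-(\<nu> + 1)) (Suc m) = -(\<nu> + 1) * pochhammer (-\<nu>) m"
      by (simp add: pochhammer_rec)
    moreover have "pochhammer (\<nu> + 1 + 1) (Suc m) = pochhammer (\<nu> + 2) m * (of_nat m + 1 + (\<nu> + 1))"
      by (simp add: pochhammer_Suc add_ac)
    moreover have "-(\<nu> + 1) + (\<nu> + 1 + 1) = 1" by simp
    moreover have "(- c * X) * (Y * W) / (f * f) = - (X * Y / (f * f)) * c * W" for c X Y W f :: complex
      by (simp add: mult_ac)
    ultimately show ?thesis
      unfolding r_def zb_coeff_def e_def n_def power2_eq_square by (simp only: fs)
  qed
  have e0: "e m * (of_nat m + 1)\<^sup>2 = pochhammer (-\<nu>) m * pochhammer (\<nu> + 2) m / (fact m * fact m)" for m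
  proof -
    have "fact (Suc m) = (of_nat m + 1) * (fact m :: complex)" by simp
    moreover have "of_nat m + 1 \<noteq> (0 :: complex)" using Sm[of m] by (simp add: add.commute)
    ultimately show ?thesis
      unfolding e_def by (simp add: power_mult_distrib power2_eq_square del: fact_Suc)
  qed
  have p0: "(n + of_nat m) * p m = n * e m * (of_nat m + 1)\<^sup>2" for m
  proof -
    have "n * pochhammer (\<nu> + 2) m = pochhammer (\<nu> + 1) m * (n + of_nat m)"
      unfolding n_def by (metis pochhammer_Suc pochhammer_rec add.assoc one_add_one)
    moreover have "(n + of_nat m) * (A * B / (f * f)) = A * (B * (n + of_nat m)) / (f * f)" for A B f :: complex
      by simp
    ultimately show ?thesis unfolding p_def zb_coeff_def using e0[of m] by (simp add: fs mult_ac)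
  qed
  have r0: "(n - of_nat m) * r m = n * e m * (of_nat m + 1)\<^sup>2" for m
  proof -
    have "- n * pochhammer (-\<nu>) m = pochhammer (-(\<nu> + 1)) m * (- n + of_nat m)"
      unfolding n_def using pochhammer_Suc[of "-(\<nu> + 1)" m] pochhammer_rec[of "-(\<nu> + 1)" m] by simp
    hence "pochhammer (-(\<nu> + 1)) m * (n - of_nat m) = n * pochhammer (-\<nu>) m"
      by (simp add: algebra_simps)
    moreover have "(n - of_nat m) * (A * B / (f * f)) = (A * (n - of_nat m)) * B / (f * f)" for A B f :: complex
      by simp
    moreover have "\<nu> + 1 + 1 = \<nu> + 2" "-(\<nu> + 1) + (\<nu> + 2) = 1" by simp_all
    ultimately show ?thesis unfolding r_def zb_coeff_def using e0[of m] by (simp only: fs mult.assoc) simp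
  qed
  have F: "(\<lambda>k. p k * z ^ k) sums zb_F (-\<nu>) (\<nu> + 1) z" "(\<lambda>k. r k * z ^ k) sums zb_F (-(\<nu> + 1)) (\<nu> + 1 + 1) z"
    unfolding p_def r_def by (intro zb_F_sums one z)+
  have H: "(\<lambda>k. ?s (\<lambda>k. of_nat (Suc k) * p (Suc k) - of_nat k * p k) k * z ^ k) sums (z * zb_H (-\<nu>) (\<nu> + 1) z)"
    "(\<lambda>k. ?s (\<lambda>k. of_nat (Suc k) * r (Suc k) - of_nat k * r k) k * z ^ k) sums (z * zb_H (-(\<nu> + 1)) (\<nu> + 1 + 1) z)"
    using zb_H_sums[OF one(1), of z] zb_H_sums[OF one(2), of z] z
    unfolding p_def r_def zb_diff_def by (intro powser_shift_sums; simp)+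
  have "(\<lambda>k. - 2 * (?s (\<lambda>k. of_nat (Suc k) * p (Suc k) - of_nat k * p k) k * z ^ k)) sums
          (- 2 * (z * zb_H (-\<nu>) (\<nu> + 1) z))"
    by (intro sums_mult H)
  moreover have "(\<lambda>k. n * (p k * z ^ k - 2 * (?s p k * z ^ k) - r k * z ^ k)) sums
          (n * (zb_F (-\<nu>) (\<nu> + 1) z - 2 * (z * zb_F (-\<nu>) (\<nu> + 1) z) - zb_F (-(\<nu> + 1)) (\<nu> + 1 + 1) z))"
    by (intro sums_mult sums_diff powser_shift_sums F)
  moreover have "- 2 * (?s (\<lambda>k. of_nat (Suc k) * p (Suc k) - of_nat k * p k) k * z ^ k) =
                 n * (p k * z ^ k - 2 * (?s p k * z ^ k) - r k * z ^ k)" for k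
  proof (cases k)
    case (Suc m)
    have "- 2 * (of_nat (Suc m) * p (Suc m) - of_nat m * p m) - n * (p (Suc m) - 2 * p m - r (Suc m)) =
       - (n + 2 * of_nat m + 2) * p (Suc m) + 2 * ((n + of_nat m) * p m) + n * r (Suc m)"
      by (simp add: algebra_simps)
    also have "\<dots> = 0" unfolding p0 p1 r1 by (simp add: n_def power2_eq_square algebra_simps)
    finally have "- 2 * (of_nat (Suc m) * p (Suc m) - of_nat m * p m) = n * (p (Suc m) - 2 * p m - r (Suc m))"
      by simp
    from arg_cong[OF this, of "\<lambda>t. t * z ^ k"] show ?thesis unfolding Suc by (simp add: algebra_simps)
  qed (simp add: p_def r_def)
  ultimately have "- 2 * (z * zb_H (-\<nu>) (\<nu> + 1) z) = n * (zb_F (-\<nu>) (\<nu> + 1) z - 2 * (z * zb_F (-\<nu>) (\<nu> + 1) z) - zb_F (-(\<nu> + 1)) (\<nu> + 1 + 1) z)"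
    by (simp add: sums_unique2)
  thus "- (2 * z * zb_H (-\<nu>) (\<nu> + 1) z) = n * ((1 - 2 * z) * zb_F (-\<nu>) (\<nu> + 1) z - zb_F (-(\<nu> + 1)) (\<nu> + 1 + 1) z)"
    by (simp add: algebra_simps)
  have "(\<lambda>k. - 2 * (?s (\<lambda>k. of_nat (Suc k) * r (Suc k) - of_nat k * r k) k * z ^ k)) sums
          (- 2 * (z * zb_H (-(\<nu> + 1)) (\<nu> + 1 + 1) z))"
    by (intro sums_mult H)
  moreover have "(\<lambda>k. n * (p k * z ^ k + 2 * (?s r k * z ^ k) - r k * z ^ k)) sums
          (n * (zb_F (-\<nu>) (\<nu> + 1) z + 2 * (z * zb_F (-(\<nu> + 1)) (\<nu> + 1 + 1) z) - zb_F (-(\<nu> + 1)) (\<nu> + 1 + 1) z))"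
    by (intro sums_mult sums_diff sums_add powser_shift_sums F)
  moreover have "- 2 * (?s (\<lambda>k. of_nat (Suc k) * r (Suc k) - of_nat k * r k) k * z ^ k) =
                 n * (p k * z ^ k + 2 * (?s r k * z ^ k) - r k * z ^ k)" for k
  proof (cases k)
    case (Suc m)
    have "- 2 * (of_nat (Suc m) * r (Suc m) - of_nat m * r m) - n * (p (Suc m) + 2 * r m - r (Suc m)) =
       - (2 * of_nat m + 2 - n) * r (Suc m) - 2 * ((n - of_nat m) * r m) - n * p (Suc m)"
      by (simp add: algebra_simps)
    also have "\<dots> = 0" unfolding r0 p1 r1 by (simp add: n_def power2_eq_square algebra_simps)
    finally have "- 2 * (of_nat (Suc m) * r (Suc m) - of_nat m * r m) = n * (p (Suc m) + 2 * r m - r (Suc m))"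
      by simp
    from arg_cong[OF this, of "\<lambda>t. t * z ^ k"] show ?thesis unfolding Suc by (simp add: algebra_simps)
  qed (simp add: p_def r_def)
  ultimately have "- 2 * (z * zb_H (-(\<nu> + 1)) (\<nu> + 1 + 1) z) = n * (zb_F (-\<nu>) (\<nu> + 1) z + 2 * (z * zb_F (-(\<nu> + 1)) (\<nu> + 1 + 1) z) - zb_F (-(\<nu> + 1)) (\<nu> + 1 + 1) z)"
    by (simp add: sums_unique2)
  thus "- (2 * z * zb_H (-(\<nu> + 1)) (\<nu> + 1 + 1) z) = n * (zb_F (-\<nu>) (\<nu> + 1) z - (1 - 2 * z) * zb_F (-(\<nu> + 1)) (\<nu> + 1 + 1) z)"
    by (simp add: algebra_simps)
qed

section \<open>Legendre functions of the first kind and their ladder equations\<close>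

lemma legendre_P_eq_zb_F:
  assumes "-1 < x" "x < 3"
  shows "legendre_P \<mu> x = zb_F (-\<mu>) (\<mu> + 1) (of_real ((1 - x) / 2))"
proof -
  have "norm (complex_of_real ((1 - x) / 2)) < 1"
    unfolding norm_of_real using assms by (auto simp: abs_if)
  from zb_F_eq_hypergeo[OF _ this, of "-\<mu>" "\<mu> + 1"] show ?thesis
    by (simp add: legendre_P_def)
qed

lemma legendre_P_1: "legendre_P \<mu> 1 = 1"
  by (subst legendre_P_eq_zb_F) (auto simp: zb_F_0)

text \<open>The series in (1 - x)/2 converges for -1 < x < 3, so x = 1 is an interior point. The
  two-sided derivative there yields differentiability in \<theta> at \<theta> = 0.\<close>

lemma legendre_P_has_field_derivative:
  assumes "-1 < x" "x < 3"
  shows "(legendre_P \<mu> has_vector_derivative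
           (- (1 / 2) * (zb_H (-\<mu>) (\<mu> + 1) (of_real ((1 - x) / 2)) / (1 - of_real ((1 - x) / 2))))) (at x)"
proof -
  let ?z = "complex_of_real ((1 - x) / 2)"
  have n: "norm ?z < 1" unfolding norm_of_real using assms by (auto simp: abs_if)
  have D: "(zb_F (-\<mu>) (\<mu> + 1) has_field_derivative zb_H (-\<mu>) (\<mu> + 1) ?z / (1 - ?z)) (at ?z)"
    by (rule zb_F_has_field_derivative_ball) (use n in auto)
  have L: "((\<lambda>x. complex_of_real ((1 - x) / 2)) has_vector_derivative - (1/2)) (at x)"
    by (auto intro!: derivative_eq_intros simp: has_vector_derivative_def scaleR_conv_of_real)
  from field_vector_diff_chain_at[OF L D]
  have "((\<lambda>x. zb_F (-\<mu>) (\<mu> + 1) (of_real ((1 - x) / 2))) has_vector_derivative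
          - (1/2) * (zb_H (-\<mu>) (\<mu> + 1) ?z / (1 - ?z))) (at x)"
    by (simp add: o_def)
  thus ?thesis
    by (rule has_vector_derivative_transform_within_open[where S = "{-1<..<3}"])
       (use assms legendre_P_eq_zb_F in auto)
qed

lemma legendre_P_ladder:
  fixes x :: real
  assumes x: "-1 < x" "x < 1"
  shows "(legendre_P \<nu> has_vector_derivative
           (\<nu> + 1) * (of_real x * legendre_P \<nu> x - legendre_P (\<nu> + 1) x) / of_real (1 - x\<^sup>2)) (at x)"
    and "(legendre_P (\<nu> + 1) has_vector_derivative
           (\<nu> + 1) * (legendre_P \<nu> x - of_real x * legendre_P (\<nu> + 1) x) / of_real (1 - x\<^sup>2)) (at x)"
proof -
  let ?z = "complex_of_real ((1 - x) / 2)"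
  have n: "norm ?z < 1" unfolding norm_of_real using x by (auto simp: abs_if)
  have z: "?z \<noteq> 0" "1 - ?z \<noteq> 0" using x n by (auto simp: complex_eq_iff)
  have e: "complex_of_real (1 - x\<^sup>2) = 4 * ?z * (1 - ?z)" "complex_of_real x = 1 - 2 * ?z"
    by (simp_all add: field_simps power2_eq_square)
  note L = zb_F_legendre_ladder[OF n, of \<nu>]
  have P: "legendre_P \<nu> x = zb_F (-\<nu>) (\<nu> + 1) ?z" "legendre_P (\<nu> + 1) x = zb_F (-(\<nu>+1)) (\<nu> + 1 + 1) ?z"
    using x by (simp_all add: legendre_P_eq_zb_F)
  have val: "(\<nu> + 1) * A / (4 * z * (1 - z)) = - (1 / 2) * (H / (1 - z))"
    if "- (2 * z * H) = (\<nu> + 1) * A" "z \<noteq> 0" "1 - z \<noteq> 0" for A H z :: complex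
    unfolding that(1)[symmetric] using that(2,3) by (simp add: divide_simps)
  show "(legendre_P \<nu> has_vector_derivative
           (\<nu> + 1) * (of_real x * legendre_P \<nu> x - legendre_P (\<nu> + 1) x) / of_real (1 - x\<^sup>2)) (at x)"
    unfolding P e val[OF L(1) z] using legendre_P_has_field_derivative[of x \<nu>] x by simp
  show "(legendre_P (\<nu> + 1) has_vector_derivative
           (\<nu> + 1) * (legendre_P \<nu> x - of_real x * legendre_P (\<nu> + 1) x) / of_real (1 - x\<^sup>2)) (at x)"
    unfolding P e val[OF L(2) z] using legendre_P_has_field_derivative[of x "\<nu> + 1"] x by simp
qed

section \<open>Connection formulas on the unit circle\<close>

text \<open>Up to a constant factor, circ_Q (\<nu> + 1) is a Legendre function of the second kind of degree \<nu>.\<close>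

definition circ_Q :: "real \<Rightarrow> real \<Rightarrow> complex" where
  "circ_Q b \<theta> = cis (b * \<theta>) * zb_F (1 / 2) (of_real b) (cis (2 * \<theta>))"

text \<open>The ladder system of (P_\<nu>, P_{\<nu>+1}), n = \<nu> + 1, after the substitution x = cos \<theta>.\<close>

definition legendre_pair :: "complex \<Rightarrow> (real \<Rightarrow> complex) \<Rightarrow> (real \<Rightarrow> complex) \<Rightarrow> bool" where
  "legendre_pair n u U \<longleftrightarrow> (\<forall>\<theta>\<in>{0<..<pi}.
     (u has_vector_derivative - (n * (of_real (cos \<theta>) * u \<theta> - U \<theta>) / of_real (sin \<theta>))) (at \<theta>) \<and>
     (U has_vector_derivative - (n * (u \<theta> - of_real (cos \<theta>) * U \<theta>) / of_real (sin \<theta>))) (at \<theta>))"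

text \<open>This is the symmetry \<mu> -> -\<mu> - 1 of the Legendre equation. It lets the
  construction of \<open>circ_Q\<close> with the negative parameter b = -n supply a second solution
  of the same system.\<close>

lemma legendre_pair_swap: "legendre_pair n u U \<Longrightarrow> legendre_pair (-n) U u"
  unfolding legendre_pair_def by (simp add: field_simps)

lemma legendre_pair_scale:
  assumes "legendre_pair n u U"
  shows "legendre_pair n (\<lambda>\<theta>. c * u \<theta>) (\<lambda>\<theta>. c * U \<theta>)"
  unfolding legendre_pair_def
proof (intro ballI conjI)
  fix \<theta> assume "\<theta> \<in> {0<..<pi}"
  hence D: "(u has_vector_derivative - (n * (of_real (cos \<theta>) * u \<theta> - U \<theta>) / of_real (sin \<theta>))) (at \<theta>)"
     "(U has_vector_derivative - (n * (u \<theta> - of_real (cos \<theta>) * U \<theta>) / of_real (sin \<theta>))) (at \<theta>)"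
    using assms by (auto simp: legendre_pair_def)
  show "((\<lambda>\<theta>. c * u \<theta>) has_vector_derivative - (n * (of_real (cos \<theta>) * (c * u \<theta>) - c * U \<theta>) / of_real (sin \<theta>))) (at \<theta>)"
    using has_vector_derivative_mult_right[OF D(1), of c] by (simp add: algebra_simps)
  show "((\<lambda>\<theta>. c * U \<theta>) has_vector_derivative - (n * (c * u \<theta> - of_real (cos \<theta>) * (c * U \<theta>)) / of_real (sin \<theta>))) (at \<theta>)"
    using has_vector_derivative_mult_right[OF D(2), of c] by (simp add: algebra_simps)
qed

text \<open>The coefficient matrix of the system has trace zero, so the Wronskian has derivative
  zero.\<close>

lemma legendre_pair_wronskian:
  assumes "legendre_pair n u U" "legendre_pair n v V"
  obtains c where "\<And>\<theta>. \<theta> \<in> {0<..<pi} \<Longrightarrow> u \<theta> * V \<theta> - v \<theta> * U \<theta> = c"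
proof -
  have "\<exists>c. \<forall>\<theta>\<in>{0<..<pi}. u \<theta> * V \<theta> - v \<theta> * U \<theta> = c"
  proof (rule has_vector_derivative_zero_constant)
    fix \<theta> assume t: "\<theta> \<in> {0<..<pi}"
    hence s: "complex_of_real (sin \<theta>) \<noteq> 0" using sin_gt_zero[of \<theta>] by auto
    have "((\<lambda>\<theta>. u \<theta> * V \<theta> - v \<theta> * U \<theta>) has_vector_derivative
       (u \<theta> * (- (n * (v \<theta> - of_real (cos \<theta>) * V \<theta>) / of_real (sin \<theta>))) +
        (- (n * (of_real (cos \<theta>) * u \<theta> - U \<theta>) / of_real (sin \<theta>))) * V \<theta>) -
       (v \<theta> * (- (n * (u \<theta> - of_real (cos \<theta>) * U \<theta>) / of_real (sin \<theta>))) +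
        (- (n * (of_real (cos \<theta>) * v \<theta> - V \<theta>) / of_real (sin \<theta>))) * U \<theta>)) (at \<theta>)"
      by (intro has_vector_derivative_diff has_vector_derivative_mult)
         (use assms t in \<open>auto simp: legendre_pair_def\<close>)
    also have "(u \<theta> * (- (n * (v \<theta> - of_real (cos \<theta>) * V \<theta>) / of_real (sin \<theta>))) +
        (- (n * (of_real (cos \<theta>) * u \<theta> - U \<theta>) / of_real (sin \<theta>))) * V \<theta>) -
       (v \<theta> * (- (n * (u \<theta> - of_real (cos \<theta>) * U \<theta>) / of_real (sin \<theta>))) +
        (- (n * (of_real (cos \<theta>) * v \<theta> - V \<theta>) / of_real (sin \<theta>))) * U \<theta>) = 0"
      using s by (simp add: divide_simps) (simp add: algebra_simps)
    finally show "((\<lambda>\<theta>. u \<theta> * V \<theta> - v \<theta> * U \<theta>) has_vector_derivative 0) (at \<theta> within {0<..<pi})"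
      by (rule has_vector_derivative_at_within)
  qed auto
  thus thesis using that by blast
qed

lemma legendre_pair_P:
  "legendre_pair (\<nu> + 1) (\<lambda>\<theta>. legendre_P \<nu> (cos \<theta>)) (\<lambda>\<theta>. legendre_P (\<nu> + 1) (cos \<theta>))"
  "legendre_pair (\<nu> + 1) (\<lambda>\<theta>. legendre_P \<nu> (- cos \<theta>)) (\<lambda>\<theta>. - legendre_P (\<nu> + 1) (- cos \<theta>))"
proof -
  have c: "-1 < cos \<theta>" "cos \<theta> < 1" "sin \<theta> > 0" if "\<theta> \<in> {0<..<pi}" for \<theta>
    using that cos_monotone_0_pi[of \<theta> pi] cos_monotone_0_pi[of 0 \<theta>] sin_gt_zero[of \<theta>] by auto
  have s2: "1 - (cos \<theta>)\<^sup>2 = sin \<theta> * sin \<theta>" for \<theta> :: real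
    using sin_squared_eq[of \<theta>] by (simp add: power2_eq_square)
  have val: "of_real (- sin \<theta>) * (n * A / of_real (1 - (cos \<theta>)\<^sup>2)) = - (n * A / complex_of_real (sin \<theta>))"
    if "\<theta> \<in> {0<..<pi}" for \<theta> n A
    using c[OF that] unfolding s2 by simp
  show "legendre_pair (\<nu> + 1) (\<lambda>\<theta>. legendre_P \<nu> (cos \<theta>)) (\<lambda>\<theta>. legendre_P (\<nu> + 1) (cos \<theta>))"
    unfolding legendre_pair_def
  proof (intro ballI)
    fix \<theta> assume t: "\<theta> \<in> {0<..<pi}"
    have dcos: "(cos has_vector_derivative - sin \<theta>) (at \<theta>)"
      by (auto intro!: derivative_eq_intros simp flip: has_real_derivative_iff_has_vector_derivative)
    note D = legendre_P_ladder[OF c(1,2)[OF t], of \<nu>]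
    from vector_diff_chain_at[OF dcos D(1)] vector_diff_chain_at[OF dcos D(2)]
    show "((\<lambda>\<theta>. legendre_P \<nu> (cos \<theta>)) has_vector_derivative
         - ((\<nu> + 1) * (complex_of_real (cos \<theta>) * legendre_P \<nu> (cos \<theta>) - legendre_P (\<nu> + 1) (cos \<theta>)) / complex_of_real (sin \<theta>))) (at \<theta>) \<and>
        ((\<lambda>\<theta>. legendre_P (\<nu> + 1) (cos \<theta>)) has_vector_derivative
         - ((\<nu> + 1) * (legendre_P \<nu> (cos \<theta>) - complex_of_real (cos \<theta>) * legendre_P (\<nu> + 1) (cos \<theta>)) / complex_of_real (sin \<theta>))) (at \<theta>)"
      unfolding o_def scaleR_conv_of_real val[OF t] by blast
  qed
  show "legendre_pair (\<nu> + 1) (\<lambda>\<theta>. legendre_P \<nu> (- cos \<theta>)) (\<lambda>\<theta>. - legendre_P (\<nu> + 1) (- cos \<theta>))"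
    unfolding legendre_pair_def
  proof (intro ballI)
    fix \<theta> assume t: "\<theta> \<in> {0<..<pi}"
    have dcos: "((\<lambda>\<theta>. - cos \<theta>) has_vector_derivative sin \<theta>) (at \<theta>)"
      by (auto intro!: derivative_eq_intros simp flip: has_real_derivative_iff_has_vector_derivative)
    have c': "-1 < - cos \<theta>" "- cos \<theta> < 1" using c[OF t] by auto
    have val': "of_real (sin \<theta>) * (n * A / of_real (1 - (- cos \<theta>)\<^sup>2)) = n * A / complex_of_real (sin \<theta>)" for n A
      using c[OF t] unfolding power2_minus s2 by simp
    have val1: "of_real (sin \<theta>) * (n * (of_real (- cos \<theta>) * p - q) / of_real (1 - (- cos \<theta>)\<^sup>2)) =
        - (n * (of_real (cos \<theta>) * p - - q) / complex_of_real (sin \<theta>))" for n p q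
    proof -
      have "of_real (- cos \<theta>) * p - q = - (of_real (cos \<theta>) * p - - q)" by simp
      thus ?thesis unfolding val' by (simp only: mult_minus_right divide_minus_left)
    qed
    have val2: "- (of_real (sin \<theta>) * (n * (p - of_real (- cos \<theta>) * q) / of_real (1 - (- cos \<theta>)\<^sup>2))) =
        - (n * (p - of_real (cos \<theta>) * - q) / complex_of_real (sin \<theta>))" for n p q
      unfolding val' by simp
    note D = legendre_P_ladder[OF c', of \<nu>]
    from vector_diff_chain_at[OF dcos D(1)] has_vector_derivative_minus[OF vector_diff_chain_at[OF dcos D(2)]]
    show "((\<lambda>\<theta>. legendre_P \<nu> (- cos \<theta>)) has_vector_derivative
         - ((\<nu> + 1) * (complex_of_real (cos \<theta>) * legendre_P \<nu> (- cos \<theta>) - - legendre_P (\<nu> + 1) (- cos \<theta>)) / complex_of_real (sin \<theta>))) (at \<theta>) \<and>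
        ((\<lambda>\<theta>. - legendre_P (\<nu> + 1) (- cos \<theta>)) has_vector_derivative
         - ((\<nu> + 1) * (legendre_P \<nu> (- cos \<theta>) - complex_of_real (cos \<theta>) * - legendre_P (\<nu> + 1) (- cos \<theta>)) / complex_of_real (sin \<theta>))) (at \<theta>)"
      unfolding o_def scaleR_conv_of_real val1 val2 by blast
  qed
qed

lemma cis_double_ne_1:
  assumes "\<theta> \<in> {0<..<pi}"
  shows "cis (2 * \<theta>) \<noteq> 1"
proof
  assume "cis (2 * \<theta>) = 1"
  hence "cos (2 * \<theta>) = 1" by (simp add: complex_eq_iff)
  hence "sin \<theta> = 0" by (simp add: cos_double_sin)
  thus False using sin_gt_zero[of \<theta>] assms by auto
qed

lemma one_minus_cis_double: "1 - cis (2 * \<theta>) = - 2 * \<i> * of_real (sin \<theta>) * cis \<theta>"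
  by (simp add: complex_eq_iff cos_double_sin sin_double power2_eq_square)

lemma cis_double: "cis (2 * \<theta>) = cis \<theta> * cis \<theta>"
  by (simp add: cis_mult)

text \<open>At a boundary point \<open>zb_F\<close> is differentiable only relative to the closed
  disc, which suffices because cis (2\<theta>) never leaves the circle. The factor cis \<theta> /
  sin \<theta> comes from 1 - y^2 = - 2 i y sin \<theta>.\<close>

lemma circ_Q_has_vector_derivative:
  assumes b: "1 / 2 + complex_of_real b \<notin> \<int>\<^sub>\<le>\<^sub>0" and t: "\<theta> \<in> {0<..<pi}"
  shows "(circ_Q b has_vector_derivative
           (\<i> * of_real b * circ_Q b \<theta> - cis \<theta> / of_real (sin \<theta>) * cis (b * \<theta>) * zb_H (1 / 2) (of_real b) (cis (2 * \<theta>)))) (at \<theta>)"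
proof -
  have s: "complex_of_real (sin \<theta>) \<noteq> 0" using sin_gt_zero[of \<theta>] t by auto
  have dc: "((\<lambda>\<theta>. cis (c * \<theta>)) has_vector_derivative (of_real c * \<i> * cis (c * \<theta>))) (at \<theta>)" for c
    unfolding has_vector_derivative_def
    by (auto intro!: derivative_eq_intros simp: scaleR_conv_of_real algebra_simps)
  have "(zb_F (1 / 2) (of_real b) has_field_derivative zb_H (1 / 2) (of_real b) (cis (2 * \<theta>)) / (1 - cis (2 * \<theta>))) (at (cis (2 * \<theta>)) within cball 0 1)"
    by (intro zb_F_has_field_derivative b cis_double_ne_1 t) auto
  hence "(zb_F (1 / 2) (of_real b) has_field_derivative zb_H (1 / 2) (of_real b) (cis (2 * \<theta>)) / (1 - cis (2 * \<theta>))) (at (cis (2 * \<theta>)) within range (\<lambda>\<theta>. cis (2 * \<theta>)))"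
    by (rule has_field_derivative_subset) auto
  from field_vector_diff_chain_within[OF dc[of 2] this]
  have D: "((\<lambda>\<theta>. zb_F (1 / 2) (of_real b) (cis (2 * \<theta>))) has_vector_derivative
      (2 * \<i> * cis (2 * \<theta>)) * (zb_H (1 / 2) (of_real b) (cis (2 * \<theta>)) / (1 - cis (2 * \<theta>)))) (at \<theta>)"
    by (simp add: o_def)
  have val: "(2 * \<i> * cis (2 * \<theta>)) * (h / (1 - cis (2 * \<theta>))) = - (cis \<theta> / of_real (sin \<theta>)) * h" for h
    unfolding one_minus_cis_double unfolding cis_double using s by (simp add: divide_simps)
  from has_vector_derivative_mult[OF dc[of b] D[unfolded val]]
  show ?thesis by (simp add: circ_Q_def[abs_def] mult_ac)
qed

text \<open>The contiguous relations supply the derivatives; the factor b / (b + 1/2) of the partner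
  appears because both series are normalised to 1 at 0. Eliminating the sine by i sin \<theta> = y -
  cos \<theta> and using y^2 + 1 = 2 y cos \<theta> reduces both equations to polynomial
  identities.\<close>

lemma legendre_pair_circ_Q:
  assumes b: "complex_of_real b \<notin> \<int>\<^sub>\<le>\<^sub>0" and b2: "1 / 2 + complex_of_real b \<notin> \<int>\<^sub>\<le>\<^sub>0"
  shows "legendre_pair (of_real b) (circ_Q b) (\<lambda>\<theta>. of_real b / (1 / 2 + of_real b) * circ_Q (b + 1) \<theta>)"
  unfolding legendre_pair_def
proof (intro ballI conjI)
  fix \<theta> assume t: "\<theta> \<in> {0<..<pi}"
  define s c y Y B where "s = complex_of_real (sin \<theta>)" and "c = complex_of_real (cos \<theta>)"
    and "y = cis \<theta>" and "Y = cis (b * \<theta>)" and "B = complex_of_real b"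
  define F F1 H H1 where "F = zb_F (1/2) B (cis (2 * \<theta>))" and "F1 = zb_F (1/2) (B + 1) (cis (2 * \<theta>))"
    and "H = zb_H (1/2) B (cis (2 * \<theta>))" and "H1 = zb_H (1/2) (B + 1) (cis (2 * \<theta>))"
  have s: "s \<noteq> 0" using sin_gt_zero[of \<theta>] t by (auto simp: s_def)
  have B: "B \<noteq> 0" "1 / 2 + B \<noteq> 0" using b b2 by (auto simp: B_def)
  have y: "\<i> * s = y - c" by (simp add: y_def c_def s_def complex_eq_iff)
  have cy: "2 * c * y = 1 + y * y"
    by (simp add: y_def c_def complex_eq_iff) (simp add: power2_eq_square[symmetric] cos_squared_eq)
  have H: "H = B * (F - B / (1 / 2 + B) * F1)"
    unfolding H_def F_def F1_def B_def
    by (intro zb_H_contiguous b b2 cis_double_ne_1 t) auto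
  have H1: "y * y * H1 = (1 / 2 + B) * (F - F1) + 1 / 2 * (y * y) * F1"
    unfolding H1_def F_def F1_def B_def y_def cis_double[symmetric]
    by (intro zb_H_contiguous b b2 cis_double_ne_1 t) auto
  have Q: "circ_Q b \<theta> = Y * F" "circ_Q (b + 1) \<theta> = Y * y * F1"
    by (simp_all add: circ_Q_def Y_def F_def F1_def y_def B_def cis_mult algebra_simps)
  have "1 / 2 + complex_of_real (b + 1) \<notin> \<int>\<^sub>\<le>\<^sub>0"
    using add_1_not_nonpos_Int[OF b2] by (simp add: add.assoc)
  note D = circ_Q_has_vector_derivative[OF b2 t] circ_Q_has_vector_derivative[OF this t]
  have "\<i> * B * (Y * F) - y / s * Y * H = - (B * (c * (Y * F) - B / (1 / 2 + B) * (Y * y * F1)) / s)"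
  proof -
    have "s * (\<i> * B * (Y * F) - y / s * Y * H) = B * Y * F * (\<i> * s) - y * Y * H"
      using s by (simp add: algebra_simps)
    also have "\<dots> = - (B * (c * (Y * F) - B / (1 / 2 + B) * (Y * y * F1)))"
      unfolding y H by (simp add: algebra_simps)
    finally have "\<i> * B * (Y * F) - y / s * Y * H = - (B * (c * (Y * F) - B / (1 / 2 + B) * (Y * y * F1))) / s"
      using s by (metis nonzero_mult_div_cancel_left)
    thus ?thesis by simp
  qed
  with D(1) show "(circ_Q b has_vector_derivative - (of_real b * (of_real (cos \<theta>) * circ_Q b \<theta> - of_real b / (1 / 2 + of_real b) * circ_Q (b + 1) \<theta>) / of_real (sin \<theta>))) (at \<theta>)"
    unfolding Q B_def[symmetric] c_def[symmetric] s_def[symmetric] y_def[symmetric] Y_def[symmetric] H_def[symmetric] by simp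
  have "B / (1 / 2 + B) * (\<i> * (B + 1) * (Y * y * F1) - y / s * (Y * y) * H1) =
        - (B * (Y * F - c * (B / (1 / 2 + B) * (Y * y * F1))) / s)"
  proof -
    have "s * (\<i> * (B + 1) * (Y * y * F1) - y / s * (Y * y) * H1) = Y * ((B + 1) * y * F1 * (\<i> * s) - y * y * H1)"
      using s by (simp add: algebra_simps)
    also have "\<dots> = Y * (- (1 / 2 + B) * F + B * c * y * F1
                     + F1 * (B * (y * y) + (1 / 2 + B) + 1 / 2 * (y * y) - (B + 1 / 2) * (2 * c * y)))"
      unfolding y H1 by (simp add: field_simps)
    also have "\<dots> = Y * (- (1 / 2 + B) * F + B * c * y * F1)"
      unfolding cy by (simp add: algebra_simps)
    finally have "s * (\<i> * (B + 1) * (Y * y * F1) - y / s * (Y * y) * H1) = Y * (- (1 / 2 + B) * F + B * c * y * F1)" .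
    hence 1: "\<i> * (B + 1) * (Y * y * F1) - y / s * (Y * y) * H1 = Y * (- (1 / 2 + B) * F + B * c * y * F1) / s"
      using s by (metis nonzero_mult_div_cancel_left)
    show ?thesis unfolding 1 using s B by (simp add: divide_simps) (simp add: algebra_simps)
  qed
  moreover have "cis ((b + 1) * \<theta>) = Y * y" by (simp add: Y_def y_def cis_mult algebra_simps)
  ultimately show "((\<lambda>\<theta>. of_real b / (1 / 2 + of_real b) * circ_Q (b + 1) \<theta>) has_vector_derivative
          - (of_real b * (circ_Q b \<theta> - of_real (cos \<theta>) * (of_real b / (1 / 2 + of_real b) * circ_Q (b + 1) \<theta>)) / of_real (sin \<theta>))) (at \<theta>)"
    using has_vector_derivative_mult_right[OF D(2), of "B / (1 / 2 + B)"]
    unfolding Q of_real_add of_real_1 B_def[symmetric] c_def[symmetric] s_def[symmetric] y_def[symmetric] Y_def[symmetric] H1_def[symmetric]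
    by simp
qed

text \<open>Here u is regular at 0 and v may have a logarithmic singularity. The Wronskian is
  rewritten so that v is multiplied only by f, which vanishes to first order; since \<theta> v tends
  to 0 that term disappears and the limit of - u h remains.\<close>

lemma wronskian_limit_left:
  fixes u U v V :: "real \<Rightarrow> complex"
  assumes f: "(f has_vector_derivative f') (at 0)" "f 0 = 0"
    and fV: "\<And>\<theta>. \<theta> \<in> {0<..<pi} \<Longrightarrow> u \<theta> * V \<theta> - v \<theta> * U \<theta> = v \<theta> * f \<theta> - u \<theta> * h \<theta>"
    and v: "((\<lambda>\<theta>. of_real \<theta> * v \<theta>) \<longlongrightarrow> 0) (at_right 0)"
    and h: "(h \<longlongrightarrow> h0) (at_right 0)" and u: "(u \<longlongrightarrow> 1) (at_right 0)"
  shows "((\<lambda>\<theta>. u \<theta> * V \<theta> - v \<theta> * U \<theta>) \<longlongrightarrow> - h0) (at_right 0)"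
proof -
  have "((\<lambda>y. (f y - f 0 - y *\<^sub>R f') /\<^sub>R norm y) \<longlongrightarrow> 0) (at 0)"
    using f(1) unfolding has_vector_derivative_def has_derivative_at_within by (auto simp: divide_inverse)
  hence r: "((\<lambda>y. (f y - (y *\<^sub>R f')) /\<^sub>R norm y) \<longlongrightarrow> 0) (at_right 0)"
    using f(2) by (auto intro: tendsto_mono[OF at_le])
  have "((\<lambda>y. (of_real y * v y) * f' + (of_real y * v y) * ((f y - (y *\<^sub>R f')) /\<^sub>R norm y) - u y * h y)
           \<longlongrightarrow> 0 * f' + 0 * 0 - 1 * h0) (at_right 0)"
    by (intro tendsto_intros v r h u)
  moreover have "eventually (\<lambda>y. (of_real y * v y) * f' + (of_real y * v y) * ((f y - (y *\<^sub>R f')) /\<^sub>R norm y) - u y * h y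
                   = u y * V y - v y * U y) (at_right 0)"
    using eventually_at_right_real[OF pi_gt_zero]
  proof eventually_elim
    case (elim y)
    thus ?case unfolding fV[OF elim] by (simp add: scaleR_conv_of_real field_simps)
  qed
  ultimately show ?thesis by (auto dest: Lim_transform_eventually)
qed

lemma zb_F_real_bound:
  assumes "a + b \<notin> \<int>\<^sub>\<le>\<^sub>0"
  obtains C where "C > 0"
    "\<And>z. norm z \<le> 1 \<Longrightarrow> z \<noteq> 1 \<Longrightarrow> norm (zb_F a b z) \<le> C * (1 + pi + \<bar>ln (norm (1 - z))\<bar>)"
proof -
  obtain C where C: "C > 0" "\<And>z. norm z \<le> 1 \<Longrightarrow> norm (zb_F a b z) \<le> C * (1 + norm (Ln (1 - z)))"
    using zb_F_bound[OF assms] by blast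
  show thesis
  proof (rule that[OF C(1)])
    fix z :: complex assume z: "norm z \<le> 1" "z \<noteq> 1"
    have "norm (Ln (1 - z)) \<le> \<bar>Re (Ln (1 - z))\<bar> + \<bar>Im (Ln (1 - z))\<bar>" by (rule cmod_le)
    also have "\<dots> \<le> \<bar>ln (norm (1 - z))\<bar> + pi"
      using z mpi_less_Im_Ln[of "1 - z"] Im_Ln_le_pi[of "1 - z"] by auto
    finally have "C * (1 + norm (Ln (1 - z))) \<le> C * (1 + pi + \<bar>ln (norm (1 - z))\<bar>)"
      using C(1) by (intro mult_left_mono) auto
    with C(2)[OF z(1)] show "norm (zb_F a b z) \<le> C * (1 + pi + \<bar>ln (norm (1 - z))\<bar>)" by linarith
  qed
qed

lemma circ_Q_bound:
  assumes "1 / 2 + complex_of_real b \<notin> \<int>\<^sub>\<le>\<^sub>0"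
  obtains C where "C > 0" "\<And>\<theta>. \<theta> \<in> {0<..<pi} \<Longrightarrow> norm (circ_Q b \<theta>) \<le> C * (1 + pi + \<bar>ln (2 * sin \<theta>)\<bar>)"
proof -
  obtain C where C: "C > 0" "\<And>z. norm z \<le> 1 \<Longrightarrow> z \<noteq> 1 \<Longrightarrow> norm (zb_F (1 / 2) (of_real b) z) \<le> C * (1 + pi + \<bar>ln (norm (1 - z))\<bar>)"
    using zb_F_real_bound[OF assms] by blast
  show thesis
  proof (rule that[OF C(1)])
    fix \<theta> assume t: "\<theta> \<in> {0<..<pi}"
    have "norm (1 - cis (2 * \<theta>)) = 2 * sin \<theta>"
      unfolding one_minus_cis_double using sin_gt_zero[of \<theta>] t by (simp add: norm_mult)
    with C(2)[of "cis (2 * \<theta>)"] cis_double_ne_1[OF t]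
    show "norm (circ_Q b \<theta>) \<le> C * (1 + pi + \<bar>ln (2 * sin \<theta>)\<bar>)"
      by (simp add: circ_Q_def norm_mult)
  qed
qed

lemma circ_Q_small:
  assumes "1 / 2 + complex_of_real b \<notin> \<int>\<^sub>\<le>\<^sub>0"
  shows "((\<lambda>\<theta>. of_real \<theta> * circ_Q b \<theta>) \<longlongrightarrow> 0) (at_right 0)"
    and "((\<lambda>\<theta>. of_real \<theta> * circ_Q b (pi - \<theta>)) \<longlongrightarrow> 0) (at_right 0)"
proof -
  obtain C where C: "C > 0" "\<And>\<theta>. \<theta> \<in> {0<..<pi} \<Longrightarrow> norm (circ_Q b \<theta>) \<le> C * (1 + pi + \<bar>ln (2 * sin \<theta>)\<bar>)"
    using circ_Q_bound[OF assms] by blast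
  have lim: "((\<lambda>\<theta>. \<theta> * (C * (1 + pi + \<bar>ln (2 * sin \<theta>)\<bar>))) \<longlongrightarrow> 0) (at_right 0)"
    by real_asymp
  show "((\<lambda>\<theta>. of_real \<theta> * circ_Q b \<theta>) \<longlongrightarrow> 0) (at_right 0)"
  proof (rule Lim_null_comparison[OF _ lim])
    show "eventually (\<lambda>\<theta>. norm (of_real \<theta> * circ_Q b \<theta>) \<le> \<theta> * (C * (1 + pi + \<bar>ln (2 * sin \<theta>)\<bar>))) (at_right 0)"
      using eventually_at_right_real[OF pi_gt_zero]
      by eventually_elim (use C in \<open>auto simp: norm_mult\<close>)
  qed
  show "((\<lambda>\<theta>. of_real \<theta> * circ_Q b (pi - \<theta>)) \<longlongrightarrow> 0) (at_right 0)"
  proof (rule Lim_null_comparison[OF _ lim])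
    show "eventually (\<lambda>\<theta>. norm (of_real \<theta> * circ_Q b (pi - \<theta>)) \<le> \<theta> * (C * (1 + pi + \<bar>ln (2 * sin \<theta>)\<bar>))) (at_right 0)"
      using eventually_at_right_real[OF pi_gt_zero]
    proof eventually_elim
      case (elim \<theta>)
      with C(2)[of "pi - \<theta>"] show ?case by (simp add: norm_mult)
    qed
  qed
qed

lemma legendre_P_minus_small:
  "((\<lambda>\<theta>. of_real \<theta> * legendre_P \<nu> (- cos \<theta>)) \<longlongrightarrow> 0) (at_right 0)"
proof -
  obtain C where C: "C > 0" "\<And>z. norm z \<le> 1 \<Longrightarrow> z \<noteq> 1 \<Longrightarrow> norm (zb_F (-\<nu>) (\<nu> + 1) z) \<le> C * (1 + pi + \<bar>ln (norm (1 - z))\<bar>)"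
    using zb_F_real_bound[of "-\<nu>" "\<nu> + 1"] by auto
  have lim: "((\<lambda>\<theta>. \<theta> * (C * (1 + pi + \<bar>ln ((1 - cos \<theta>) / 2)\<bar>))) \<longlongrightarrow> 0) (at_right 0)"
    by real_asymp
  show ?thesis
  proof (rule Lim_null_comparison[OF _ lim])
    show "eventually (\<lambda>\<theta>. norm (of_real \<theta> * legendre_P \<nu> (- cos \<theta>)) \<le> \<theta> * (C * (1 + pi + \<bar>ln ((1 - cos \<theta>) / 2)\<bar>))) (at_right 0)"
      using eventually_at_right_real[OF pi_gt_zero]
    proof eventually_elim
      case (elim \<theta>)
      have c: "-1 < cos \<theta>" "cos \<theta> < 1"
        using elim cos_monotone_0_pi[of \<theta> pi] cos_monotone_0_pi[of 0 \<theta>] by auto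
      have "norm (complex_of_real ((1 + cos \<theta>) / 2)) \<le> 1" "complex_of_real ((1 + cos \<theta>) / 2) \<noteq> 1"
        unfolding norm_of_real using c by (auto simp: complex_eq_iff)
      moreover have "norm (1 - complex_of_real ((1 + cos \<theta>) / 2)) = (1 - cos \<theta>) / 2"
      proof -
        have "1 - complex_of_real ((1 + cos \<theta>) / 2) = of_real ((1 - cos \<theta>) / 2)" by (simp add: field_simps)
        thus ?thesis using c by (simp only: norm_of_real) simp
      qed
      ultimately have "norm (zb_F (-\<nu>) (\<nu> + 1) (of_real ((1 + cos \<theta>) / 2))) \<le> C * (1 + pi + \<bar>ln ((1 - cos \<theta>) / 2)\<bar>)"
        using C(2)[of "complex_of_real ((1 + cos \<theta>) / 2)"] by metis
      moreover have "legendre_P \<nu> (- cos \<theta>) = zb_F (-\<nu>) (\<nu> + 1) (of_real ((1 + cos \<theta>) / 2))"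
        using c by (subst legendre_P_eq_zb_F) auto
      ultimately have "norm (legendre_P \<nu> (- cos \<theta>)) \<le> C * (1 + pi + \<bar>ln ((1 - cos \<theta>) / 2)\<bar>)"
        by simp
      thus ?case using elim by (simp add: norm_mult)
    qed
  qed
qed

lemma legendre_P_cos_has_vector_derivative_0:
  "((\<lambda>\<theta>. legendre_P \<mu> (cos \<theta>)) has_vector_derivative 0) (at 0)"
proof -
  have dcos: "(cos has_vector_derivative - sin 0) (at (0::real))"
    by (auto intro!: derivative_eq_intros simp flip: has_real_derivative_iff_has_vector_derivative)
  obtain d where "(legendre_P \<mu> has_vector_derivative d) (at (cos 0))"
    using legendre_P_has_field_derivative[of 1 \<mu>] by auto
  from vector_diff_chain_at[OF dcos this] show ?thesis by (simp add: o_def)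
qed

lemma legendre_P_cos_tendsto_1: "((\<lambda>\<theta>. legendre_P \<mu> (cos \<theta>)) \<longlongrightarrow> 1) (at_right 0)"
proof -
  have "isCont (\<lambda>\<theta>. legendre_P \<mu> (cos \<theta>)) 0"
    using legendre_P_cos_has_vector_derivative_0 by (rule has_vector_derivative_continuous)
  thus ?thesis by (auto simp: isCont_def legendre_P_1 intro: tendsto_mono[OF at_le])
qed

text \<open>Three solutions of a two-dimensional system satisfy a linear relation whose coefficients
  are their pairwise Wronskians; these are constant and are read off at the endpoints. The form U =
  g u - h, with g = 1 at 0 and g = -1 at pi, imitates the first ladder equation U = cos \<theta> u +
  (sin \<theta> / (\<nu> + 1)) u'. It splits off the logarithmic part of u, so that h stays bounded
  and its limits measure the logarithms at the two ends.\<close>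

theorem legendre_connection:
  fixes u U :: "real \<Rightarrow> complex" and \<nu> :: complex
  assumes pair: "legendre_pair (\<nu> + 1) u U"
    and U: "\<And>\<theta>. \<theta> \<in> {0<..<pi} \<Longrightarrow> U \<theta> = g \<theta> * u \<theta> - h \<theta>"
    and g: "(g has_vector_derivative g0) (at 0)" "g 0 = 1" "(g has_vector_derivative g1) (at pi)" "g pi = -1"
    and h: "(h \<longlongrightarrow> h0) (at_right 0)" "((\<lambda>\<theta>. h (pi - \<theta>)) \<longlongrightarrow> h1) (at_right 0)"
    and u: "((\<lambda>\<theta>. of_real \<theta> * u \<theta>) \<longlongrightarrow> 0) (at_right 0)"
           "((\<lambda>\<theta>. of_real \<theta> * u (pi - \<theta>)) \<longlongrightarrow> 0) (at_right 0)"
    and \<nu>: "\<nu> + 1 \<noteq> 0" and t: "\<theta> \<in> {0<..<pi}"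
  shows "u \<theta> * (2 * zb_kappa (-\<nu>) (\<nu> + 1) / (\<nu> + 1)) =
           legendre_P \<nu> (- cos \<theta>) * h0 - legendre_P \<nu> (cos \<theta>) * h1"
proof -
  define n where "n = \<nu> + 1"
  define k where "k = zb_kappa (-\<nu>) (\<nu> + 1)"
  define u1 U1 u2 U2 where "u1 \<theta> = legendre_P \<nu> (cos \<theta>)" and "U1 \<theta> = legendre_P (\<nu> + 1) (cos \<theta>)"
    and "u2 \<theta> = legendre_P \<nu> (- cos \<theta>)" and "U2 \<theta> = - legendre_P (\<nu> + 1) (- cos \<theta>)" for \<theta>
  have n: "n \<noteq> 0" using \<nu> by (simp add: n_def)
  have p1: "legendre_pair n u1 U1" and p2: "legendre_pair n u2 U2" and p3: "legendre_pair n u U"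
    using legendre_pair_P[of \<nu>] pair unfolding u1_def u2_def U1_def U2_def n_def by auto
  obtain c12 where c12: "\<And>\<theta>. \<theta> \<in> {0<..<pi} \<Longrightarrow> u1 \<theta> * U2 \<theta> - u2 \<theta> * U1 \<theta> = c12"
    using legendre_pair_wronskian[OF p1 p2] by blast
  obtain c13 where c13: "\<And>\<theta>. \<theta> \<in> {0<..<pi} \<Longrightarrow> u1 \<theta> * U \<theta> - u \<theta> * U1 \<theta> = c13"
    using legendre_pair_wronskian[OF p1 p3] by blast
  obtain c23 where c23: "\<And>\<theta>. \<theta> \<in> {0<..<pi} \<Longrightarrow> u2 \<theta> * U \<theta> - u \<theta> * U2 \<theta> = c23"
    using legendre_pair_wronskian[OF p2 p3] by blast
  have const: "c = l" if "(f \<longlongrightarrow> l) (at_right 0)" "\<And>\<theta>. \<theta> \<in> {0<..<pi} \<Longrightarrow> f \<theta> = c" for f and c l :: complex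
  proof -
    have "eventually (\<lambda>\<theta>. f \<theta> = c) (at_right 0)"
      using eventually_at_right_real[OF pi_gt_zero] by eventually_elim (use that in auto)
    hence "(f \<longlongrightarrow> c) (at_right 0)" by (rule tendsto_eventually)
    thus ?thesis using that(1) by (intro tendsto_unique[OF trivial_limit_at_right_real])
  qed
  note D0 = legendre_P_cos_has_vector_derivative_0
  have "((\<lambda>\<theta>. u1 \<theta> * U \<theta> - u \<theta> * U1 \<theta>) \<longlongrightarrow> - h0) (at_right 0)"
  proof (rule wronskian_limit_left[where f = "\<lambda>\<theta>. u1 \<theta> * g \<theta> - U1 \<theta>"])
    show "((\<lambda>\<theta>. u1 \<theta> * g \<theta> - U1 \<theta>) has_vector_derivative (u1 0 * g0 + 0 * g 0 - 0)) (at 0)"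
      unfolding u1_def U1_def by (intro has_vector_derivative_diff has_vector_derivative_mult D0 g)
    fix \<theta> assume "\<theta> \<in> {0<..<pi}"
    show "u1 \<theta> * U \<theta> - u \<theta> * U1 \<theta> = u \<theta> * (u1 \<theta> * g \<theta> - U1 \<theta>) - u1 \<theta> * h \<theta>"
      unfolding U[OF \<open>\<theta> \<in> {0<..<pi}\<close>] by (simp add: algebra_simps)
  qed (use g h u in \<open>auto simp: u1_def U1_def legendre_P_1 legendre_P_cos_tendsto_1\<close>)
  hence c13': "c13 = - h0" by (rule const) (rule c13)
  \<comment> \<open>At pi the regular solution is u2. Read backwards from pi it becomes u1, and the
    second components change sign, so the same limit lemma applies.\<close>
  have "((\<lambda>\<theta>. (u2 (pi - \<theta>)) * (- U (pi - \<theta>)) - u (pi - \<theta>) * (- U2 (pi - \<theta>))) \<longlongrightarrow> - (- h1)) (at_right 0)"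
  proof (rule wronskian_limit_left[where f = "\<lambda>\<theta>. - (u1 \<theta> * g (pi - \<theta>)) - U1 \<theta>"])
    have "((\<lambda>\<theta>. g (pi - \<theta>)) has_vector_derivative (-1) *\<^sub>R g1) (at 0)"
    proof -
      have "((\<lambda>\<theta>. pi - \<theta>) has_vector_derivative -1) (at 0)"
        by (auto intro!: derivative_eq_intros simp flip: has_real_derivative_iff_has_vector_derivative)
      from vector_diff_chain_at[OF this, of g g1] g(3) show ?thesis by (simp add: o_def)
    qed
    thus "((\<lambda>\<theta>. - (u1 \<theta> * g (pi - \<theta>)) - U1 \<theta>) has_vector_derivative (- (u1 0 * ((-1) *\<^sub>R g1) + 0 * g (pi - 0)) - 0)) (at 0)"
      unfolding u1_def U1_def by (intro has_vector_derivative_diff has_vector_derivative_minus has_vector_derivative_mult D0)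
    show "((\<lambda>\<theta>. - h (pi - \<theta>)) \<longlongrightarrow> - h1) (at_right 0)" by (intro tendsto_minus h)
    fix \<theta> assume "\<theta> \<in> {0<..<pi}"
    hence t': "pi - \<theta> \<in> {0<..<pi}" by auto
    show "u2 (pi - \<theta>) * - U (pi - \<theta>) - u (pi - \<theta>) * - U2 (pi - \<theta>) =
        u (pi - \<theta>) * (- (u1 \<theta> * g (pi - \<theta>)) - U1 \<theta>) - u2 (pi - \<theta>) * - h (pi - \<theta>)"
      unfolding U[OF t'] by (simp add: u1_def u2_def U1_def U2_def algebra_simps)
  qed (use g u in \<open>auto simp: u1_def u2_def U1_def legendre_P_1 legendre_P_cos_tendsto_1\<close>)
  hence "- c23 = - (- h1)"
  proof (rule const)
    fix \<theta> assume "\<theta> \<in> {0<..<pi}"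
    hence "pi - \<theta> \<in> {0<..<pi}" by auto
    from c23[OF this] show "u2 (pi - \<theta>) * - U (pi - \<theta>) - u (pi - \<theta>) * - U2 (pi - \<theta>) = - c23"
      by (simp add: algebra_simps)
  qed
  hence c23': "c23 = - h1" by (metis minus_minus)
  \<comment> \<open>For the two Legendre solutions g is the cosine itself, and h is the
    \<open>zb_H\<close> term of the ladder equation at (1 + cos \<theta>)/2; its limit at 0 is 2 k /
    n by \<open>zb_H_1\<close>.\<close>
  have "((\<lambda>\<theta>. u1 \<theta> * U2 \<theta> - u2 \<theta> * U1 \<theta>) \<longlongrightarrow> - (2 * k / n)) (at_right 0)"
  proof (rule wronskian_limit_left[where f = "\<lambda>\<theta>. u1 \<theta> * of_real (cos \<theta>) - U1 \<theta>"
        and h = "\<lambda>\<theta>. 2 * of_real ((1 + cos \<theta>) / 2) * zb_H (-\<nu>) (\<nu> + 1) (of_real ((1 + cos \<theta>) / 2)) / n"])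
    have "((\<lambda>\<theta>. complex_of_real (cos \<theta>)) has_vector_derivative of_real (- sin 0)) (at 0)"
      by (intro has_vector_derivative_of_real derivative_eq_intros) auto
    thus "((\<lambda>\<theta>. u1 \<theta> * of_real (cos \<theta>) - U1 \<theta>) has_vector_derivative (u1 0 * of_real (- sin 0) + 0 * of_real (cos 0) - 0)) (at 0)"
      unfolding u1_def U1_def by (intro has_vector_derivative_diff has_vector_derivative_mult D0)
    have H: "((\<lambda>\<theta>. zb_H (-\<nu>) (\<nu> + 1) (of_real ((1 + cos \<theta>) / 2))) \<longlongrightarrow> zb_H (-\<nu>) (\<nu> + 1) 1) (at_right 0)"
    proof (rule continuous_on_tendsto_compose[OF continuous_on_zb_H])
      show "((\<lambda>\<theta>. complex_of_real ((1 + cos \<theta>) / 2)) \<longlongrightarrow> 1) (at_right 0)"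
        by (auto intro!: tendsto_eq_intros)
      show "eventually (\<lambda>\<theta>. complex_of_real ((1 + cos \<theta>) / 2) \<in> cball 0 1) (at_right 0)"
      proof (intro always_eventually allI)
        fix \<theta> :: real
        have "\<bar>1 + cos \<theta>\<bar> \<le> 2"
          using cos_le_one[of \<theta>] cos_ge_minus_one[of \<theta>] by linarith
        thus "complex_of_real ((1 + cos \<theta>) / 2) \<in> cball 0 1"
          unfolding mem_cball_0 norm_of_real by simp
      qed
    qed auto
    have "((\<lambda>\<theta>. 2 * complex_of_real ((1 + cos \<theta>) / 2) * zb_H (-\<nu>) (\<nu> + 1) (of_real ((1 + cos \<theta>) / 2)) / n) \<longlongrightarrow>
       2 * of_real ((1 + cos 0) / 2) * k / n) (at_right 0)"
      unfolding k_def zb_H_1[symmetric] by (intro tendsto_intros H n) auto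
    thus "((\<lambda>\<theta>. 2 * complex_of_real ((1 + cos \<theta>) / 2) * zb_H (-\<nu>) (\<nu> + 1) (of_real ((1 + cos \<theta>) / 2)) / n) \<longlongrightarrow> 2 * k / n) (at_right 0)"
      by simp
    fix \<theta> assume t: "\<theta> \<in> {0<..<pi}"
    have c: "-1 < cos \<theta>" "cos \<theta> < 1"
      using t cos_monotone_0_pi[of \<theta> pi] cos_monotone_0_pi[of 0 \<theta>] by auto
    define z where "z = complex_of_real ((1 + cos \<theta>) / 2)"
    have z: "norm z < 1" unfolding z_def norm_of_real using c by auto
    have cz: "complex_of_real (cos \<theta>) = 2 * z - 1" by (simp add: z_def field_simps)
    have P: "u2 \<theta> = zb_F (-\<nu>) (\<nu> + 1) z" "U2 \<theta> = - zb_F (-(\<nu>+1)) (\<nu> + 1 + 1) z"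
      using c by (simp_all add: u2_def U2_def z_def legendre_P_eq_zb_F)
    have E0: "2 * z * zb_H (-\<nu>) (\<nu> + 1) z / n = of_real (cos \<theta>) * u2 \<theta> - U2 \<theta>"
      using zb_F_legendre_ladder(1)[OF z, of \<nu>, folded n_def] n unfolding P cz
      by (simp add: field_simps n_def)
    show "u1 \<theta> * U2 \<theta> - u2 \<theta> * U1 \<theta> = u2 \<theta> * (u1 \<theta> * of_real (cos \<theta>) - U1 \<theta>) -
       u1 \<theta> * (2 * of_real ((1 + cos \<theta>) / 2) * zb_H (-\<nu>) (\<nu> + 1) (of_real ((1 + cos \<theta>) / 2)) / n)"
      unfolding z_def[symmetric] E0 by (simp add: algebra_simps)
  qed (auto simp: u1_def u2_def U1_def legendre_P_1 legendre_P_cos_tendsto_1 legendre_P_minus_small)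
  hence c12': "c12 = - (2 * k / n)" by (rule const) (rule c12)
  \<comment> \<open>The expansion of the 3 by 3 determinant with columns u, u, U formed from the
    three solutions; it vanishes because a column is repeated.\<close>
  have "u1 \<theta> * c23 - u2 \<theta> * c13 + u \<theta> * c12 = 0"
    unfolding c12[OF t, symmetric] c13[OF t, symmetric] c23[OF t, symmetric] by (simp add: algebra_simps)
  thus ?thesis unfolding c12' c13' c23' by (simp add: u1_def u2_def k_def n_def algebra_simps)
qed

lemma zb_kappa_legendre: "zb_kappa (-\<nu>) (\<nu> + 1) = - sin (of_real pi * \<nu>) / of_real pi"
  using rGamma_reflection_complex[of "-\<nu>"] by (simp add: zb_kappa_def add.commute)

lemma tendsto_zb_H_cis:
  assumes "a + b \<notin> \<int>\<^sub>\<le>\<^sub>0" "(f \<longlongrightarrow> c) F" "cis c = 1"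
  shows "((\<lambda>x. zb_H a b (cis (f x))) \<longlongrightarrow> zb_kappa a b) F"
  unfolding zb_H_1[symmetric]
proof (rule continuous_on_tendsto_compose[OF continuous_on_zb_H[OF assms(1)]])
  show "((\<lambda>x. cis (f x)) \<longlongrightarrow> 1) F"
    unfolding assms(3)[symmetric] by (intro tendsto_intros assms)
qed auto

text \<open>Divided by b and multiplied by y^(\<nu>+2), the first contiguous relation has the form U
  = g u - h with g = y and h proportional to \<open>zb_H\<close>, whose endpoint value is
  \<open>zb_kappa\<close>.\<close>

lemma circ_Q_connection:
  assumes b: "complex_of_real (\<nu> + 1) \<notin> \<int>\<^sub>\<le>\<^sub>0" and b2: "1 / 2 + complex_of_real (\<nu> + 1) \<notin> \<int>\<^sub>\<le>\<^sub>0"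
    and t: "\<theta> \<in> {0<..<pi}"
  shows "circ_Q (\<nu> + 1) \<theta> * (2 * zb_kappa (- of_real \<nu>) (of_real \<nu> + 1)) =
           zb_kappa (1 / 2) (of_real (\<nu> + 1)) *
             (legendre_P (of_real \<nu>) (- cos \<theta>) - cis (\<nu> * pi) * legendre_P (of_real \<nu>) (cos \<theta>))"
proof -
  define B where "B = complex_of_real (\<nu> + 1)"
  have B: "B \<noteq> 0" using b by (auto simp: B_def)
  have B': "complex_of_real \<nu> + 1 = B" by (simp add: B_def)
  define k where "k = zb_kappa (1 / 2) B"
  define g where "g = cis"
  define h where "h \<theta> = cis ((\<nu> + 2) * \<theta>) * zb_H (1 / 2) B (cis (2 * \<theta>)) / B" for \<theta>
  have "circ_Q (\<nu> + 1) \<theta> * (2 * zb_kappa (- of_real \<nu>) (of_real \<nu> + 1) / (of_real \<nu> + 1)) =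
          legendre_P (of_real \<nu>) (- cos \<theta>) * (1 * k / B) - legendre_P (of_real \<nu>) (cos \<theta>) * (cis ((\<nu> + 2) * pi) * k / B)"
  proof (rule legendre_connection[where g = g and h = h, OF _ _ _ _ _ _ _ _ _ _ _ t])
    show "legendre_pair (complex_of_real \<nu> + 1) (circ_Q (\<nu> + 1))
            (\<lambda>\<theta>. B / (1 / 2 + B) * circ_Q ((\<nu> + 1) + 1) \<theta>)"
      using legendre_pair_circ_Q[OF b b2] by (simp add: B_def)
    show "complex_of_real \<nu> + 1 \<noteq> 0" using B by (simp add: B')
    show "g 0 = 1" "g pi = -1" by (auto simp: g_def)
    show "(g has_vector_derivative \<i> * cis 0) (at 0)" "(g has_vector_derivative \<i> * cis pi) (at pi)"
      unfolding g_def has_vector_derivative_def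
      by (auto intro!: derivative_eq_intros)
    have b2': "1 / 2 + B \<notin> \<int>\<^sub>\<le>\<^sub>0" using b2 by (simp add: B_def)
    have "(h \<longlongrightarrow> cis ((\<nu> + 2) * 0) * k / B) (at_right 0)"
      unfolding h_def k_def by (intro tendsto_intros tendsto_zb_H_cis[where c = "2 * 0"] B b2') auto
    thus "(h \<longlongrightarrow> 1 * k / B) (at_right 0)" by simp
    have "((\<lambda>\<theta>. h (pi - \<theta>)) \<longlongrightarrow> cis ((\<nu> + 2) * (pi - 0)) * k / B) (at_right 0)"
      unfolding h_def k_def by (intro tendsto_intros tendsto_zb_H_cis[where c = "2 * (pi - 0)"] B b2') auto
    thus "((\<lambda>\<theta>. h (pi - \<theta>)) \<longlongrightarrow> cis ((\<nu> + 2) * pi) * k / B) (at_right 0)" by simp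
    fix \<theta> assume t: "\<theta> \<in> {0<..<pi}"
    define F where "F = zb_F (1/2) B (cis (2 * \<theta>))"
    define F1 where "F1 = zb_F (1/2) (B + 1) (cis (2 * \<theta>))"
    have H: "zb_H (1/2) B (cis (2 * \<theta>)) = B * (F - B / (1 / 2 + B) * F1)"
      unfolding F_def F1_def B_def
      by (intro zb_H_contiguous b b2 cis_double_ne_1 t) auto
    have e: "circ_Q (\<nu> + 1) \<theta> = cis ((\<nu> + 1) * \<theta>) * F" "circ_Q (\<nu> + 1 + 1) \<theta> = cis ((\<nu> + 2) * \<theta>) * F1"
      by (simp_all add: circ_Q_def F_def F1_def B_def add_ac)
    have c: "cis \<theta> * (cis ((\<nu> + 1) * \<theta>) * F) = cis ((\<nu> + 2) * \<theta>) * F"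
      by (simp add: cis_mult algebra_simps flip: mult.assoc)
    have alg: "R * (c * f1) = c * f - c * (B * (f - R * f1)) / B" for R c f f1
      using B by (simp add: field_simps)
    show "B / (1 / 2 + B) * circ_Q (\<nu> + 1 + 1) \<theta> = g \<theta> * circ_Q (\<nu> + 1) \<theta> - h \<theta>"
      unfolding e g_def c h_def H by (rule alg)
  qed (intro circ_Q_small b2)+
  moreover have "cis ((\<nu> + 2) * pi) = cis (\<nu> * pi)"
    by (simp add: distrib_right flip: cis_mult)
  ultimately show ?thesis using B unfolding B' B_def[symmetric] k_def[symmetric]
    by (simp add: field_simps)
qed

text \<open>The function with b = -\<nu> is reached as the partner of b = -\<nu> - 1 in the swapped
  system, so now the second contiguous relation supplies g and h. The rescaling by (1/2 + B) / B
  makes \<open>circ_Q\<close> at -\<nu> itself the first component.\<close>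

lemma circ_Q_connection':
  assumes b: "complex_of_real (- \<nu> - 1) \<notin> \<int>\<^sub>\<le>\<^sub>0" and b2: "1 / 2 + complex_of_real (- \<nu> - 1) \<notin> \<int>\<^sub>\<le>\<^sub>0"
    and t: "\<theta> \<in> {0<..<pi}"
  shows "circ_Q (- \<nu>) \<theta> * (2 * zb_kappa (- of_real \<nu>) (of_real \<nu> + 1)) =
           zb_kappa (1 / 2) (of_real (- \<nu>)) *
             (legendre_P (of_real \<nu>) (- cos \<theta>) + cis (- \<nu> * pi) * legendre_P (of_real \<nu>) (cos \<theta>))"
proof -
  define B where "B = complex_of_real (- \<nu> - 1)"
  have B: "B \<noteq> 0" "1 / 2 + B \<noteq> 0" using b b2 by (auto simp: B_def)
  have B': "complex_of_real \<nu> + 1 = - B" by (simp add: B_def)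
  have B1: "B + 1 = - of_real \<nu>" by (simp add: B_def)
  define k where "k = zb_kappa (1 / 2) (B + 1)"
  \<comment> \<open>The coefficient of the first component after the second contiguous relation is
    solved for the series with parameter B. At y = 1 and y = -1 it reduces to 1/y, which gives the
    endpoint values required.\<close>
  define g where "g \<theta> = cis (- \<theta>) * (1 / 2 + B - 1 / 2 * cis (2 * \<theta>)) / B" for \<theta>
  define h where "h \<theta> = - (cis ((1 - \<nu>) * \<theta>) * zb_H (1 / 2) (B + 1) (cis (2 * \<theta>)) / B)" for \<theta>
  have b2': "1 / 2 + B \<notin> \<int>\<^sub>\<le>\<^sub>0" using b2 by (simp add: B_def)
  have b4: "1 / 2 + (B + 1) \<notin> \<int>\<^sub>\<le>\<^sub>0"
    using add_1_not_nonpos_Int[OF b2'] by (simp add: add.assoc)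
  hence b3: "1 / 2 + complex_of_real (- \<nu>) \<notin> \<int>\<^sub>\<le>\<^sub>0" by (simp add: B1)
  have "circ_Q (- \<nu>) \<theta> * (2 * zb_kappa (- of_real \<nu>) (of_real \<nu> + 1) / (of_real \<nu> + 1)) =
          legendre_P (of_real \<nu>) (- cos \<theta>) * (- (1 * k / B)) - legendre_P (of_real \<nu>) (cos \<theta>) * (- (cis ((1 - \<nu>) * pi) * k / B))"
  proof (rule legendre_connection[where g = g and h = h, OF _ _ _ _ _ _ _ _ _ _ _ t])
    have "legendre_pair (complex_of_real \<nu> + 1) (\<lambda>\<theta>. B / (1 / 2 + B) * circ_Q (- \<nu> - 1 + 1) \<theta>) (circ_Q (- \<nu> - 1))"
      using legendre_pair_swap[OF legendre_pair_circ_Q[OF b b2]] unfolding B' by (simp only: B_def)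
    from legendre_pair_scale[OF this, of "(1 / 2 + B) / B"]
    show "legendre_pair (complex_of_real \<nu> + 1) (circ_Q (- \<nu>)) (\<lambda>\<theta>. (1 / 2 + B) / B * circ_Q (- \<nu> - 1) \<theta>)"
      using B by simp
    show "complex_of_real \<nu> + 1 \<noteq> 0" using B by (simp add: B')
    show "g 0 = 1" "g pi = -1" using B by (auto simp: g_def divide_simps complex_eq_iff[of "cis (- pi)"])
    show "(g has_vector_derivative (- \<i> * cis (- 0) * (1 / 2 + B - 1 / 2 * cis (2 * 0)) / B + cis (- 0) * (- \<i> * cis (2 * 0)) / B)) (at 0)"
         "(g has_vector_derivative (- \<i> * cis (- pi) * (1 / 2 + B - 1 / 2 * cis (2 * pi)) / B + cis (- pi) * (- \<i> * cis (2 * pi)) / B)) (at pi)"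
      unfolding g_def has_vector_derivative_def using B
      by (auto intro!: derivative_eq_intros simp: fun_eq_iff scaleR_conv_of_real field_simps)
    have "(h \<longlongrightarrow> - (cis ((1 - \<nu>) * 0) * k / B)) (at_right 0)"
      unfolding h_def k_def by (intro tendsto_intros tendsto_zb_H_cis[where c = "2 * 0"] B b4) auto
    thus "(h \<longlongrightarrow> - (1 * k / B)) (at_right 0)" by simp
    have "((\<lambda>\<theta>. h (pi - \<theta>)) \<longlongrightarrow> - (cis ((1 - \<nu>) * (pi - 0)) * k / B)) (at_right 0)"
      unfolding h_def k_def by (intro tendsto_intros tendsto_zb_H_cis[where c = "2 * (pi - 0)"] B b4) auto
    thus "((\<lambda>\<theta>. h (pi - \<theta>)) \<longlongrightarrow> - (cis ((1 - \<nu>) * pi) * k / B)) (at_right 0)" by simp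
    fix \<theta> assume t: "\<theta> \<in> {0<..<pi}"
    define F where "F = zb_F (1/2) B (cis (2 * \<theta>))"
    define F1 where "F1 = zb_F (1/2) (B + 1) (cis (2 * \<theta>))"
    define H1 where "H1 = zb_H (1/2) (B + 1) (cis (2 * \<theta>))"
    define X where "X = cis (2 * \<theta>)"
    define Y where "Y = cis ((- \<nu> - 1) * \<theta>)"
    have H: "X * H1 = (1 / 2 + B) * (F - F1) + 1 / 2 * X * F1"
      unfolding X_def F_def F1_def H1_def B_def
      by (intro zb_H_contiguous b b2 cis_double_ne_1 t) auto
    have e: "circ_Q (- \<nu> - 1) \<theta> = Y * F" "circ_Q (- \<nu>) \<theta> = cis (- \<nu> * \<theta>) * F1"
      by (simp_all add: circ_Q_def F_def F1_def B_def Y_def)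
    have c1: "cis (- \<theta>) * (1 / 2 + B - 1 / 2 * X) / B * (cis (- \<nu> * \<theta>) * F1) = Y * ((1 / 2 + B - 1 / 2 * X) * F1) / B"
    proof -
      have "cis (- \<theta>) * cis (- \<nu> * \<theta>) = Y"
        unfolding cis_mult Y_def by (rule arg_cong[where f = cis]) (simp add: algebra_simps)
      thus ?thesis by (simp add: mult_ac)
    qed
    have c2: "cis ((1 - \<nu>) * \<theta>) = Y * X" by (simp add: cis_mult algebra_simps Y_def X_def)
    have "Y * ((1 / 2 + B) * F) / B = Y * ((1 / 2 + B - 1 / 2 * X) * F1) / B - (- (Y * (X * H1) / B))"
      unfolding H using B by (simp add: field_simps)
    thus "(1 / 2 + B) / B * circ_Q (- \<nu> - 1) \<theta> = g \<theta> * circ_Q (- \<nu>) \<theta> - h \<theta>"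
      unfolding e g_def h_def c1[unfolded X_def] c2 H1_def[symmetric] X_def by (simp add: mult_ac)
  qed (intro circ_Q_small b3)+
  moreover have "cis ((1 - \<nu>) * pi) = - cis (- \<nu> * pi)"
    by (simp add: left_diff_distrib flip: cis_mult) (simp add: complex_eq_iff cos_diff sin_diff)
  moreover have "q * K = k * (p2 + c * p1)" if "q * (K / - B) = p2 * (- (1 * k / B)) - p1 * (- (- c * k / B))"
    for q K p1 p2 c using that B by (simp add: field_simps)
  moreover have "zb_kappa (1 / 2) (of_real (- \<nu>)) = k" by (simp add: k_def B1)
  ultimately show ?thesis unfolding B' by metis
qed

lemma Re_pos_not_nonpos_Int: "Re z > 0 \<Longrightarrow> z \<notin> \<int>\<^sub>\<le>\<^sub>0"
  by (auto elim!: nonpos_Ints_cases)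

section \<open>Cauchy's theorem on the half disc\<close>

text \<open>Continuity on the closed half disc and holomorphy inside are all that can be offered:
  the integrands to come are in general only continuous at -1, 0 and 1. On a convex set Cauchy's
  theorem accepts this.\<close>

lemma half_disc_integral:
  fixes f :: "complex \<Rightarrow> complex"
  assumes cont: "continuous_on (cball 0 1 \<inter> {z. Im z \<ge> 0}) f"
    and hol: "\<And>z. norm z < 1 \<Longrightarrow> Im z > 0 \<Longrightarrow> f field_differentiable at z"
  shows "integral {0..pi} (\<lambda>t. f (cis t) * (\<i> * cis t)) + integral {-1..1} (\<lambda>x. f (of_real x)) = 0"
proof -
  define S where "S = cball (0::complex) 1 \<inter> {z. Im z \<ge> 0}"
  let ?c = "part_circlepath 0 1 0 pi" and ?l = "linepath (-1) (1 :: complex)"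
  have S: "convex S" unfolding S_def by (intro convex_Int convex_cball convex_halfspace_Im_ge)
  have int: "norm z < 1 \<and> Im z > 0" if zS: "z \<in> interior S" for z
  proof
    have "interior S \<subseteq> interior (cball 0 1)" unfolding S_def by (intro interior_mono) auto
    thus "norm z < 1" using zS by auto
    obtain e where e: "e > 0" "ball z e \<subseteq> S" using zS by (auto simp: mem_interior)
    have "z - \<i> * of_real (e / 2) \<in> ball z e" using e(1) by (simp add: dist_norm norm_mult)
    hence "z - \<i> * of_real (e / 2) \<in> S" using e(2) by blast
    thus "Im z > 0" using e(1) by (simp add: S_def)
  qed
  have pc: "path_image ?c \<subseteq> S"
    unfolding path_image_part_circlepath[OF pi_ge_zero] S_def
    by (auto simp: cis_conv_exp[symmetric] norm_mult sin_ge_zero)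
  have pl: "path_image ?l \<subseteq> S"
    unfolding path_image_linepath using S by (intro closed_segment_subset) (auto simp: S_def)
  have "(f has_contour_integral 0) (?c +++ ?l)"
  proof (rule Cauchy_theorem_convex[of S f "{}"])
    show "continuous_on S f" using cont by (simp add: S_def)
    show "path_image (?c +++ ?l) \<subseteq> S" using pc pl by (intro subset_path_image_join)
    show "valid_path (?c +++ ?l)" by (intro valid_path_join) (auto simp: exp_eq_polar cis.code complex_eq_iff)
    fix x assume "x \<in> interior S - {}"
    thus "f field_differentiable at x" using hol int by auto
  qed (use S in \<open>auto simp: exp_eq_polar cis.code complex_eq_iff\<close>)
  moreover have "f contour_integrable_on ?c"
    by (rule contour_integrable_continuous_part_circlepath)
       (use pc cont in \<open>auto intro: continuous_on_subset simp: S_def\<close>)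
  moreover have "f contour_integrable_on ?l"
    by (rule contour_integrable_continuous_linepath)
       (use pl cont in \<open>auto intro: continuous_on_subset simp: S_def\<close>)
  ultimately have "contour_integral ?c f + contour_integral ?l f = 0"
    by (metis contour_integral_join contour_integral_unique valid_path_part_circlepath valid_path_linepath)
  moreover have "contour_integral ?c f = integral {0..pi} (\<lambda>t. f (cis t) * (\<i> * cis t))"
    by (subst contour_integral_part_circlepath_eq) (auto simp: mult.assoc)
  moreover have "contour_integral ?l f = integral {-1..1} (\<lambda>x. f (of_real x))"
    by (subst contour_integral_linepath_Reals_eq) auto
  ultimately show ?thesis by simp
qed

text \<open>At z = cis (2\<theta>) the factor (1 - z)^\<nu> is the weight sin^\<nu> \<theta> up to a
  constant and a phase; in this form the weighted product extends analytically into the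
  disc.\<close>

definition zb_triple :: "real \<Rightarrow> real \<Rightarrow> real \<Rightarrow> real \<Rightarrow> complex \<Rightarrow> complex" where
  "zb_triple \<nu> b1 b2 b3 z = zb_F (1 / 2) (of_real b1) z * zb_F (1 / 2) (of_real b2) z * zb_F (1 / 2) (of_real b3) z *
      (1 - z) powr of_real \<nu>"

lemma Re_one_minus_nonneg:
  fixes z :: complex
  assumes "norm z \<le> 1"
  shows "Re (1 - z) \<ge> 0"
  using complex_Re_le_cmod[of z] assms by simp

text \<open>At z = 1 the positive power of 1 - z beats the cube of a logarithm, and the value there
  is 0 because 0 \<open>powr\<close> anything is 0.\<close>

lemma continuous_on_zb_triple:
  assumes \<nu>: "\<nu> > 0"
    and b: "1 / 2 + complex_of_real b1 \<notin> \<int>\<^sub>\<le>\<^sub>0" "1 / 2 + complex_of_real b2 \<notin> \<int>\<^sub>\<le>\<^sub>0" "1 / 2 + complex_of_real b3 \<notin> \<int>\<^sub>\<le>\<^sub>0"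
  shows "continuous_on (cball 0 1) (zb_triple \<nu> b1 b2 b3)"
  unfolding continuous_on_eq_continuous_within
proof
  fix z :: complex assume z: "z \<in> cball 0 1"
  show "continuous (at z within cball 0 1) (zb_triple \<nu> b1 b2 b3)"
  proof (cases "z = 1")
    case False
    have "continuous_on (cball 0 1 - {1}) (zb_triple \<nu> b1 b2 b3)"
      unfolding zb_triple_def[abs_def]
      by (intro continuous_intros continuous_on_zb_F b) (use Re_one_minus_nonneg in auto)
    hence "continuous (at z within cball 0 1 - {1}) (zb_triple \<nu> b1 b2 b3)"
      using False z by (simp add: continuous_on_eq_continuous_within)
    moreover have "at z within cball 0 1 - {1} = at z within cball 0 1"
      using False by (intro at_within_nhd[where S = "- {1}"]) auto
    ultimately show ?thesis by simp
  next
    case True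
    obtain C1 where C1: "C1 > 0" "\<And>z. norm z \<le> 1 \<Longrightarrow> z \<noteq> 1 \<Longrightarrow> norm (zb_F (1 / 2) (of_real b1) z) \<le> C1 * (1 + pi + \<bar>ln (norm (1 - z))\<bar>)"
      using zb_F_real_bound[OF b(1)] by blast
    obtain C2 where C2: "C2 > 0" "\<And>z. norm z \<le> 1 \<Longrightarrow> z \<noteq> 1 \<Longrightarrow> norm (zb_F (1 / 2) (of_real b2) z) \<le> C2 * (1 + pi + \<bar>ln (norm (1 - z))\<bar>)"
      using zb_F_real_bound[OF b(2)] by blast
    obtain C3 where C3: "C3 > 0" "\<And>z. norm z \<le> 1 \<Longrightarrow> z \<noteq> 1 \<Longrightarrow> norm (zb_F (1 / 2) (of_real b3) z) \<le> C3 * (1 + pi + \<bar>ln (norm (1 - z))\<bar>)"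
      using zb_F_real_bound[OF b(3)] by blast
    have lim: "((\<lambda>r. C1 * C2 * C3 * (1 + pi + \<bar>ln r\<bar>) ^ 3 * r powr \<nu>) \<longlongrightarrow> 0) (at_right 0)"
      using \<nu> by real_asymp
    have "filterlim (\<lambda>w. norm (1 - w)) (at_right 0) (at 1 within cball (0::complex) 1)"
      unfolding filterlim_at
    proof
      show "eventually (\<lambda>w. norm (1 - w) \<in> {0<..} \<and> norm (1 - w) \<noteq> 0) (at 1 within cball (0::complex) 1)"
        unfolding eventually_at by (intro exI[of _ 1]) auto
      have "((\<lambda>w. norm (1 - w)) \<longlongrightarrow> norm (1 - 1 :: complex)) (at 1 within cball (0::complex) 1)"
        by (intro tendsto_intros)
      thus "((\<lambda>w. norm (1 - w)) \<longlongrightarrow> 0) (at 1 within cball (0::complex) 1)" by simp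
    qed
    from filterlim_compose[OF lim this]
    have lim': "((\<lambda>w. C1 * C2 * C3 * (1 + pi + \<bar>ln (norm (1 - w))\<bar>) ^ 3 * norm (1 - w) powr \<nu>) \<longlongrightarrow> 0) (at 1 within cball (0::complex) 1)" .
    have "(zb_triple \<nu> b1 b2 b3 \<longlongrightarrow> 0) (at 1 within cball 0 1)"
    proof (rule Lim_null_comparison[OF _ lim'])
      show "eventually (\<lambda>w. norm (zb_triple \<nu> b1 b2 b3 w) \<le> C1 * C2 * C3 * (1 + pi + \<bar>ln (norm (1 - w))\<bar>) ^ 3 * norm (1 - w) powr \<nu>)
              (at 1 within cball 0 1)"
        unfolding eventually_at
      proof (intro exI[of _ 1] conjI ballI impI)
        fix w :: complex assume w: "w \<in> cball 0 1" "w \<noteq> 1 \<and> dist w 1 < 1"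
        let ?L = "1 + pi + \<bar>ln (norm (1 - w))\<bar>"
        have L: "?L \<ge> 0" using pi_gt_zero by linarith
        have "norm (zb_triple \<nu> b1 b2 b3 w) = norm (zb_F (1 / 2) (of_real b1) w) * norm (zb_F (1 / 2) (of_real b2) w) * norm (zb_F (1 / 2) (of_real b3) w) * norm (1 - w) powr \<nu>"
          by (simp add: zb_triple_def norm_mult norm_powr_real_powr')
        also have "\<dots> \<le> (C1 * ?L) * (C2 * ?L) * (C3 * ?L) * norm (1 - w) powr \<nu>"
          using w C1 C2 C3 L by (intro mult_mono mult_nonneg_nonneg) auto
        finally show "norm (zb_triple \<nu> b1 b2 b3 w) \<le> C1 * C2 * C3 * ?L ^ 3 * norm (1 - w) powr \<nu>"
          by (simp add: power3_eq_cube mult_ac)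
      qed auto
    qed
    moreover have "zb_triple \<nu> b1 b2 b3 1 = 0" by (simp add: zb_triple_def)
    ultimately show ?thesis using True by (simp add: continuous_within)
  qed
qed

lemma zb_triple_field_differentiable:
  assumes "1 / 2 + complex_of_real b1 \<notin> \<int>\<^sub>\<le>\<^sub>0" "1 / 2 + complex_of_real b2 \<notin> \<int>\<^sub>\<le>\<^sub>0" "1 / 2 + complex_of_real b3 \<notin> \<int>\<^sub>\<le>\<^sub>0"
    and z: "norm z < 1"
  shows "zb_triple \<nu> b1 b2 b3 field_differentiable at z"
proof -
  have F: "zb_F (1 / 2) (of_real b) field_differentiable at z" if "1 / 2 + complex_of_real b \<notin> \<int>\<^sub>\<le>\<^sub>0" for b
    using zb_F_has_field_derivative_ball[OF that z] by (auto simp: field_differentiable_def)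
  have "1 - z \<notin> \<real>\<^sub>\<le>\<^sub>0"
    using complex_Re_le_cmod[of z] z by (auto simp: complex_nonpos_Reals_iff)
  hence "(\<lambda>z. (1 - z) powr of_real \<nu>) field_differentiable at z"
    unfolding field_differentiable_def by (auto intro!: exI derivative_eq_intros)
  thus ?thesis unfolding zb_triple_def[abs_def]
    by (intro field_differentiable_mult F assms)
qed

lemma cis_powr_real:
  assumes "r > 0" "-pi < t" "t \<le> pi"
  shows "(of_real r * cis t) powr of_real a = of_real (r powr a) * cis (a * t)"
proof -
  have "Ln (of_real r * cis t) = of_real (ln r) + \<i> * of_real t"
  proof (rule Ln_unique)
    show "exp (of_real (ln r) + \<i> * of_real t) = of_real r * cis t"
      using assms by (simp add: exp_add cis_conv_exp exp_of_real)
  qed (use assms in auto)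
  hence "(of_real r * cis t) powr of_real a = exp (of_real (a * ln r) + \<i> * of_real (a * t))"
    using assms by (simp add: powr_def algebra_simps)
  moreover have "exp (of_real (a * ln r)) = complex_of_real (r powr a)"
    unfolding exp_of_real using assms by (simp add: powr_def)
  ultimately show ?thesis by (simp only: exp_add cis_conv_exp)
qed

lemma one_minus_cis_double_powr:
  assumes "\<theta> \<in> {0<..<pi}"
  shows "(1 - cis (2 * \<theta>)) powr of_real \<nu> = of_real ((2 * sin \<theta>) powr \<nu>) * cis (\<nu> * (\<theta> - pi / 2))"
proof -
  have "1 - cis (2 * \<theta>) = of_real (2 * sin \<theta>) * cis (\<theta> - pi / 2)"
    unfolding one_minus_cis_double by (simp add: complex_eq_iff cos_diff sin_diff)
  moreover have "(of_real (2 * sin \<theta>) * cis (\<theta> - pi / 2)) powr of_real \<nu> = of_real ((2 * sin \<theta>) powr \<nu>) * cis (\<nu> * (\<theta> - pi / 2))"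
    by (rule cis_powr_real) (use assms sin_gt_zero in auto)
  ultimately show ?thesis by simp
qed

lemma circ_Q_triple:
  assumes t: "\<theta> \<in> {0..pi}" and \<nu>: "\<nu> \<noteq> 0"
  shows "circ_Q b1 \<theta> * circ_Q b2 \<theta> * circ_Q b3 \<theta> * of_real (sin \<theta> powr \<nu>) =
           of_real (2 powr - \<nu>) * cis ((b1 + b2 + b3) * \<theta> - \<nu> * (\<theta> - pi / 2)) * zb_triple \<nu> b1 b2 b3 (cis (2 * \<theta>))"
proof (cases "\<theta> \<in> {0<..<pi}")
  case True
  have s: "sin \<theta> > 0" using True sin_gt_zero by auto
  have "of_real (2 powr - \<nu>) * (of_real ((2 * sin \<theta>) powr \<nu>) :: complex) = of_real (sin \<theta> powr \<nu>)"
    using s by (simp add: powr_mult powr_minus field_simps flip: of_real_mult)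
  moreover have "cis ((b1 + b2 + b3) * \<theta> - \<nu> * (\<theta> - pi / 2)) * cis (\<nu> * (\<theta> - pi / 2)) = cis (b1 * \<theta>) * cis (b2 * \<theta>) * cis (b3 * \<theta>)"
    by (simp add: cis_mult algebra_simps)
  moreover have "c * d = r \<Longrightarrow> e * g = p1 * p2 * p3 \<Longrightarrow> (p1 * f1) * (p2 * f2) * (p3 * f3) * r = c * e * (f1 * f2 * f3 * (d * g))"
    for c d r e g p1 p2 p3 f1 f2 f3 :: complex by (auto simp: mult_ac)
  ultimately show ?thesis
    unfolding circ_Q_def zb_triple_def one_minus_cis_double_powr[OF True] by blast
next
  case False
  \<comment> \<open>At the endpoints both sides are 0 through the \<open>powr\<close> factor,
    whatever value \<open>zb_F\<close> has at 1.\<close>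
  hence "\<theta> = 0 \<or> \<theta> = pi" using t by auto
  moreover have "cis (pi * 2) = 1" "cis (2 * pi) = 1" by (simp_all add: complex_eq_iff)
  ultimately show ?thesis using \<nu> by (auto simp: zb_triple_def)
qed

lemma continuous_on_circ_Q_triple:
  assumes \<nu>: "\<nu> > 0"
    and b: "1 / 2 + complex_of_real b1 \<notin> \<int>\<^sub>\<le>\<^sub>0" "1 / 2 + complex_of_real b2 \<notin> \<int>\<^sub>\<le>\<^sub>0" "1 / 2 + complex_of_real b3 \<notin> \<int>\<^sub>\<le>\<^sub>0"
  shows "continuous_on {0..pi} (\<lambda>\<theta>. circ_Q b1 \<theta> * circ_Q b2 \<theta> * circ_Q b3 \<theta> * of_real (sin \<theta> powr \<nu>))"
proof -
  have "continuous_on {0..pi} (\<lambda>\<theta>. of_real (2 powr - \<nu>) * cis ((b1 + b2 + b3) * \<theta> - \<nu> * (\<theta> - pi / 2)) * zb_triple \<nu> b1 b2 b3 (cis (2 * \<theta>)))"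
    by (intro continuous_intros continuous_on_compose2[OF continuous_on_zb_triple[OF \<nu> b]]) auto
  thus ?thesis
    by (subst continuous_on_cong[OF refl circ_Q_triple]) (use \<nu> in auto)
qed

text \<open>On the circle the cube carries y^(3\<nu>+3) from the solutions, y^(-\<nu>) from the
  weight and 1/y from d\<theta>: in total y^(2\<nu>+2) (1 - y^2)^\<nu> F(y^2)^3 dy. On the two
  halves of the diameter this function has opposite phases, cis ((\<nu>+1) pi) and cis (-(\<nu>+1)
  pi) once normalised, with sum - 2 cos(\<nu> pi).\<close>

lemma circ_Q_integral_1:
  assumes \<nu>: "\<nu> > 0"
  shows "of_real (2 powr \<nu>) * cis (- (3 * \<nu> + 1) * pi / 2) *
      integral {0..pi} (\<lambda>\<theta>. circ_Q (\<nu> + 1) \<theta> * circ_Q (\<nu> + 1) \<theta> * circ_Q (\<nu> + 1) \<theta> * of_real (sin \<theta> powr \<nu>)) =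
      2 * of_real (cos (\<nu> * pi)) *
      integral {0..1} (\<lambda>x. of_real (x powr (2 * \<nu> + 2)) * zb_triple \<nu> (\<nu> + 1) (\<nu> + 1) (\<nu> + 1) (of_real (x\<^sup>2)))"
    (is "?c * integral _ ?q = _ * integral _ ?j")
proof -
  have b: "1 / 2 + complex_of_real (\<nu> + 1) \<notin> \<int>\<^sub>\<le>\<^sub>0"
    by (rule Re_pos_not_nonpos_Int) (use \<nu> in simp)
  define K where "K = zb_triple \<nu> (\<nu> + 1) (\<nu> + 1) (\<nu> + 1)"
  \<comment> \<open>Taking the power of - i y moves the cut of \<open>powr\<close> to the negative
    imaginary axis, outside the half disc, and makes the phases on the two halves of the diameter
    complex conjugate.\<close>
  define f where "f y = (- \<i> * y) powr of_real (2 * \<nu> + 2) * K (y\<^sup>2)" for y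
  have contK: "continuous_on (cball 0 1) K" unfolding K_def by (rule continuous_on_zb_triple[OF \<nu> b b b])
  have "integral {0..pi} (\<lambda>t. f (cis t) * (\<i> * cis t)) + integral {-1..1} (\<lambda>x. f (of_real x)) = 0"
  proof (rule half_disc_integral)
    show "continuous_on (cball 0 1 \<inter> {z. Im z \<ge> 0}) f"
      unfolding f_def using \<nu>
      by (intro continuous_intros continuous_on_compose2[OF contK]) (auto simp: norm_power power_le_one)
    fix z :: complex assume z: "norm z < 1" "Im z > 0"
    have z2: "norm (z\<^sup>2) < 1" using z by (simp add: norm_power power_less_one_iff abs_square_less_1)
    have "- \<i> * z \<notin> \<real>\<^sub>\<le>\<^sub>0" using z by (auto simp: complex_nonpos_Reals_iff)
    hence "(\<lambda>y. (- \<i> * y) powr of_real (2 * \<nu> + 2)) field_differentiable at z"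
      unfolding field_differentiable_def by (auto intro!: exI derivative_eq_intros)
    moreover have "(\<lambda>y. K (y\<^sup>2)) field_differentiable at z"
    proof (rule field_differentiable_compose[of "\<lambda>y. y\<^sup>2" z K, unfolded o_def])
      show "K field_differentiable at (z\<^sup>2)" unfolding K_def
        by (intro zb_triple_field_differentiable b z2)
    qed (auto simp: field_differentiable_def intro!: exI derivative_eq_intros)
    ultimately show "f field_differentiable at z" unfolding f_def[abs_def] by (rule field_differentiable_mult)
  qed
  moreover have "integral {0..pi} (\<lambda>t. f (cis t) * (\<i> * cis t)) = integral {0..pi} (\<lambda>t. ?c * ?q t)"
  proof (rule integral_cong)
    fix t assume t: "t \<in> {0..pi}"
    have "- \<i> * cis t = of_real 1 * cis (t - pi / 2)" by (simp add: complex_eq_iff cos_diff sin_diff)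
    moreover have "(of_real 1 * cis (t - pi / 2)) powr of_real (2 * \<nu> + 2) = of_real (1 powr (2 * \<nu> + 2)) * cis ((2 * \<nu> + 2) * (t - pi / 2))"
    proof (rule cis_powr_real)
      have "0 \<le> t" "t \<le> pi" using t by auto
      thus "- pi < t - pi / 2" "t - pi / 2 \<le> pi" using pi_gt_zero by linarith+
    qed auto
    ultimately have e1: "(- \<i> * cis t) powr of_real (2 * \<nu> + 2) = cis ((2 * \<nu> + 2) * (t - pi / 2))"
      by simp
    have e2: "\<i> * cis t = cis (t + pi / 2)" by (simp add: complex_eq_iff cos_add sin_add)
    have e3: "(cis t)\<^sup>2 = cis (2 * t)" by (simp add: Complex.DeMoivre)
    have "?c * ?q t = (of_real (2 powr \<nu>) * of_real (2 powr - \<nu>)) *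
         (cis (- (3 * \<nu> + 1) * pi / 2) * cis ((\<nu> + 1 + (\<nu> + 1) + (\<nu> + 1)) * t - \<nu> * (t - pi / 2))) * K (cis (2 * t))"
      using \<nu> by (subst circ_Q_triple[OF t]) (auto simp: K_def mult_ac)
    also have "of_real (2 powr \<nu>) * of_real (2 powr - \<nu>) = (1 :: complex)"
      by (simp flip: of_real_mult powr_add)
    also have "cis (- (3 * \<nu> + 1) * pi / 2) * cis ((\<nu> + 1 + (\<nu> + 1) + (\<nu> + 1)) * t - \<nu> * (t - pi / 2)) =
               cis ((2 * \<nu> + 2) * (t - pi / 2)) * cis (t + pi / 2)"
      unfolding cis_mult by (rule arg_cong[where f = cis]) (simp add: field_simps)
    finally show "f (cis t) * (\<i> * cis t) = ?c * ?q t"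
      unfolding f_def e1 unfolding e2 e3 by (simp add: mult_ac)
  qed
  moreover have "integral {-1..1} (\<lambda>x. f (of_real x)) = - 2 * of_real (cos (\<nu> * pi)) * integral {0..1} ?j"
  proof -
    have c: "continuous_on {-1..1} (\<lambda>x. f (of_real x))"
      unfolding f_def using \<nu>
      by (intro continuous_intros continuous_on_compose2[OF contK]) (auto simp: norm_power power_le_one abs_square_le_1 simp flip: of_real_power)
    hence int: "(\<lambda>x. f (of_real x)) integrable_on {-1..1}" by (rule integrable_continuous_real)
    have pos: "f (of_real x) = cis (- (\<nu> + 1) * pi) * ?j x" if "x \<in> {0..1}" for x
    proof (cases "x = 0")
      case False
      have "- \<i> * of_real x = of_real x * cis (- (pi / 2))" by (simp add: complex_eq_iff)
      moreover have "(of_real x * cis (- (pi / 2))) powr of_real (2 * \<nu> + 2) = of_real (x powr (2 * \<nu> + 2)) * cis ((2 * \<nu> + 2) * (- (pi / 2)))"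
      proof (rule cis_powr_real)
        show "- pi < - (pi / 2)" "- (pi / 2) \<le> pi" using pi_gt_zero by linarith+
      qed (use that False in auto)
      moreover have "(2 * \<nu> + 2) * (- (pi / 2)) = - (\<nu> + 1) * pi" by (simp add: field_simps)
      ultimately show ?thesis by (simp add: f_def K_def mult_ac)
    qed (auto simp: f_def)
    have neg: "f (of_real (- x)) = cis ((\<nu> + 1) * pi) * ?j x" if "x \<in> {0..1}" for x
    proof (cases "x = 0")
      case False
      have "- \<i> * of_real (- x) = of_real x * cis (pi / 2)" by (simp add: complex_eq_iff)
      moreover have "(of_real x * cis (pi / 2)) powr of_real (2 * \<nu> + 2) = of_real (x powr (2 * \<nu> + 2)) * cis ((2 * \<nu> + 2) * (pi / 2))"
        by (rule cis_powr_real) (use that False in auto)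
      moreover have "(2 * \<nu> + 2) * (pi / 2) = (\<nu> + 1) * pi" by (simp add: field_simps)
      ultimately have e: "(- \<i> * of_real (- x)) powr of_real (2 * \<nu> + 2) = of_real (x powr (2 * \<nu> + 2)) * cis ((\<nu> + 1) * pi)"
        by (simp only:)
      show ?thesis unfolding f_def K_def e by (simp add: mult_ac)
    qed (auto simp: f_def)
    have "integral {-1..1} (\<lambda>x. f (of_real x)) = integral {-1..0} (\<lambda>x. f (of_real x)) + integral {0..1} (\<lambda>x. f (of_real x))"
      using Henstock_Kurzweil_Integration.integral_combine[of "-1" 0 1 "\<lambda>x. f (of_real x)"] int by simp
    also have "integral {-1..0} (\<lambda>x. f (of_real x)) = integral {0..1} (\<lambda>x. f (of_real (- x)))"
      using Henstock_Kurzweil_Integration.integral_reflect_real[of 1 0 "\<lambda>x. f (of_real (- x))"] by simp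
    also have "\<dots> = integral {0..1} (\<lambda>x. cis ((\<nu> + 1) * pi) * ?j x)"
      by (rule integral_cong) (rule neg)
    also have "integral {0..1} (\<lambda>x. f (of_real x)) = integral {0..1} (\<lambda>x. cis (- (\<nu> + 1) * pi) * ?j x)"
      by (rule integral_cong) (rule pos)
    also have "integral {0..1} (\<lambda>x. cis ((\<nu> + 1) * pi) * ?j x) + integral {0..1} (\<lambda>x. cis (- (\<nu> + 1) * pi) * ?j x) =
               (cis ((\<nu> + 1) * pi) + cis (- (\<nu> + 1) * pi)) * integral {0..1} ?j"
      by (simp only: integral_mult_right distrib_right)
    also have "cis ((\<nu> + 1) * pi) + cis (- (\<nu> + 1) * pi) = - 2 * of_real (cos (\<nu> * pi))"
      by (simp add: complex_eq_iff algebra_simps cos_add sin_add cos_diff sin_diff)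
    finally show ?thesis .
  qed
  ultimately show ?thesis by (simp add: integral_mult_right)
qed

text \<open>The exponents \<nu> + 1, \<nu> + 1, -\<nu> of the solutions and -\<nu> of the weight add
  up to 2, so with dy = i y d\<theta> only y K(y^2) remains. This is single-valued and odd, hence
  its integral over the diameter is zero.\<close>

lemma circ_Q_integral_2:
  assumes \<nu>: "\<nu> > 0" and b3: "1 / 2 + complex_of_real (- \<nu>) \<notin> \<int>\<^sub>\<le>\<^sub>0"
  shows "integral {0..pi} (\<lambda>\<theta>. circ_Q (\<nu> + 1) \<theta> * circ_Q (\<nu> + 1) \<theta> * circ_Q (- \<nu>) \<theta> * of_real (sin \<theta> powr \<nu>)) = 0"
    (is "integral _ ?q = 0")
proof -
  have b: "1 / 2 + complex_of_real (\<nu> + 1) \<notin> \<int>\<^sub>\<le>\<^sub>0"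
    by (rule Re_pos_not_nonpos_Int) (use \<nu> in simp)
  define K where "K = zb_triple \<nu> (\<nu> + 1) (\<nu> + 1) (- \<nu>)"
  define f where "f y = y * K (y\<^sup>2)" for y
  have contK: "continuous_on (cball 0 1) K" unfolding K_def by (rule continuous_on_zb_triple[OF \<nu> b b b3])
  have "integral {0..pi} (\<lambda>t. f (cis t) * (\<i> * cis t)) + integral {-1..1} (\<lambda>x. f (of_real x)) = 0"
  proof (rule half_disc_integral)
    show "continuous_on (cball 0 1 \<inter> {z. Im z \<ge> 0}) f"
      unfolding f_def
      by (intro continuous_intros continuous_on_compose2[OF contK]) (auto simp: norm_power power_le_one)
    fix z :: complex assume z: "norm z < 1" "Im z > 0"
    have z2: "norm (z\<^sup>2) < 1" using z by (simp add: norm_power power_less_one_iff abs_square_less_1)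
    have "(\<lambda>y. K (y\<^sup>2)) field_differentiable at z"
    proof (rule field_differentiable_compose[of "\<lambda>y. y\<^sup>2" z K, unfolded o_def])
      show "K field_differentiable at (z\<^sup>2)" unfolding K_def
        by (intro zb_triple_field_differentiable b b3 z2)
    qed (auto simp: field_differentiable_def intro!: exI derivative_eq_intros)
    thus "f field_differentiable at z" unfolding f_def[abs_def]
      by (intro field_differentiable_mult field_differentiable_ident)
  qed
  moreover have "integral {0..pi} (\<lambda>t. f (cis t) * (\<i> * cis t)) =
      integral {0..pi} (\<lambda>t. of_real (2 powr \<nu>) * cis ((1 - \<nu>) * pi / 2) * ?q t)"
  proof (rule integral_cong)
    fix t assume t: "t \<in> {0..pi}"
    have e2: "\<i> * cis t = cis (t + pi / 2)" by (simp add: complex_eq_iff cos_add sin_add)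
    have e3: "(cis t)\<^sup>2 = cis (2 * t)" by (simp add: Complex.DeMoivre)
    have "of_real (2 powr \<nu>) * cis ((1 - \<nu>) * pi / 2) * ?q t = (of_real (2 powr \<nu>) * of_real (2 powr - \<nu>)) *
         (cis ((1 - \<nu>) * pi / 2) * cis ((\<nu> + 1 + (\<nu> + 1) + (- \<nu>)) * t - \<nu> * (t - pi / 2))) * K (cis (2 * t))"
      using \<nu> by (subst circ_Q_triple[OF t]) (auto simp: K_def mult_ac)
    also have "of_real (2 powr \<nu>) * of_real (2 powr - \<nu>) = (1 :: complex)"
      by (simp flip: of_real_mult powr_add)
    also have "cis ((1 - \<nu>) * pi / 2) * cis ((\<nu> + 1 + (\<nu> + 1) + (- \<nu>)) * t - \<nu> * (t - pi / 2)) =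
               cis t * cis (t + pi / 2)"
      unfolding cis_mult by (rule arg_cong[where f = cis]) (simp add: field_simps)
    finally show "f (cis t) * (\<i> * cis t) = of_real (2 powr \<nu>) * cis ((1 - \<nu>) * pi / 2) * ?q t"
      unfolding f_def e2 e3 by (simp add: mult_ac)
  qed
  moreover have "integral {-1..1} (\<lambda>x. f (of_real x)) = 0"
  proof -
    have "integral {-1..1} (\<lambda>x. f (of_real x)) = integral {-1..1} (\<lambda>x. f (of_real (- x)))"
      using Henstock_Kurzweil_Integration.integral_reflect_real[of 1 "-1" "\<lambda>x. f (of_real x)"] by simp
    also have "\<dots> = integral {-1..1} (\<lambda>x. - f (of_real x))"
      by (simp add: f_def)
    finally show ?thesis by (simp add: integral_neg)
  qed
  ultimately show ?thesis by (simp add: integral_mult_right)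
qed

text \<open>Expanding the product leaves eight weighted triples of circle solutions. Each is
  continuous on the closed interval although the single factors may have logarithmic singularities
  at its ends.\<close>

lemma circ_Q_absolutely_integrable:
  assumes \<nu>: "0 < \<nu>" "\<nu> < 1 / 2"
    and w: "\<And>\<theta>. \<theta> \<in> {0<..<pi} \<Longrightarrow> w1 \<theta> = a1 * circ_Q (\<nu> + 1) \<theta> + c1 * circ_Q (- \<nu>) \<theta>"
      "\<And>\<theta>. \<theta> \<in> {0<..<pi} \<Longrightarrow> w2 \<theta> = a2 * circ_Q (\<nu> + 1) \<theta> + c2 * circ_Q (- \<nu>) \<theta>"
      "\<And>\<theta>. \<theta> \<in> {0<..<pi} \<Longrightarrow> w3 \<theta> = a3 * circ_Q (\<nu> + 1) \<theta> + c3 * circ_Q (- \<nu>) \<theta>"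
  shows "(\<lambda>\<theta>. w1 \<theta> * w2 \<theta> * w3 \<theta> * of_real (sin \<theta> powr \<nu>)) absolutely_integrable_on {0..pi}"
proof -
  have b: "1 / 2 + complex_of_real (\<nu> + 1) \<notin> \<int>\<^sub>\<le>\<^sub>0" "1 / 2 + complex_of_real (- \<nu>) \<notin> \<int>\<^sub>\<le>\<^sub>0"
    by (rule Re_pos_not_nonpos_Int; use \<nu> in simp)+
  let ?T = "\<lambda>b1 b2 b3 \<theta>. circ_Q b1 \<theta> * circ_Q b2 \<theta> * circ_Q b3 \<theta> * of_real (sin \<theta> powr \<nu>)"
  let ?b = "\<nu> + 1" and ?d = "- \<nu>"
  have T: "(\<lambda>\<theta>. c * ?T b1 b2 b3 \<theta>) absolutely_integrable_on {0..pi}"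
    if "1 / 2 + complex_of_real b1 \<notin> \<int>\<^sub>\<le>\<^sub>0" "1 / 2 + complex_of_real b2 \<notin> \<int>\<^sub>\<le>\<^sub>0" "1 / 2 + complex_of_real b3 \<notin> \<int>\<^sub>\<le>\<^sub>0" for b1 b2 b3 c
    by (intro absolutely_integrable_continuous_real continuous_on_mult_left continuous_on_circ_Q_triple that \<nu>)
  have "(\<lambda>\<theta>. (a1 * a2 * a3) * ?T ?b ?b ?b \<theta> + (a1 * a2 * c3) * ?T ?b ?b ?d \<theta> + (a1 * c2 * a3) * ?T ?b ?d ?b \<theta> + (a1 * c2 * c3) * ?T ?b ?d ?d \<theta> +
           (c1 * a2 * a3) * ?T ?d ?b ?b \<theta> + (c1 * a2 * c3) * ?T ?d ?b ?d \<theta> + (c1 * c2 * a3) * ?T ?d ?d ?b \<theta> + (c1 * c2 * c3) * ?T ?d ?d ?d \<theta>) absolutely_integrable_on {0..pi}"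
    by (intro set_integral_add(1) T b)
  thus ?thesis
  proof (rule absolutely_integrable_spike[of _ _ "{0, pi}"])
    fix \<theta> assume "\<theta> \<in> {0..pi} - {0, pi}"
    hence t: "\<theta> \<in> {0<..<pi}" by auto
    show "w1 \<theta> * w2 \<theta> * w3 \<theta> * of_real (sin \<theta> powr \<nu>) = (a1 * a2 * a3) * ?T ?b ?b ?b \<theta> + (a1 * a2 * c3) * ?T ?b ?b ?d \<theta> + (a1 * c2 * a3) * ?T ?b ?d ?b \<theta> + (a1 * c2 * c3) * ?T ?b ?d ?d \<theta> +
           (c1 * a2 * a3) * ?T ?d ?b ?b \<theta> + (c1 * a2 * c3) * ?T ?d ?b ?d \<theta> + (c1 * c2 * a3) * ?T ?d ?d ?b \<theta> + (c1 * c2 * c3) * ?T ?d ?d ?d \<theta>"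
      unfolding w[OF t] by (simp add: algebra_simps)
  qed auto
qed

text \<open>Put E = cis (\<nu> pi). Up to constants the first circle solution is u2 - E u1 and the
  second is u2 + u1/E. The reflection \<theta> -> pi - \<theta> swaps u1 and u2, so a and b are the
  only unknown cubic moments: the vanishing integral gives their ratio, the cube of the first
  solution their size.\<close>

lemma legendre_triple_theta:
  fixes \<nu> :: real
  assumes \<nu>: "0 < \<nu>" "\<nu> < 1 / 2"
  defines "u1 \<equiv> \<lambda>\<theta>. legendre_P (of_real \<nu>) (cos \<theta>)" and "u2 \<equiv> \<lambda>\<theta>. legendre_P (of_real \<nu>) (- cos \<theta>)"
  defines "a \<equiv> integral {0..pi} (\<lambda>\<theta>. u1 \<theta> * u1 \<theta> * u1 \<theta> * of_real (sin \<theta> powr \<nu>))"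
  defines "b \<equiv> integral {0..pi} (\<lambda>\<theta>. u1 \<theta> * u1 \<theta> * u2 \<theta> * of_real (sin \<theta> powr \<nu>))"
  shows "(\<lambda>\<theta>. u1 \<theta> * u1 \<theta> * u1 \<theta> * of_real (sin \<theta> powr \<nu>)) absolutely_integrable_on {0..pi}"
    and "(\<lambda>\<theta>. u1 \<theta> * u1 \<theta> * u2 \<theta> * of_real (sin \<theta> powr \<nu>)) absolutely_integrable_on {0..pi}"
    and "a = of_real (3 - 2 * cos (\<nu> * pi)) * b"
    and "of_real (2 powr \<nu> * pi ^ 3) * zb_kappa (1 / 2) (of_real (\<nu> + 1)) ^ 3 * b = 8 * of_real (cos (\<nu> * pi / 2)) ^ 3 *
           integral {0..1} (\<lambda>x. of_real (x powr (2 * \<nu> + 2)) * zb_triple \<nu> (\<nu> + 1) (\<nu> + 1) (\<nu> + 1) (of_real (x\<^sup>2)))"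
proof -
  define E where "E = cis (\<nu> * pi)"
  define S C where "S = complex_of_real (sin (\<nu> * pi / 2))" and "C = complex_of_real (cos (\<nu> * pi / 2))"
  define k k' where "k = zb_kappa (1 / 2) (of_real (\<nu> + 1))" and "k' = zb_kappa (1 / 2) (of_real (- \<nu>))"
  define kP where "kP = zb_kappa (- of_real \<nu>) (of_real \<nu> + 1)"
  define j where "j = integral {0..1} (\<lambda>x. of_real (x powr (2 * \<nu> + 2)) * zb_triple \<nu> (\<nu> + 1) (\<nu> + 1) (\<nu> + 1) (of_real (x\<^sup>2)))"
  let ?q = "circ_Q (\<nu> + 1)" and ?s = "circ_Q (- \<nu>)"
  let ?w = "\<lambda>\<theta>. complex_of_real (sin \<theta> powr \<nu>)"
  have E: "E \<noteq> 0" "cis (- \<nu> * pi) = 1 / E" by (simp_all add: E_def cis_inverse flip: inverse_eq_divide)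
  have not_nonpos: "complex_of_real x \<notin> \<int>\<^sub>\<le>\<^sub>0" if "of_int m < x" "x < of_int (m + 1)" for x m
  proof
    assume "complex_of_real x \<in> \<int>\<^sub>\<le>\<^sub>0"
    then obtain n where "x = of_int n" by (auto elim!: nonpos_Ints_cases simp: complex_eq_iff)
    with that show False by (simp only: of_int_less_iff)
  qed
  have b: "complex_of_real (\<nu> + 1) \<notin> \<int>\<^sub>\<le>\<^sub>0" "1 / 2 + complex_of_real (\<nu> + 1) \<notin> \<int>\<^sub>\<le>\<^sub>0"
       "1 / 2 + complex_of_real (- \<nu>) \<notin> \<int>\<^sub>\<le>\<^sub>0" "1 / 2 \<notin> (\<int>\<^sub>\<le>\<^sub>0 :: complex set)"
    by (rule Re_pos_not_nonpos_Int; use \<nu> in simp)+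
  have b': "complex_of_real (- \<nu>) \<notin> \<int>\<^sub>\<le>\<^sub>0"
    by (rule not_nonpos[of "-1"]) (use \<nu> in auto)
  have b1: "complex_of_real (- \<nu> - 1) \<notin> \<int>\<^sub>\<le>\<^sub>0"
    by (rule not_nonpos[of "-2"]) (use \<nu> in auto)
  have "complex_of_real (- \<nu> - 1 / 2) \<notin> \<int>\<^sub>\<le>\<^sub>0"
    by (rule not_nonpos[of "-1"]) (use \<nu> in auto)
  moreover have "complex_of_real (- \<nu> - 1 / 2) = 1 / 2 + complex_of_real (- \<nu> - 1)"
    by (simp add: complex_eq_iff)
  ultimately have b2: "1 / 2 + complex_of_real (- \<nu> - 1) \<notin> \<int>\<^sub>\<le>\<^sub>0" by metis
  have k: "k \<noteq> 0" "k' \<noteq> 0"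
    using b b' by (auto simp: k_def k'_def zb_kappa_def Gamma_eq_zero_iff rGamma_eq_zero_iff)
  have sc: "sin (\<nu> * pi / 2) > 0" "cos (\<nu> * pi / 2) > 0" "cos (\<nu> * pi) > 0"
  proof -
    have "\<nu> * pi < pi / 2" using mult_strict_right_mono[OF \<nu>(2) pi_gt_zero] by simp
    moreover have "0 < \<nu> * pi" using \<nu> by simp
    ultimately have "0 < \<nu> * pi / 2" "\<nu> * pi / 2 < pi / 2" "\<nu> * pi / 2 < pi" "- (pi / 2) < \<nu> * pi / 2" "- (pi / 2) < \<nu> * pi" "\<nu> * pi < pi / 2"
      using pi_gt_zero by linarith+
    thus "sin (\<nu> * pi / 2) > 0" "cos (\<nu> * pi / 2) > 0" "cos (\<nu> * pi) > 0"
      by (blast intro: sin_gt_zero cos_gt_zero_pi)+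
  qed
  have SC: "S \<noteq> 0" "C \<noteq> 0" using sc by (auto simp: S_def C_def)
  have SC1: "S\<^sup>2 + C\<^sup>2 = 1" by (simp add: S_def C_def flip: of_real_power of_real_add)
  have E_half: "E = (C + \<i> * S)\<^sup>2"
  proof -
    have "C + \<i> * S = cis (\<nu> * pi / 2)" by (simp add: C_def S_def complex_eq_iff)
    thus ?thesis by (simp add: E_def Complex.DeMoivre)
  qed
  have cosE: "2 * complex_of_real (cos (\<nu> * pi)) = E + 1 / E"
    unfolding E(2)[symmetric] by (simp add: E_def complex_eq_iff)
  hence D: "E + 1 / E \<noteq> 0" using sc(3) by (metis less_irrefl mult_eq_0_iff of_real_eq_0_iff zero_neq_numeral)
  have kP: "kP = - (2 * S * C) / of_real pi"
  proof -
    have "kP = - complex_of_real (sin (pi * \<nu>)) / of_real pi"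
      unfolding kP_def zb_kappa_legendre by (simp flip: sin_of_real)
    also have "pi * \<nu> = 2 * (\<nu> * pi / 2)" by simp
    finally show ?thesis unfolding sin_double by (simp add: S_def C_def)
  qed
  have kP0: "kP \<noteq> 0" using SC by (simp add: kP)
  have q: "?q \<theta> * (2 * kP) = k * (u2 \<theta> - E * u1 \<theta>)" if "\<theta> \<in> {0<..<pi}" for \<theta>
    unfolding u1_def u2_def k_def kP_def E_def using circ_Q_connection[OF b(1,2) that] by simp
  have s: "?s \<theta> * (2 * kP) = k' * (u2 \<theta> + 1 / E * u1 \<theta>)" if "\<theta> \<in> {0<..<pi}" for \<theta>
    unfolding u1_def u2_def k'_def kP_def E(2)[symmetric] using circ_Q_connection'[OF b1 b2 that] by simp
  define K K' where "K = 2 * kP / k" and "K' = 2 * kP / k'"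
  have K: "K \<noteq> 0" "K' \<noteq> 0" using k kP0 by (auto simp: K_def K'_def)
  have qK: "K * ?q \<theta> = u2 \<theta> - E * u1 \<theta>" if "\<theta> \<in> {0<..<pi}" for \<theta>
    using q[OF that] k by (simp add: K_def field_simps)
  have sK: "K' * ?s \<theta> = u2 \<theta> + 1 / E * u1 \<theta>" if "\<theta> \<in> {0<..<pi}" for \<theta>
    using s[OF that] k by (simp add: K'_def field_simps)
  define d where "d = E + 1 / E"
  have d: "d \<noteq> 0" using D by (simp add: d_def)
  have u1: "u1 \<theta> = (- K / d) * ?q \<theta> + (K' / d) * ?s \<theta>" if "\<theta> \<in> {0<..<pi}" for \<theta>
  proof -
    have "d * u1 \<theta> = K' * ?s \<theta> - K * ?q \<theta>"
      unfolding qK[OF that] sK[OF that] by (simp add: d_def algebra_simps)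
    thus ?thesis using d by (simp add: field_simps)
  qed
  have u2: "u2 \<theta> = (K - E * K / d) * ?q \<theta> + (E * K' / d) * ?s \<theta>" if "\<theta> \<in> {0<..<pi}" for \<theta>
  proof -
    have "u2 \<theta> = K * ?q \<theta> + E * u1 \<theta>" using qK[OF that] by simp
    thus ?thesis unfolding u1[OF that] by (simp add: algebra_simps)
  qed
  have aint111: "(\<lambda>\<theta>. u1 \<theta> * u1 \<theta> * u1 \<theta> * ?w \<theta>) absolutely_integrable_on {0..pi}"
    by (rule circ_Q_absolutely_integrable[OF \<nu> u1 u1 u1])
  have aint112: "(\<lambda>\<theta>. u1 \<theta> * u1 \<theta> * u2 \<theta> * ?w \<theta>) absolutely_integrable_on {0..pi}"
    by (rule circ_Q_absolutely_integrable[OF \<nu> u1 u1 u2])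
  note int111 = set_lebesgue_integral_eq_integral(1)[OF aint111]
    and int112 = set_lebesgue_integral_eq_integral(1)[OF aint112]
  have reflect: "((\<lambda>\<theta>. f (pi - \<theta>)) has_integral integral {0..pi} f) {0..pi}"
    if "f integrable_on {0..pi}" for f :: "real \<Rightarrow> complex"
  proof -
    have "(f has_integral integral {0..pi} f) (cbox 0 pi)" using that by auto
    from has_integral_affinity[OF this, of "-1" pi]
    have "((\<lambda>\<theta>. f (pi - \<theta>)) has_integral integral {0..pi} f) ((\<lambda>x. pi - x) ` {0..pi})" by simp
    also have "(\<lambda>x. pi - x) ` {0..pi} = {0..pi}" by (auto intro!: image_eqI[of _ _ "pi - _"])
    finally show ?thesis .
  qed
  have uu: "u1 (pi - \<theta>) = u2 \<theta>" "u2 (pi - \<theta>) = u1 \<theta>" for \<theta> by (simp_all add: u1_def u2_def)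
  have a1: "((\<lambda>\<theta>. u1 \<theta> * u1 \<theta> * u1 \<theta> * ?w \<theta>) has_integral a) {0..pi}"
    using int111 by (simp add: a_def has_integral_integral)
  have b1: "((\<lambda>\<theta>. u1 \<theta> * u1 \<theta> * u2 \<theta> * ?w \<theta>) has_integral b) {0..pi}"
    using int112 by (simp add: b_def has_integral_integral)
  have a2: "((\<lambda>\<theta>. u2 \<theta> * u2 \<theta> * u2 \<theta> * ?w \<theta>) has_integral a) {0..pi}"
    using reflect[OF int111] by (simp add: uu a_def)
  have b2: "((\<lambda>\<theta>. u2 \<theta> * u2 \<theta> * u1 \<theta> * ?w \<theta>) has_integral b) {0..pi}"
    using reflect[OF int112] by (simp add: uu b_def)
  \<comment> \<open>R2 and R1 below expand the vanishing, respectively known, integrals of q q s and q q q.\<close>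
  have R2: "a + b * (E\<^sup>2 - 2) + (1 / E - 2 * E) * b + E * a = 0"
  proof -
    have "((\<lambda>\<theta>. u2 \<theta> * u2 \<theta> * u2 \<theta> * ?w \<theta> + (E\<^sup>2 - 2) * (u1 \<theta> * u1 \<theta> * u2 \<theta> * ?w \<theta>)
               + (1 / E - 2 * E) * (u2 \<theta> * u2 \<theta> * u1 \<theta> * ?w \<theta>) + E * (u1 \<theta> * u1 \<theta> * u1 \<theta> * ?w \<theta>))
        has_integral (a + (E\<^sup>2 - 2) * b + (1 / E - 2 * E) * b + E * a)) {0..pi}"
      by (intro has_integral_add has_integral_mult_right a1 a2 b1 b2)
    moreover have "((\<lambda>\<theta>. K * K * K' * (?q \<theta> * ?q \<theta> * ?s \<theta> * ?w \<theta>)) has_integral (K * K * K' * 0)) {0..pi}"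
    proof (intro has_integral_mult_right)
      have "(\<lambda>\<theta>. ?q \<theta> * ?q \<theta> * ?s \<theta> * ?w \<theta>) integrable_on {0..pi}"
        by (intro integrable_continuous_real continuous_on_circ_Q_triple b \<nu>)
      thus "((\<lambda>\<theta>. ?q \<theta> * ?q \<theta> * ?s \<theta> * ?w \<theta>) has_integral 0) {0..pi}"
        using circ_Q_integral_2[OF \<nu>(1) b(3)] by (metis has_integral_integral)
    qed
    hence "((\<lambda>\<theta>. u2 \<theta> * u2 \<theta> * u2 \<theta> * ?w \<theta> + (E\<^sup>2 - 2) * (u1 \<theta> * u1 \<theta> * u2 \<theta> * ?w \<theta>)
               + (1 / E - 2 * E) * (u2 \<theta> * u2 \<theta> * u1 \<theta> * ?w \<theta>) + E * (u1 \<theta> * u1 \<theta> * u1 \<theta> * ?w \<theta>))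
        has_integral (K * K * K' * 0)) {0..pi}"
    proof (rule has_integral_spike[of "{0, pi}", rotated 2])
      fix \<theta> assume "\<theta> \<in> {0..pi} - {0, pi}"
      hence t: "\<theta> \<in> {0<..<pi}" by auto
      have "K * K * K' * (?q \<theta> * ?q \<theta> * ?s \<theta> * ?w \<theta>) = (K * ?q \<theta>) * (K * ?q \<theta>) * (K' * ?s \<theta>) * ?w \<theta>"
        by (simp add: mult_ac)
      also have "\<dots> = u2 \<theta> * u2 \<theta> * u2 \<theta> * ?w \<theta> + (E\<^sup>2 - 2) * (u1 \<theta> * u1 \<theta> * u2 \<theta> * ?w \<theta>)
               + (1 / E - 2 * E) * (u2 \<theta> * u2 \<theta> * u1 \<theta> * ?w \<theta>) + E * (u1 \<theta> * u1 \<theta> * u1 \<theta> * ?w \<theta>)"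
        unfolding qK[OF t] sK[OF t] using E(1) by (simp add: divide_simps) (simp add: power2_eq_square algebra_simps)
      finally show "u2 \<theta> * u2 \<theta> * u2 \<theta> * ?w \<theta> + (E\<^sup>2 - 2) * (u1 \<theta> * u1 \<theta> * u2 \<theta> * ?w \<theta>)
               + (1 / E - 2 * E) * (u2 \<theta> * u2 \<theta> * u1 \<theta> * ?w \<theta>) + E * (u1 \<theta> * u1 \<theta> * u1 \<theta> * ?w \<theta>)
          = K * K * K' * (?q \<theta> * ?q \<theta> * ?s \<theta> * ?w \<theta>)" ..
    qed auto
    ultimately have "a + (E\<^sup>2 - 2) * b + (1 / E - 2 * E) * b + E * a = K * K * K' * 0"
      by (rule has_integral_unique)
    thus ?thesis by (simp add: mult.commute)
  qed
  have E1: "E + 1 \<noteq> 0"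
  proof
    assume "E + 1 = 0"
    hence "E = -1" by (simp add: eq_neg_iff_add_eq_0)
    hence "complex_of_real (cos (\<nu> * pi)) = -1" using cosE by simp
    thus False using sc(3) by (simp add: complex_eq_iff)
  qed
  have ab: "a = (3 - (E + 1 / E)) * b"
  proof -
    \<comment> \<open>The vanishing relation R2 contains the wanted ratio multiplied by the extra
      factor E + 1.\<close>
    have "(E + 1) * (a - (3 - (E + 1 / E)) * b) = a + b * (E\<^sup>2 - 2) + (1 / E - 2 * E) * b + E * a"
      using E(1) by (simp add: divide_simps) (simp add: power2_eq_square algebra_simps)
    also have "\<dots> = 0" by (rule R2)
    finally show ?thesis using E1 by simp
  qed
  thus "a = of_real (3 - 2 * cos (\<nu> * pi)) * b" using cosE by simp
  have R1: "of_real (2 powr \<nu>) * cis (- (3 * \<nu> + 1) * pi / 2) * (a - 3 * E * b + 3 * E\<^sup>2 * b - E ^ 3 * a) = (E + 1 / E) * (K ^ 3 * j)"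
  proof -
    define I where "I = integral {0..pi} (\<lambda>\<theta>. ?q \<theta> * ?q \<theta> * ?q \<theta> * ?w \<theta>)"
    have "((\<lambda>\<theta>. u2 \<theta> * u2 \<theta> * u2 \<theta> * ?w \<theta> - (3 * E) * (u2 \<theta> * u2 \<theta> * u1 \<theta> * ?w \<theta>)
               + (3 * E\<^sup>2) * (u1 \<theta> * u1 \<theta> * u2 \<theta> * ?w \<theta>) - E ^ 3 * (u1 \<theta> * u1 \<theta> * u1 \<theta> * ?w \<theta>))
        has_integral (a - (3 * E) * b + (3 * E\<^sup>2) * b - E ^ 3 * a)) {0..pi}"
      by (intro has_integral_add has_integral_diff has_integral_mult_right a1 a2 b1 b2)
    moreover have "((\<lambda>\<theta>. K ^ 3 * (?q \<theta> * ?q \<theta> * ?q \<theta> * ?w \<theta>)) has_integral (K ^ 3 * I)) {0..pi}"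
      unfolding I_def
      by (intro has_integral_mult_right integrable_integral integrable_continuous_real continuous_on_circ_Q_triple b \<nu>)
    hence "((\<lambda>\<theta>. u2 \<theta> * u2 \<theta> * u2 \<theta> * ?w \<theta> - (3 * E) * (u2 \<theta> * u2 \<theta> * u1 \<theta> * ?w \<theta>)
               + (3 * E\<^sup>2) * (u1 \<theta> * u1 \<theta> * u2 \<theta> * ?w \<theta>) - E ^ 3 * (u1 \<theta> * u1 \<theta> * u1 \<theta> * ?w \<theta>))
        has_integral (K ^ 3 * I)) {0..pi}"
    proof (rule has_integral_spike[of "{0, pi}", rotated 2])
      fix \<theta> assume "\<theta> \<in> {0..pi} - {0, pi}"
      hence t: "\<theta> \<in> {0<..<pi}" by auto
      have "K ^ 3 * (?q \<theta> * ?q \<theta> * ?q \<theta> * ?w \<theta>) = (K * ?q \<theta>) * (K * ?q \<theta>) * (K * ?q \<theta>) * ?w \<theta>"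
        by (simp add: mult_ac power3_eq_cube)
      also have "\<dots> = u2 \<theta> * u2 \<theta> * u2 \<theta> * ?w \<theta> - (3 * E) * (u2 \<theta> * u2 \<theta> * u1 \<theta> * ?w \<theta>)
               + (3 * E\<^sup>2) * (u1 \<theta> * u1 \<theta> * u2 \<theta> * ?w \<theta>) - E ^ 3 * (u1 \<theta> * u1 \<theta> * u1 \<theta> * ?w \<theta>)"
        unfolding qK[OF t] by (simp add: power2_eq_square power3_eq_cube algebra_simps)
      finally show "u2 \<theta> * u2 \<theta> * u2 \<theta> * ?w \<theta> - (3 * E) * (u2 \<theta> * u2 \<theta> * u1 \<theta> * ?w \<theta>)
               + (3 * E\<^sup>2) * (u1 \<theta> * u1 \<theta> * u2 \<theta> * ?w \<theta>) - E ^ 3 * (u1 \<theta> * u1 \<theta> * u1 \<theta> * ?w \<theta>)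
          = K ^ 3 * (?q \<theta> * ?q \<theta> * ?q \<theta> * ?w \<theta>)" ..
    qed auto
    ultimately have I: "a - (3 * E) * b + (3 * E\<^sup>2) * b - E ^ 3 * a = K ^ 3 * I"
      by (rule has_integral_unique)
    have "of_real (2 powr \<nu>) * cis (- (3 * \<nu> + 1) * pi / 2) * I = (E + 1 / E) * j"
      using circ_Q_integral_1[OF \<nu>(1)] unfolding cosE I_def j_def .
    thus ?thesis unfolding I by (simp add: mult_ac)
  qed
  \<comment> \<open>Inserting the ratio produces the factor E + 1/E = 2 cos(\<nu> pi), which cancels
    against the same factor of the diameter integral in R1.\<close>
  have brk: "a - 3 * E * b + 3 * E\<^sup>2 * b - E ^ 3 * a = (E - 1) ^ 3 * (E + 1 / E) * b"
    unfolding ab using E(1) by (simp add: divide_simps) (simp add: power2_eq_square power3_eq_cube algebra_simps)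
  have "of_real (2 powr \<nu>) * cis (- (3 * \<nu> + 1) * pi / 2) * (E - 1) ^ 3 * b = K ^ 3 * j"
    using R1 D unfolding brk by (simp add: mult_ac)
  moreover have "cis (- (3 * \<nu> + 1) * pi / 2) * (E - 1) ^ 3 = - 8 * S ^ 3"
  proof -
    define h where "h = C + \<i> * S"
    have h: "h = cis (\<nu> * pi / 2)" by (simp add: h_def C_def S_def complex_eq_iff)
    \<comment> \<open>Half-angle form, E - 1 = 2 i sin(\<nu> pi/2) cis (\<nu> pi/2). The phase of
      its cube is undone by the prefactor of R1.\<close>
    have "E - 1 = h * (2 * \<i> * S)"
      unfolding E_half h_def using SC1 by (simp add: power2_eq_square algebra_simps)
    hence "(E - 1) ^ 3 = h ^ 3 * (- 8 * \<i> * S ^ 3)"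
      by (simp add: power_mult_distrib power3_eq_cube)
    moreover have "cis (- (3 * \<nu> + 1) * pi / 2) * h ^ 3 = - \<i>"
    proof -
      have "cis (- (3 * \<nu> + 1) * pi / 2) * h ^ 3 = cis (- (3 * \<nu> + 1) * pi / 2 + 3 * (\<nu> * pi / 2))"
        unfolding h by (simp add: Complex.DeMoivre cis_mult)
      also have "- (3 * \<nu> + 1) * pi / 2 + 3 * (\<nu> * pi / 2) = - (pi / 2)" by (simp add: field_simps)
      finally show ?thesis by (simp add: complex_eq_iff)
    qed
    ultimately have "cis (- (3 * \<nu> + 1) * pi / 2) * (E - 1) ^ 3 = - \<i> * (- 8 * \<i> * S ^ 3)"
      by (metis mult.assoc)
    thus ?thesis by simp
  qed
  ultimately have "of_real (2 powr \<nu>) * (- 8 * S ^ 3) * b = K ^ 3 * j"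
    by (metis mult.assoc)
  \<comment> \<open>By the reflection formula kP is - sin(\<nu> pi)/pi = - 2 S C/pi. So the cube of
    S cancels and the cube of C, the cosine factor of the theorem, survives.\<close>
  also have "K ^ 3 = - 64 * S ^ 3 * C ^ 3 / (of_real pi ^ 3 * k ^ 3)"
    using k by (simp add: K_def kP power3_eq_cube field_simps)
  finally have "of_real (2 powr \<nu>) * (- 8 * S ^ 3) * b * (of_real pi ^ 3 * k ^ 3) = - 64 * S ^ 3 * C ^ 3 * j"
    using k by (simp add: field_simps)
  hence "(- 8 * S ^ 3) * (of_real (2 powr \<nu> * pi ^ 3) * k ^ 3 * b) = (- 8 * S ^ 3) * (8 * C ^ 3 * j)"
    by (simp add: mult_ac)
  hence "of_real (2 powr \<nu> * pi ^ 3) * k ^ 3 * b = 8 * C ^ 3 * j"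
    using SC by (subst (asm) mult_cancel_left) auto
  thus "of_real (2 powr \<nu> * pi ^ 3) * zb_kappa (1 / 2) (of_real (\<nu> + 1)) ^ 3 * b = 8 * of_real (cos (\<nu> * pi / 2)) ^ 3 *
           integral {0..1} (\<lambda>x. of_real (x powr (2 * \<nu> + 2)) * zb_triple \<nu> (\<nu> + 1) (\<nu> + 1) (\<nu> + 1) (of_real (x\<^sup>2)))"
    unfolding k_def C_def j_def .
  show "(\<lambda>\<theta>. u1 \<theta> * u1 \<theta> * u1 \<theta> * ?w \<theta>) absolutely_integrable_on {0..pi}" by (rule aint111)
  show "(\<lambda>\<theta>. u1 \<theta> * u1 \<theta> * u2 \<theta> * ?w \<theta>) absolutely_integrable_on {0..pi}" by (rule aint112)
qed

section \<open>Recurrence and asymptotics of the real integral\<close>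

definition rcoeff :: "real \<Rightarrow> nat \<Rightarrow> real" where
  "rcoeff b n = pochhammer (1 / 2) n * pochhammer b n / (pochhammer (1 / 2 + b) n * fact n)"

definition rF :: "real \<Rightarrow> real \<Rightarrow> real" where
  "rF b x = (\<Sum>n. rcoeff b n * x ^ n)"

lemma of_real_rcoeff: "of_real (rcoeff b n) = zb_coeff (1 / 2) (of_real b) n"
proof -
  have "pochhammer (1 / 2 :: complex) n = of_real (pochhammer (1 / 2) n)"
    using pochhammer_of_real[of "1 / 2 :: real" n, where 'a = complex] by simp
  moreover have "pochhammer (1 / 2 + of_real b :: complex) n = of_real (pochhammer (1 / 2 + b) n)"
    using pochhammer_of_real[of "1 / 2 + b" n, where 'a = complex] by simp
  ultimately show ?thesis
    by (simp add: rcoeff_def zb_coeff_def pochhammer_of_real)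
qed

lemma half_plus_pos:
  assumes "b > 0"
  shows "1 / 2 + complex_of_real b \<notin> \<int>\<^sub>\<le>\<^sub>0" "complex_of_real b \<notin> \<int>\<^sub>\<le>\<^sub>0" "1 / 2 + complex_of_real (b + 1) \<notin> \<int>\<^sub>\<le>\<^sub>0"
  by (rule Re_pos_not_nonpos_Int; use assms in simp)+

lemma zb_F_of_real:
  assumes b: "b > 0" and x: "\<bar>x\<bar> < 1"
  shows "(\<lambda>n. rcoeff b n * x ^ n) sums rF b x"
    and "zb_F (1 / 2) (of_real b) (of_real x) = of_real (rF b x)"
proof -
  have "(\<lambda>n. zb_coeff (1 / 2) (of_real b) n * of_real x ^ n) sums zb_F (1 / 2) (of_real b) (of_real x)"
    by (rule zb_F_sums) (use half_plus_pos[OF b] x in auto)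
  hence 1: "(\<lambda>n. complex_of_real (rcoeff b n * x ^ n)) sums zb_F (1 / 2) (of_real b) (of_real x)"
    by (simp add: of_real_rcoeff)
  have "(\<lambda>n. rcoeff b n * x ^ n) sums Re (zb_F (1 / 2) (of_real b) (of_real x))"
    using sums_Re[OF 1] by simp
  thus s: "(\<lambda>n. rcoeff b n * x ^ n) sums rF b x"
    unfolding rF_def by (simp add: sums_iff)
  have "(\<lambda>n. complex_of_real (rcoeff b n * x ^ n)) sums of_real (rF b x)"
    using s by (rule sums_of_real)
  with 1 show "zb_F (1 / 2) (of_real b) (of_real x) = of_real (rF b x)"
    by (rule sums_unique2)
qed

lemma rF_deriv:
  assumes b: "b > 0" and x: "\<bar>x\<bar> < 1"
  shows "(rF b has_real_derivative b * (rF b x - b / (1 / 2 + b) * rF (b + 1) x) / (1 - x)) (at x)"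
    and "x \<noteq> 0 \<Longrightarrow> (rF (b + 1) has_real_derivative
           ((1 / 2 + b) * (rF b x - rF (b + 1) x) + x / 2 * rF (b + 1) x) / (x * (1 - x))) (at x)"
proof -
  have z: "norm (complex_of_real x) < 1" "complex_of_real x \<noteq> 1" using x by auto
  have x1: "1 - x \<noteq> 0" using x by auto
  have gen: "(rF c has_real_derivative d) (at x)" if c: "c > 0"
    and H: "zb_H (1 / 2) (of_real c) (of_real x) / (1 - of_real x) = of_real d" for c d
  proof -
    have "(zb_F (1 / 2) (of_real c) has_field_derivative of_real d) (at (of_real x))"
      using zb_F_has_field_derivative_ball[OF half_plus_pos(1)[OF c] z(1)] unfolding H .
    hence "((\<lambda>t. zb_F (1 / 2) (of_real c) (of_real t)) has_vector_derivative of_real d) (at x)"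
      by (rule has_vector_derivative_real_field)
    hence "((\<lambda>t. Re (zb_F (1 / 2) (of_real c) (of_real t))) has_vector_derivative Re (of_real d)) (at x)"
      by (rule bounded_linear.has_vector_derivative[OF bounded_linear_Re])
    hence "((\<lambda>t. Re (zb_F (1 / 2) (of_real c) (of_real t))) has_real_derivative d) (at x)"
      by (simp add: has_real_derivative_iff_has_vector_derivative)
    thus ?thesis
      by (rule has_field_derivative_transform_within_open[where S = "{-1<..<1}"])
         (use x zb_F_of_real(2)[OF c] in auto)
  qed
  note C = zb_H_contiguous[OF half_plus_pos(1,2)[OF b] less_imp_le[OF z(1)] z(2)]
  note F = zb_F_of_real(2)[OF b x] zb_F_of_real(2)[of "b + 1" x]
  show "(rF b has_real_derivative b * (rF b x - b / (1 / 2 + b) * rF (b + 1) x) / (1 - x)) (at x)"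
  proof (rule gen[OF b])
    show "zb_H (1 / 2) (of_real b) (of_real x) / (1 - of_real x) = complex_of_real (b * (rF b x - b / (1 / 2 + b) * rF (b + 1) x) / (1 - x))"
      using C(1) F b x by simp
  qed
  assume x0: "x \<noteq> 0"
  show "(rF (b + 1) has_real_derivative
           ((1 / 2 + b) * (rF b x - rF (b + 1) x) + x / 2 * rF (b + 1) x) / (x * (1 - x))) (at x)"
  proof (rule gen)
    have "zb_H (1 / 2) (of_real (b + 1)) (of_real x) = complex_of_real (((1 / 2 + b) * (rF b x - rF (b + 1) x) + x / 2 * rF (b + 1) x) / x)"
      using C(2) F b x x0 by (simp add: field_simps)
    thus "zb_H (1 / 2) (of_real (b + 1)) (of_real x) / (1 - of_real x) = complex_of_real (((1 / 2 + b) * (rF b x - rF (b + 1) x) + x / 2 * rF (b + 1) x) / (x * (1 - x)))"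
      by simp
  qed (use b in simp)
qed

section \<open>The ladder system on the real radius and creative telescoping\<close>

definition rQ :: "real \<Rightarrow> real \<Rightarrow> real" where
  "rQ n y = y powr n * rF n (y\<^sup>2)"

text \<open>\<open>rQ\<close> is \<open>circ_Q\<close> continued from the circle to the radius. With
  y = exp(-t) one has z = cosh t and s = sinh t, and the system is the ladder system with cos and
  sin replaced by their hyperbolic counterparts.\<close>

lemma rQ_deriv:
  assumes n: "n > 0" and y: "0 < y" "y < 1"
  defines "s \<equiv> (1 - y\<^sup>2) / (2 * y)" and "z \<equiv> (1 + y\<^sup>2) / (2 * y)" and "\<rho> \<equiv> n / (n + 1 / 2)"
  shows "(rQ n has_real_derivative n * (z * rQ n y - \<rho> * rQ (n + 1) y) / (s * y)) (at y)"
    and "((\<lambda>y. \<rho> * rQ (n + 1) y) has_real_derivative n * (rQ n y - z * (\<rho> * rQ (n + 1) y)) / (s * y)) (at y)"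
proof -
  have y2: "\<bar>y\<^sup>2\<bar> < 1" "y\<^sup>2 \<noteq> 0" "1 - y\<^sup>2 \<noteq> 0"
    using y by (auto simp: abs_square_less_1 power2_eq_1_iff)
  note D = rF_deriv[OF n y2(1)]
  have sq: "((\<lambda>y. y\<^sup>2) has_real_derivative 2 * y) (at y)" by (auto intro!: derivative_eq_intros)
  have pw: "((\<lambda>y. y powr c) has_real_derivative c * y powr c / y) (at y)" for c
    using y by (auto intro!: derivative_eq_intros simp: powr_diff)
  have p1: "y powr (n + 1) = y powr n * y" using y by (simp add: powr_add)
  define Y F F1 where "Y = y powr n" and "F = rF n (y\<^sup>2)" and "F1 = rF (n + 1) (y\<^sup>2)"
  note fold = Y_def[symmetric] F_def[symmetric] F1_def[symmetric]
  have "(rQ n has_real_derivative (n * y powr n / y) * rF n (y\<^sup>2) + (n * (rF n (y\<^sup>2) - n / (1 / 2 + n) * rF (n + 1) (y\<^sup>2)) / (1 - y\<^sup>2) * (2 * y)) * y powr n) (at y)"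
    unfolding rQ_def by (intro DERIV_mult pw DERIV_chain2[OF D(1) sq])
  moreover have "(n * Y / y) * F + (n * (F - n / (1 / 2 + n) * F1) / (1 - y\<^sup>2) * (2 * y)) * Y =
         n * (z * (Y * F) - \<rho> * (Y * y * F1)) / (s * y)"
  proof -
    have e: "s * y = (1 - y\<^sup>2) / 2" "1 / 2 + n = n + 1 / 2" using y by (auto simp: s_def)
    define w where "w = 1 - y\<^sup>2"
    have w: "w \<noteq> 0" "y\<^sup>2 = 1 - w" using y2 by (auto simp: w_def)
    have zz: "z = (2 - w) / (2 * y)" by (simp add: z_def w_def)
    have "(n * Y / y) * F + (n * (F - \<rho> * F1) / w * (2 * y)) * Y = n * (z * (Y * F) - \<rho> * (Y * y * F1)) / (w / 2)"
      unfolding zz using w(1) y by (simp add: field_simps) (simp add: w_def power2_eq_square algebra_simps)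
    thus ?thesis unfolding e w_def[symmetric] \<rho>_def by simp
  qed
  ultimately show "(rQ n has_real_derivative n * (z * rQ n y - \<rho> * rQ (n + 1) y) / (s * y)) (at y)"
    unfolding rQ_def p1 fold by simp
  have "(rQ (n + 1) has_real_derivative ((n + 1) * y powr (n + 1) / y) * rF (n + 1) (y\<^sup>2) +
      (((1 / 2 + n) * (rF n (y\<^sup>2) - rF (n + 1) (y\<^sup>2)) + y\<^sup>2 / 2 * rF (n + 1) (y\<^sup>2)) / (y\<^sup>2 * (1 - y\<^sup>2)) * (2 * y)) * y powr (n + 1)) (at y)"
    unfolding rQ_def by (intro DERIV_mult pw DERIV_chain2[OF D(2) sq] y2)
  from DERIV_cmult[OF this, of \<rho>]
  have "((\<lambda>y. \<rho> * rQ (n + 1) y) has_real_derivative \<rho> * (((n + 1) * (Y * y) / y) * F1 +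
      (((1 / 2 + n) * (F - F1) + y\<^sup>2 / 2 * F1) / (y\<^sup>2 * (1 - y\<^sup>2)) * (2 * y)) * (Y * y))) (at y)"
    unfolding p1 fold .
  moreover have "\<rho> * (((n + 1) * (Y * y) / y) * F1 +
      (((1 / 2 + n) * (F - F1) + y\<^sup>2 / 2 * F1) / (y\<^sup>2 * (1 - y\<^sup>2)) * (2 * y)) * (Y * y)) =
      n * (Y * F - z * (\<rho> * (Y * y * F1))) / (s * y)"
  proof -
    define w where "w = 1 - y\<^sup>2"
    define N where "N = n + 1 / 2"
    have w: "w \<noteq> 0" using y2 by (auto simp: w_def)
    have N: "N \<noteq> 0" "n = N - 1 / 2" "1 / 2 + n = N" using n by (auto simp: N_def)
    have e: "s * y = w / 2" using y by (auto simp: s_def w_def)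
    have z: "z * y = (2 - w) / 2" using y by (simp add: z_def w_def)
    have r: "\<rho> * N = n" using N(1) by (simp add: \<rho>_def N_def)
    have "\<rho> * (((n + 1) * (Y * y) / y) * F1 + ((N * (F - F1) + y\<^sup>2 / 2 * F1) / (y\<^sup>2 * w) * (2 * y)) * (Y * y)) * w
        = Y * (\<rho> * (n + 1) * F1 * w + 2 * (\<rho> * N) * (F - F1) + \<rho> * y\<^sup>2 * F1)"
      using w y by (simp add: field_simps power2_eq_square)
    also have "\<dots> = Y * (2 * n * F - 2 * n * \<rho> * (z * y) * F1)"
    proof -
      have "\<rho> * (n + 1) * F1 * w + 2 * (\<rho> * N) * (F - F1) + \<rho> * y\<^sup>2 * F1 = 2 * (\<rho> * N) * F + \<rho> * F1 * ((n + 1) * w - 2 * N + (1 - w))"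
        by (simp add: w_def algebra_simps)
      also have "(n + 1) * w - 2 * N + (1 - w) = - n * (2 - w)" by (simp add: N_def algebra_simps)
      finally have X: "\<rho> * (n + 1) * F1 * w + 2 * (\<rho> * N) * (F - F1) + \<rho> * y\<^sup>2 * F1 = 2 * (\<rho> * N) * F + \<rho> * F1 * (- n * (2 - w))" .
      show ?thesis unfolding X unfolding r z by (simp add: field_simps)
    qed
    finally have "\<rho> * (((n + 1) * (Y * y) / y) * F1 + ((N * (F - F1) + y\<^sup>2 / 2 * F1) / (y\<^sup>2 * w) * (2 * y)) * (Y * y))
       = Y * (2 * n * F - 2 * n * \<rho> * (z * y) * F1) / w"
      using w by (simp add: eq_divide_eq)
    also have "\<dots> = n * (Y * F - z * (\<rho> * (Y * y * F1))) / (w / 2)" by (simp add: algebra_simps)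
    finally show ?thesis unfolding e N(3) w_def .
  qed
  ultimately show "((\<lambda>y. \<rho> * rQ (n + 1) y) has_real_derivative n * (rQ n y - z * (\<rho> * rQ (n + 1) y)) / (s * y)) (at y)"
    unfolding rQ_def p1 fold by simp
qed

text \<open>The function of index n + 1 is the second member of the pair for n and the first member
  of the pair for n + 1. Equating the two expressions for its derivative eliminates
  differentiation.\<close>

lemma rQ_three_term:
  assumes n: "n > 0" and y: "0 < y" "y < 1"
  defines "z \<equiv> (1 + y\<^sup>2) / (2 * y)" and "\<rho> \<equiv> n / (n + 1 / 2)" and "\<rho>' \<equiv> (n + 1) / (n + 3 / 2)"
  shows "(n + 1) * (\<rho> * \<rho>' * rQ (n + 2) y) = (2 * n + 1) * z * (\<rho> * rQ (n + 1) y) - n * rQ n y"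
proof -
  define s where "s = (1 - y\<^sup>2) / (2 * y)"
  have s: "s * y \<noteq> 0" using y by (auto simp: s_def power2_eq_1_iff)
  have "((\<lambda>y. \<rho> * rQ (n + 1) y) has_real_derivative \<rho> * ((n + 1) * (z * rQ (n + 1) y - \<rho>' * rQ (n + 1 + 1) y) / (s * y))) (at y)"
  proof (rule DERIV_cmult)
    have e: "n + 3 / 2 = n + 1 + 1 / 2" by simp
    show "(rQ (n + 1) has_real_derivative (n + 1) * (z * rQ (n + 1) y - \<rho>' * rQ (n + 1 + 1) y) / (s * y)) (at y)"
      using rQ_deriv(1)[of "n + 1" y] n y by (simp add: z_def s_def \<rho>'_def e)
  qed
  moreover have "((\<lambda>y. \<rho> * rQ (n + 1) y) has_real_derivative n * (rQ n y - z * (\<rho> * rQ (n + 1) y)) / (s * y)) (at y)"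
    unfolding \<rho>_def z_def s_def by (rule rQ_deriv(2)[OF n y])
  ultimately have "\<rho> * ((n + 1) * (z * rQ (n + 1) y - \<rho>' * rQ (n + 1 + 1) y) / (s * y)) = n * (rQ n y - z * (\<rho> * rQ (n + 1) y)) / (s * y)"
    by (rule DERIV_unique)
  hence "\<rho> * ((n + 1) * (z * rQ (n + 1) y - \<rho>' * rQ (n + 1 + 1) y)) = n * (rQ n y - z * (\<rho> * rQ (n + 1) y))"
    using s by (simp add: divide_simps)
  thus ?thesis by (simp add: algebra_simps)
qed

definition rJ_fun :: "real \<Rightarrow> real \<Rightarrow> real" where
  "rJ_fun \<nu> x = x powr (2 * \<nu> + 2) * rF (\<nu> + 1) (x\<^sup>2) ^ 3 * (1 - x\<^sup>2) powr \<nu>"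

definition rJ :: "real \<Rightarrow> real" where
  "rJ \<nu> = integral {0..1} (rJ_fun \<nu>)"

lemma zb_triple_of_real:
  assumes \<nu>: "\<nu> > 0" and b: "b1 > 0" "b2 > 0" "b3 > 0" and x: "0 \<le> x" "x \<le> 1"
  shows "zb_triple \<nu> b1 b2 b3 (of_real x) = of_real (rF b1 x * rF b2 x * rF b3 x * (1 - x) powr \<nu>)"
proof (cases "x = 1")
  case False
  hence "\<bar>x\<bar> < 1" using x by auto
  moreover have "(1 - complex_of_real x) powr of_real \<nu> = of_real ((1 - x) powr \<nu>)"
    using powr_of_real[of "1 - x" \<nu>] x by simp
  ultimately show ?thesis using b by (simp add: zb_triple_def zb_F_of_real(2))
qed (use \<nu> in \<open>auto simp: zb_triple_def\<close>)

lemma continuous_on_rF_triple: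
  assumes \<nu>: "\<nu> > 0" and b: "b1 > 0" "b2 > 0" "b3 > 0"
  shows "continuous_on {0..1} (\<lambda>y. rF b1 (y\<^sup>2) * rF b2 (y\<^sup>2) * rF b3 (y\<^sup>2) * (1 - y\<^sup>2) powr \<nu>)"
proof -
  have "continuous_on {0..1} (\<lambda>y. Re (zb_triple \<nu> b1 b2 b3 (of_real (y\<^sup>2))))"
    by (intro continuous_intros continuous_on_compose2[OF continuous_on_zb_triple[OF \<nu>]] half_plus_pos b)
       (auto simp: norm_power power_le_one)
  thus ?thesis
    by (rule continuous_on_eq)
       (subst zb_triple_of_real, use \<nu> b in \<open>auto simp: power_le_one simp del: of_real_mult of_real_power\<close>)
qed

lemma rJ_fun_has_integral:
  assumes \<nu>: "\<nu> > 0"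
  shows "(rJ_fun \<nu> has_integral rJ \<nu>) {0..1}"
proof -
  have "continuous_on {0..1} (\<lambda>x. x powr (2 * \<nu> + 2) * (rF (\<nu> + 1) (x\<^sup>2) * rF (\<nu> + 1) (x\<^sup>2) * rF (\<nu> + 1) (x\<^sup>2) * (1 - x\<^sup>2) powr \<nu>))"
    by (rule continuous_on_mult[OF _ continuous_on_rF_triple])
       (use \<nu> in \<open>auto intro!: continuous_on_powr' continuous_on_id continuous_on_const\<close>)
  hence "continuous_on {0..1} (rJ_fun \<nu>)"
    unfolding rJ_fun_def[abs_def] by (simp add: power3_eq_cube mult_ac)
  thus ?thesis unfolding rJ_def by (intro integrable_integral integrable_continuous_real)
qed

lemma zb_triple_integral_eq_rJ:
  assumes \<nu>: "\<nu> > 0"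
  shows "integral {0..1} (\<lambda>x. of_real (x powr (2 * \<nu> + 2)) * zb_triple \<nu> (\<nu> + 1) (\<nu> + 1) (\<nu> + 1) (of_real (x\<^sup>2))) = of_real (rJ \<nu>)"
proof -
  have "integral {0..1} (\<lambda>x. of_real (x powr (2 * \<nu> + 2)) * zb_triple \<nu> (\<nu> + 1) (\<nu> + 1) (\<nu> + 1) (of_real (x\<^sup>2))) =
        integral {0..1} (\<lambda>x. complex_of_real (rJ_fun \<nu> x))"
    by (intro integral_cong, subst zb_triple_of_real)
       (use \<nu> in \<open>auto simp: rJ_fun_def power3_eq_cube power_le_one\<close>)
  also have "((\<lambda>x. complex_of_real (rJ_fun \<nu> x)) has_integral of_real (rJ \<nu>)) {0..1}"
    by (rule has_integral_of_real[OF rJ_fun_has_integral[OF \<nu>]])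
  hence "integral {0..1} (\<lambda>x. complex_of_real (rJ_fun \<nu> x)) = of_real (rJ \<nu>)"
    by (rule integral_unique)
  finally show ?thesis .
qed

text \<open>
  The constants c1, ..., c8 are the coefficients of a certificate found by solving the linear system
  for a cubic form in q and U with coefficients polynomial in z whose derivative along the ladder
  system is the right-hand side.
\<close>

lemma telescoping_identity:
  fixes n z q U s :: real
  assumes s: "s\<^sup>2 = z\<^sup>2 - 1"
  defines "c1 \<equiv> - (48 * n ^ 2 + 63 * n ^ 3)" and "c2 \<equiv> - (16 + 64 * n + 88 * n ^ 2 + 42 * n ^ 3)"
    and "c3 \<equiv> - 16 * n ^ 3" and "c4 \<equiv> 48 * n + 192 * n ^ 2 + 168 * n ^ 3" and "c5 \<equiv> 48 * n ^ 2 + 96 * n ^ 3"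
    and "c6 \<equiv> - (32 * n + 104 * n ^ 2 + 80 * n ^ 3)" and "c7 \<equiv> - (48 * n + 192 * n ^ 2 + 192 * n ^ 3)"
    and "c8 \<equiv> 16 + 96 * n + 192 * n ^ 2 + 128 * n ^ 3"
  shows "- n * z * (c1*q^2*U + c2*U^3 + c3*z*q^3 + c4*z*q*U^2 + c5*z^2*q^2*U + c6*z^2*U^3 + c7*z^3*q*U^2 + c8*z^4*U^3)
     - s\<^sup>2 * (c3*q^3 + c4*q*U^2 + 2*c5*z*q^2*U + 2*c6*z*U^3 + 3*c7*z^2*q*U^2 + 4*c8*z^3*U^3)
     + n * (z * q - U) * (2*c1*q*U + 3*c3*z*q^2 + c4*z*U^2 + 2*c5*z^2*q*U + c7*z^3*U^2)
     + n * (q - z * U) * (c1*q^2 + 3*c2*U^2 + 2*c4*z*q*U + c5*z^2*q^2 + 3*c6*z^2*U^2 + 2*c7*z^3*q*U + 3*c8*z^4*U^2)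
     = 64 * (n + 1) * (- s\<^sup>2) * ((2 * n + 1) * z * U - n * q) ^ 3 + n ^ 4 * q ^ 3"
proof -
  \<comment> \<open>The left side is s y s^(-n) times the y-derivative of s^n T, where T is the
    cubic form in the first bracket; its four summands are the contributions of s^n, z, q and U. The
    proof compares coefficients of the monomials in z, q and U.\<close>
  define k m where "k = 64 * (n + 1)" and "m = 2 * n + 1"
  have "- n * z * (c1*q^2*U + c2*U^3 + c3*z*q^3 + c4*z*q*U^2 + c5*z^2*q^2*U + c6*z^2*U^3 + c7*z^3*q*U^2 + c8*z^4*U^3)
     - s\<^sup>2 * (c3*q^3 + c4*q*U^2 + 2*c5*z*q^2*U + 2*c6*z*U^3 + 3*c7*z^2*q*U^2 + 4*c8*z^3*U^3)
     + n * (z * q - U) * (2*c1*q*U + 3*c3*z*q^2 + c4*z*U^2 + 2*c5*z^2*q*U + c7*z^3*U^2)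
     + n * (q - z * U) * (c1*q^2 + 3*c2*U^2 + 2*c4*z*q*U + c5*z^2*q^2 + 3*c6*z^2*U^2 + 2*c7*z^3*q*U + 3*c8*z^4*U^2)
     = (n*c1 + c3) * q^3 + ((2*n-1)*c3 + n*c5) * (z^2*q^3) + (2*n*c4 - 3*n*c3 + 2*c5) * (z*q^2*U) + (2*n*c7 - 2*c5) * (z^3*q^2*U)
      + (c4 - 2*n*c1 + 3*n*c2) * (q*U^2) + (3*c7 - (2*n+1)*c4 - 2*n*c5 + 3*n*c6) * (z^2*q*U^2) + (3*n*c8 - (2*n+3)*c7) * (z^4*q*U^2)
      + (2*c6 - 4*n*c2 - n*c4) * (z*U^3) + (4*c8 - (4*n+2)*c6 - n*c7) * (z^3*U^3) - (4*n+4)*c8 * (z^5*U^3)"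
    unfolding s by (simp add: algebra_simps eval_nat_numeral)
  also have "n*c1 + c3 = n^4 - k*n^3" by (simp add: c1_def c3_def k_def algebra_simps eval_nat_numeral)
  also have "(2*n-1)*c3 + n*c5 = k*n^3" by (simp add: c5_def c3_def k_def algebra_simps eval_nat_numeral)
  also have "2*n*c4 - 3*n*c3 + 2*c5 = 3*k*m*n^2" by (simp add: c4_def c5_def c3_def k_def m_def algebra_simps eval_nat_numeral)
  also have "2*n*c7 - 2*c5 = -3*k*m*n^2" by (simp add: c7_def c5_def k_def m_def algebra_simps eval_nat_numeral)
  also have "c4 - 2*n*c1 + 3*n*c2 = 0" by (simp add: c4_def c1_def c2_def algebra_simps eval_nat_numeral)
  also have "3*c7 - (2*n+1)*c4 - 2*n*c5 + 3*n*c6 = -3*k*m^2*n" by (simp add: c4_def c5_def c6_def c7_def k_def m_def algebra_simps eval_nat_numeral)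
  also have "3*n*c8 - (2*n+3)*c7 = 3*k*m^2*n" by (simp add: c7_def c8_def k_def m_def algebra_simps eval_nat_numeral)
  also have "2*c6 - 4*n*c2 - n*c4 = 0" by (simp add: c4_def c6_def c2_def algebra_simps eval_nat_numeral)
  also have "4*c8 - (4*n+2)*c6 - n*c7 = k*m^3" by (simp add: c6_def c7_def c8_def k_def m_def algebra_simps eval_nat_numeral)
  also have "(4*n+4)*c8 = k*m^3" by (simp add: c8_def k_def m_def algebra_simps eval_nat_numeral)
  also have "(n^4 - k*n^3) * q^3 + k*n^3 * (z^2*q^3) + 3*k*m*n^2 * (z*q^2*U) + -3*k*m*n^2 * (z^3*q^2*U)
      + 0 * (q*U^2) + -3*k*m^2*n * (z^2*q*U^2) + 3*k*m^2*n * (z^4*q*U^2) + 0 * (z*U^3) + k*m^3 * (z^3*U^3) - k*m^3 * (z^5*U^3)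
     = k * (- s\<^sup>2) * (m * z * U - n * q) ^ 3 + n ^ 4 * q ^ 3"
    unfolding s by (simp add: algebra_simps eval_nat_numeral)
  finally show ?thesis unfolding k_def m_def .
qed

lemma rJ_fun_rQ:
  assumes y: "0 < y" "y < 1"
  defines "s \<equiv> (1 - y\<^sup>2) / (2 * y)"
  shows "s powr \<nu> * rQ (\<nu> + 1) y ^ 3 / y = 2 powr - \<nu> * rJ_fun \<nu> y"
proof -
  have y2: "y\<^sup>2 < 1" using y by (simp add: power_less_one_iff abs_square_less_1)
  have s: "s powr \<nu> = (1 - y\<^sup>2) powr \<nu> * 2 powr - \<nu> * y powr - \<nu>"
    unfolding s_def using y y2 by (simp add: powr_divide powr_mult powr_minus field_simps)
  have "y powr (2 * \<nu> + 2) * y = y powr - \<nu> * (y powr (\<nu> + 1)) ^ 3"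
  proof -
    have "y powr (2 * \<nu> + 2) * y = y powr (2 * \<nu> + 2) * y powr 1" using y by simp
    also have "\<dots> = y powr (2 * \<nu> + 2 + 1)" by (rule powr_add[symmetric])
    also have "2 * \<nu> + 2 + 1 = - \<nu> + 3 * (\<nu> + 1)" by simp
    also have "y powr (- \<nu> + 3 * (\<nu> + 1)) = y powr - \<nu> * y powr (3 * (\<nu> + 1))" by (rule powr_add)
    also have "y powr (3 * (\<nu> + 1)) = (y powr (\<nu> + 1)) ^ 3" using y by (simp add: powr_power mult.commute)
    finally show ?thesis .
  qed
  hence "y powr (2 * \<nu> + 2) = y powr - \<nu> * (y powr (\<nu> + 1)) ^ 3 / y" using y by (simp add: field_simps)
  thus ?thesis unfolding s rQ_def rJ_fun_def power_mult_distrib by (simp add: mult_ac)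
qed

text \<open>\<open>telescoping_identity\<close> makes a combination of the integrands for \<nu> and
  \<nu> + 2 a total derivative: by \<open>rQ_three_term\<close> the cubed linear form there is a
  multiple of the function of index n + 2. The antiderivative vanishes at both ends.\<close>

lemma rJ_recurrence:
  assumes \<nu>: "\<nu> > 0"
  defines "n \<equiv> \<nu> + 1"
  defines "\<rho> \<equiv> n / (n + 1 / 2)" and "\<rho>' \<equiv> (n + 1) / (n + 3 / 2)"
  shows "n ^ 4 * rJ \<nu> = 16 * (n + 1) ^ 4 * (\<rho> * \<rho>') ^ 3 * rJ (\<nu> + 2)"
proof -
  define c1 c2 c3 c4 c5 c6 c7 c8 where "c1 = - (48 * n ^ 2 + 63 * n ^ 3)" and "c2 = - (16 + 64 * n + 88 * n ^ 2 + 42 * n ^ 3)"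
    and "c3 = - 16 * n ^ 3" and "c4 = 48 * n + 192 * n ^ 2 + 168 * n ^ 3" and "c5 = 48 * n ^ 2 + 96 * n ^ 3"
    and "c6 = - (32 * n + 104 * n ^ 2 + 80 * n ^ 3)" and "c7 = - (48 * n + 192 * n ^ 2 + 192 * n ^ 3)"
    and "c8 = 16 + 96 * n + 192 * n ^ 2 + 128 * n ^ 3"
  have n: "n > 1" "n > 0" using \<nu> by (auto simp: n_def)
  define t where "t b1 b2 b3 y = rF b1 (y\<^sup>2) * rF b2 (y\<^sup>2) * rF b3 (y\<^sup>2) * (1 - y\<^sup>2) powr n" for b1 b2 b3 y
  define h where "h y = (1 + y\<^sup>2) / 2" for y :: real
  \<comment> \<open>This is s^n T with the powers of y collected, so that it makes sense at y = 0.
    The factor s^n costs y^(-n), the cubic terms bring y^(3n), each z = h/y costs one power and each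
    U gains one; the least exponent 2n - 1 is positive and is put in front.\<close>
  define \<Phi> where "\<Phi> y = 2 powr - n * y powr (2 * n - 1) *
     (c3 * h y * t n n n y + (c1 * y^2 + c5 * h y^2) * \<rho> * t n n (n + 1) y
      + (c4 * h y * y^2 + c7 * h y^3) * \<rho>^2 * t n (n + 1) (n + 1) y
      + (c2 * y^4 + c6 * h y^2 * y^2 + c8 * h y^4) * \<rho>^3 * t (n + 1) (n + 1) (n + 1) y)" for y
  define D where "D y = n ^ 4 * (2 powr - \<nu> * rJ_fun \<nu> y) -
     64 * (n + 1) * ((n + 1) * \<rho> * \<rho>') ^ 3 * (2 powr - (\<nu> + 2) * rJ_fun (\<nu> + 2) y)" for y
  have "(D has_integral (\<Phi> 1 - \<Phi> 0)) {0..1}"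
  proof (rule fundamental_theorem_of_calculus_interior)
    have pw: "continuous_on {0..1} (\<lambda>y. y powr (2 * n - 1))"
      using n by (auto intro!: continuous_on_powr' continuous_on_id continuous_on_const)
    have ct: "continuous_on {0..1} (t b1 b2 b3)" if "b1 > 0" "b2 > 0" "b3 > 0" for b1 b2 b3
      unfolding t_def[abs_def] using that n by (intro continuous_on_rF_triple) auto
    show "continuous_on {0..1} \<Phi>"
      unfolding \<Phi>_def[abs_def] h_def using n
      by (intro continuous_on_add continuous_on_mult pw ct continuous_on_const continuous_on_power continuous_on_id continuous_on_divide) auto
    fix y :: real assume "y \<in> {0<..<1}"
    hence y: "0 < y" "y < 1" by auto
    define s z where "s = (\<lambda>y :: real. (1 - y\<^sup>2) / (2 * y))" and "z = (\<lambda>y :: real. (1 + y\<^sup>2) / (2 * y))"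
    define q U where "q = rQ n" and "U = (\<lambda>y. \<rho> * rQ (n + 1) y)"
    define T where "T y = c1*q y^2*U y + c2*U y^3 + c3*z y*q y^3 + c4*z y*q y*U y^2 + c5*z y^2*q y^2*U y + c6*z y^2*U y^3 + c7*z y^3*q y*U y^2 + c8*z y^4*U y^3" for y
    have sp: "s y > 0" if "0 < y" "y < 1" for y
      using that by (auto simp: s_def power_less_one_iff abs_square_less_1)
    have s2: "s y ^ 2 = z y ^ 2 - 1" using y by (simp add: s_def z_def field_simps) (simp add: power2_eq_square algebra_simps)
    have dz: "(z has_real_derivative (- s y / y)) (at y)"
      unfolding z_def s_def using y by (auto intro!: derivative_eq_intros simp: field_simps power2_eq_square)
    have ds: "(s has_real_derivative (- z y / y)) (at y)"
      unfolding z_def s_def using y by (auto intro!: derivative_eq_intros simp: field_simps power2_eq_square)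
    have dq: "(q has_real_derivative n * (z y * q y - U y) / (s y * y)) (at y)"
      and dU: "(U has_real_derivative n * (q y - z y * U y) / (s y * y)) (at y)"
      using rQ_deriv[OF n(2) y] unfolding q_def U_def z_def s_def \<rho>_def by auto
    define Tz Tq TU where "Tz = c3*q y^3 + c4*q y*U y^2 + 2*c5*z y*q y^2*U y + 2*c6*z y*U y^3 + 3*c7*z y^2*q y*U y^2 + 4*c8*z y^3*U y^3"
      and "Tq = 2*c1*q y*U y + 3*c3*z y*q y^2 + c4*z y*U y^2 + 2*c5*z y^2*q y*U y + c7*z y^3*U y^2"
      and "TU = c1*q y^2 + 3*c2*U y^2 + 2*c4*z y*q y*U y + c5*z y^2*q y^2 + 3*c6*z y^2*U y^2 + 2*c7*z y^3*q y*U y + 3*c8*z y^4*U y^2"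
    have dT: "(T has_real_derivative (Tz * z' + Tq * q' + TU * U')) (at y)"
      if "(z has_real_derivative z') (at y)" "(q has_real_derivative q') (at y)" "(U has_real_derivative U') (at y)" for z' q' U'
      unfolding T_def[abs_def] Tz_def Tq_def TU_def
      by (rule derivative_eq_intros that refl)+ (simp add: algebra_simps eval_nat_numeral)
    have dsn: "((\<lambda>y. s y powr n) has_real_derivative (n * (s y powr n / s y) * (- z y / y))) (at y)"
      using sp[OF y] by (auto intro!: derivative_eq_intros ds simp: powr_diff)
    have "((\<lambda>y. s y powr n * T y) has_real_derivative
        (n * (s y powr n / s y) * (- z y / y)) * T y + (Tz * (- s y / y) + Tq * (n * (z y * q y - U y) / (s y * y)) + TU * (n * (q y - z y * U y) / (s y * y))) * s y powr n) (at y)"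
      by (rule DERIV_mult[OF dsn dT[OF dz dq dU]])
    also have "(n * (s y powr n / s y) * (- z y / y)) * T y + (Tz * (- s y / y) + Tq * (n * (z y * q y - U y) / (s y * y)) + TU * (n * (q y - z y * U y) / (s y * y))) * s y powr n
        = s y powr n / (s y * y) * (- n * z y * T y - s y ^ 2 * Tz + n * (z y * q y - U y) * Tq + n * (q y - z y * U y) * TU)"
      using sp[OF y] y by (simp add: divide_simps) (simp add: power2_eq_square algebra_simps)
    also have "- n * z y * T y - s y ^ 2 * Tz + n * (z y * q y - U y) * Tq + n * (q y - z y * U y) * TU =
        64 * (n + 1) * (- (s y)\<^sup>2) * ((2 * n + 1) * z y * U y - n * q y) ^ 3 + n ^ 4 * q y ^ 3"
      unfolding T_def Tz_def Tq_def TU_def c1_def c2_def c3_def c4_def c5_def c6_def c7_def c8_def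
      by (rule telescoping_identity[OF s2])
    also have "(2 * n + 1) * z y * U y - n * q y = (n + 1) * \<rho> * \<rho>' * rQ (n + 2) y"
      using rQ_three_term[OF n(2) y] unfolding z_def U_def q_def \<rho>_def \<rho>'_def by (simp add: mult_ac)
    also have "s y powr n / (s y * y) * (64 * (n + 1) * (- (s y)\<^sup>2) * ((n + 1) * \<rho> * \<rho>' * rQ (n + 2) y) ^ 3 + n ^ 4 * q y ^ 3) = D y"
    proof -
      \<comment> \<open>Division by s turns s^n into the weight s^\<nu> of J(\<nu>), and the extra
        factor s^2 of the other term raises it to the weight of J(\<nu> + 2).\<close>
      have e1: "s y powr n / s y = s y powr \<nu>" "s y powr \<nu> * s y ^ 2 = s y powr (\<nu> + 2)"
        using sp[OF y] by (simp_all add: n_def powr_add powr_numeral)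
      have J1: "s y powr \<nu> * q y ^ 3 / y = 2 powr - \<nu> * rJ_fun \<nu> y"
        using rJ_fun_rQ[OF y, of \<nu>] by (simp only: s_def q_def n_def)
      have "\<nu> + 2 + 1 = n + 2" by (simp add: n_def)
      hence J2: "s y powr (\<nu> + 2) * rQ (n + 2) y ^ 3 / y = 2 powr - (\<nu> + 2) * rJ_fun (\<nu> + 2) y"
        using rJ_fun_rQ[OF y, of "\<nu> + 2"] by (simp only: s_def)
      have gen: "S / (s y * y) * (a * (- (s y)\<^sup>2) * (m * R) ^ 3 + b * Q) = b * ((S / s y) * Q / y) - a * m ^ 3 * (((S / s y) * s y ^ 2) * R ^ 3 / y)"
        for S a b m R Q using sp[OF y] y by (simp add: field_simps power_mult_distrib)
      have "s y powr n / (s y * y) * (64 * (n + 1) * (- (s y)\<^sup>2) * ((n + 1) * \<rho> * \<rho>' * rQ (n + 2) y) ^ 3 + n ^ 4 * q y ^ 3) =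
        n ^ 4 * ((s y powr n / s y) * q y ^ 3 / y) - 64 * (n + 1) * ((n + 1) * \<rho> * \<rho>') ^ 3 * (((s y powr n / s y) * s y ^ 2) * rQ (n + 2) y ^ 3 / y)"
        by (rule gen)
      also have "\<dots> = D y"
        unfolding e1 J1 J2 D_def ..
      finally show ?thesis .
    qed
    finally have "((\<lambda>y. s y powr n * T y) has_real_derivative D y) (at y)" .
    hence "(\<Phi> has_real_derivative D y) (at y)"
    proof (rule has_field_derivative_transform_within_open[where S = "{0<..<1}"])
      fix x :: real assume "x \<in> {0<..<1}"
      hence x: "0 < x" "x < 1" by auto
      have x2: "x\<^sup>2 < 1" using x by (simp add: power_less_one_iff abs_square_less_1)
      define Y A F G where "Y = x powr n" and "A = (1 - x\<^sup>2) powr n" and "F = rF n (x\<^sup>2)" and "G = rF (n + 1) (x\<^sup>2)"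
      have Y: "Y > 0" using x by (simp add: Y_def)
      have s: "s x powr n = A * 2 powr - n / Y"
        unfolding s_def A_def Y_def using x x2 by (simp add: powr_divide powr_mult powr_minus field_simps)
      have Y2: "x powr (2 * n - 1) = Y * Y / x"
        using x by (simp add: powr_diff Y_def powr_add[symmetric])
      have q: "q x = Y * F" "U x = \<rho> * (Y * x * G)"
        using x by (simp_all add: q_def U_def rQ_def Y_def F_def G_def powr_add)
      have z: "z x = h x / x" by (simp add: z_def h_def)
      have tt: "t n n n x = F*F*F*A" "t n n (n + 1) x = F*F*G*A" "t n (n + 1) (n + 1) x = F*G*G*A" "t (n + 1) (n + 1) (n + 1) x = G*G*G*A"
        by (simp_all add: t_def F_def G_def A_def)
      show "s x powr n * T x = \<Phi> x"
        unfolding T_def \<Phi>_def s Y2 q z tt using x Y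
        by (simp add: divide_simps) (simp add: algebra_simps eval_nat_numeral)
    qed (use y in auto)
    thus "(\<Phi> has_vector_derivative D y) (at y)"
      by (simp add: has_real_derivative_iff_has_vector_derivative)
  qed auto
  moreover have "\<Phi> 1 = 0" "\<Phi> 0 = 0" using n by (auto simp: \<Phi>_def t_def)
  ultimately have "(D has_integral 0) {0..1}" by simp
  moreover have "(D has_integral (n ^ 4 * (2 powr - \<nu> * rJ \<nu>) -
     64 * (n + 1) * ((n + 1) * \<rho> * \<rho>') ^ 3 * (2 powr - (\<nu> + 2) * rJ (\<nu> + 2)))) {0..1}"
    unfolding D_def[abs_def] using \<nu>
    by (intro has_integral_diff has_integral_mult_right rJ_fun_has_integral) auto
  ultimately have "n ^ 4 * (2 powr - \<nu> * rJ \<nu>) - 64 * (n + 1) * ((n + 1) * \<rho> * \<rho>') ^ 3 * (2 powr - (\<nu> + 2) * rJ (\<nu> + 2)) = 0"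
    by (metis has_integral_unique)
  moreover have "2 powr - (\<nu> + 2) = 2 powr - \<nu> / (4 :: real)"
    using powr_diff[of 2 "-\<nu>" 2] by simp
  moreover have "P * (N * J) = P * (16 * m ^ 4 * (r * r') ^ 3 * J')" if "N * (P * J) - 64 * m * (m * r * r') ^ 3 * (P / 4 * J') = 0"
    for P N J J' m r r' :: real using that by (simp add: power_mult_distrib eval_nat_numeral mult_ac)
  ultimately have "2 powr - \<nu> * (n ^ 4 * rJ \<nu>) = 2 powr - \<nu> * (16 * (n + 1) ^ 4 * (\<rho> * \<rho>') ^ 3 * rJ (\<nu> + 2))"
    by metis
  thus ?thesis by simp
qed

section \<open>Gamma quotients and the growth of the real integral\<close>

definition gamma_ratio :: "real \<Rightarrow> real" where
  "gamma_ratio x = Gamma (x + 1 / 2) / Gamma x"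

text \<open>The upper bound is log-convexity of Gamma at a midpoint. The lower one follows from it,
  since the quotients at x - 1/2 and at x have product x - 1/2.\<close>

lemma gamma_ratio_bounds:
  assumes x: "x > 1 / 2"
  shows "sqrt (x - 1 / 2) \<le> gamma_ratio x" "gamma_ratio x \<le> sqrt x" "gamma_ratio x > 0"
proof -
  have pos: "Gamma y > 0" if "y > 0" for y :: real using that by (rule Gamma_real_pos)
  have mono: "Gamma (y + 1 / 2) ^ 2 \<le> Gamma y * Gamma (y + 1)" if y: "y > 0" for y :: real
  proof -
    have "(ln \<circ> Gamma) ((1 - 1 / 2) *\<^sub>R y + (1 / 2) *\<^sub>R (y + 1)) \<le> (1 - 1 / 2) * (ln \<circ> Gamma) y + (1 / 2) * (ln \<circ> Gamma) (y + 1)"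
      by (rule convex_onD[OF log_convex_Gamma_real]) (use y in auto)
    moreover have "(1 - 1 / 2) *\<^sub>R y + (1 / 2) *\<^sub>R (y + 1) = y + 1 / 2" by (simp add: field_simps)
    ultimately have "2 * ln (Gamma (y + 1 / 2)) \<le> ln (Gamma y) + ln (Gamma (y + 1))" by simp
    moreover have G: "Gamma y > 0" "Gamma (y + 1) > 0" "Gamma (y + 1 / 2) > 0" using y by (auto intro: pos)
    ultimately have "ln (Gamma (y + 1 / 2) ^ 2) \<le> ln (Gamma y * Gamma (y + 1))"
      using ln_mult[of "Gamma y" "Gamma (y + 1)"] ln_realpow[of "Gamma (y + 1 / 2)" 2] by simp
    thus ?thesis using G by (subst (asm) ln_le_cancel_iff) auto
  qed
  show g0: "gamma_ratio x > 0" using x pos by (simp add: gamma_ratio_def)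
  have up: "gamma_ratio y ^ 2 \<le> y" if y: "y > 0" for y
  proof -
    have "Gamma (y + 1) = y * Gamma y" using y by (intro Gamma_plus1) auto
    thus ?thesis using mono[OF y] pos[OF y] by (simp add: gamma_ratio_def power_divide divide_simps power2_eq_square mult_ac)
  qed
  show "gamma_ratio x \<le> sqrt x" using up[of x] x by (intro real_le_rsqrt) auto
  have "gamma_ratio (x - 1 / 2) * gamma_ratio x = x - 1 / 2"
  proof -
    have "gamma_ratio w * gamma_ratio (w + 1 / 2) = w" if w: "w > 0" for w
    proof -
      have "Gamma (w + 1 / 2 + 1 / 2) = Gamma (1 + w)" "Gamma (w + 1) = Gamma (1 + w)" by (simp_all add: add.commute)
      moreover have "Gamma (w + 1) = w * Gamma w" using w by (intro Gamma_plus1) auto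
      moreover have "Gamma w > 0" "Gamma (w + 1 / 2) > 0" using w by (auto intro: pos)
      ultimately show ?thesis unfolding gamma_ratio_def by (simp add: divide_simps)
    qed
    from this[of "x - 1 / 2"] x show ?thesis by simp
  qed
  moreover have "gamma_ratio (x - 1 / 2) \<le> sqrt (x - 1 / 2)" using up[of "x - 1 / 2"] x by (intro real_le_rsqrt) auto
  ultimately have "x - 1 / 2 \<le> sqrt (x - 1 / 2) * gamma_ratio x"
    using g0 by (metis mult_right_mono less_imp_le)
  hence "sqrt (x - 1 / 2) * sqrt (x - 1 / 2) \<le> sqrt (x - 1 / 2) * gamma_ratio x" using x by simp
  thus "sqrt (x - 1 / 2) \<le> gamma_ratio x" by (rule mult_left_le_imp_le) (use x in auto)
qed

text \<open>The quotient of the Pochhammer symbols of b and b + 1/2 is a product of n factors, each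
  at most 1 and at least the first one, r = b / (b + 1/2). Hence the series lies termwise between
  the binomial series of (1 - r x)^(-1/2) and of (1 - x)^(-1/2).\<close>

lemma rF_bounds:
  assumes b: "b > 0" and x: "0 \<le> x" "x < 1"
  shows "rF b x \<le> (1 - x) powr (-1 / 2)" "(1 - b / (b + 1 / 2) * x) powr (-1 / 2) \<le> rF b x"
proof -
  have binom: "(\<lambda>n. pochhammer (1 / 2) n / fact n * x ^ n) sums (1 - x) powr (-1 / 2)" if "\<bar>x\<bar> < 1" for x :: real
  proof -
    have "(\<lambda>n. ((-1 / 2) gchoose n) * (- x) ^ n) sums (1 + (- x)) powr (-1 / 2)"
      by (rule gen_binomial_real) (use that in auto)
    moreover have "((-1 / 2) gchoose n) * (- x) ^ n = pochhammer (1 / 2) n / fact n * x ^ n" for n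
    proof -
      have "(-1) ^ n * (- x) ^ n = x ^ n" by (simp flip: power_mult_distrib)
      hence K: "(-1) ^ n * P / f * (- x) ^ n = P / f * x ^ n" for P f :: real
        by (metis (no_types, lifting) mult.assoc mult.commute times_divide_eq_left)
      have "- (-1 / 2) = (1 / 2 :: real)" by simp
      thus ?thesis unfolding gbinomial_pochhammer by (simp only: K)
    qed
    ultimately show ?thesis by simp
  qed
  define r where "r = b / (b + 1 / 2)"
  have r: "0 < r" "r < 1" using b by (auto simp: r_def)
  have pp: "pochhammer b n > 0" "pochhammer (1 / 2 + b) n > 0" for n
    using b by (auto intro!: pochhammer_pos)
  have pq: "r ^ n \<le> pochhammer b n / pochhammer (1 / 2 + b) n" "pochhammer b n / pochhammer (1 / 2 + b) n \<le> 1" for n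
  proof (induction n)
    case (Suc n)
    case 1
    have "r \<le> (b + n) / (1 / 2 + b + n)" using b by (simp add: r_def divide_simps) (simp add: algebra_simps)
    hence "r ^ n * r \<le> pochhammer b n / pochhammer (1 / 2 + b) n * ((b + n) / (1 / 2 + b + n))"
      using Suc(1) r pp[of n] b by (intro mult_mono) auto
    thus ?case by (simp add: pochhammer_Suc mult_ac)
  next
    case (Suc n)
    case 2
    have "pochhammer b n / pochhammer (1 / 2 + b) n * ((b + n) / (1 / 2 + b + n)) \<le> 1 * 1"
      using Suc(2) b pp[of n] by (intro mult_mono) auto
    thus ?case by (simp add: pochhammer_Suc)
  qed auto
  have c: "rcoeff b n = (pochhammer (1 / 2) n / fact n) * (pochhammer b n / pochhammer (1 / 2 + b) n)" for n
    by (simp add: rcoeff_def)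
  have p: "pochhammer (1 / 2 :: real) n / fact n \<ge> 0" for n by (simp add: pochhammer_nonneg)
  have F: "(\<lambda>n. rcoeff b n * x ^ n) sums rF b x" by (rule zb_F_of_real(1)[OF b]) (use x in auto)
  show "rF b x \<le> (1 - x) powr (-1 / 2)"
  proof (rule sums_le[OF _ F binom])
    fix n
    have "(pochhammer (1 / 2) n / fact n) * (pochhammer b n / pochhammer (1 / 2 + b) n) \<le> (pochhammer (1 / 2) n / fact n) * 1"
      by (intro mult_left_mono pq p)
    thus "rcoeff b n * x ^ n \<le> pochhammer (1 / 2) n / fact n * x ^ n"
      unfolding c using x by (intro mult_right_mono) auto
  qed (use x in auto)
  have rx: "\<bar>r * x\<bar> < 1"
  proof -
    have "r * x \<le> 1 * x" using r x by (intro mult_right_mono) auto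
    thus ?thesis using r x by (simp add: abs_mult)
  qed
  show "(1 - b / (b + 1 / 2) * x) powr (-1 / 2) \<le> rF b x"
    unfolding r_def[symmetric]
  proof (rule sums_le[OF _ binom[OF rx] F])
    fix n
    have "(pochhammer (1 / 2) n / fact n) * r ^ n \<le> (pochhammer (1 / 2) n / fact n) * (pochhammer b n / pochhammer (1 / 2 + b) n)"
      by (intro mult_left_mono pq p)
    hence "(pochhammer (1 / 2) n / fact n * r ^ n) * x ^ n \<le> rcoeff b n * x ^ n"
      unfolding c using x by (intro mult_right_mono) auto
    thus "pochhammer (1 / 2) n / fact n * (r * x) ^ n \<le> rcoeff b n * x ^ n"
      by (simp add: power_mult_distrib mult_ac)
  qed
qed

lemma has_integral_Beta_square:
  fixes a b :: real
  assumes "a > 1" "b > 1"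
  shows "((\<lambda>x. x powr (2 * a - 1) * (1 - x\<^sup>2) powr (b - 1)) has_integral Beta a b / 2) {0..1}"
proof -
  let ?f = "\<lambda>t. t powr (a - 1) * (1 - t) powr (b - 1)"
  have cont: "continuous_on {0..1} ?f"
    using assms by (intro continuous_on_mult continuous_on_powr' continuous_on_id continuous_on_const continuous_on_diff) auto
  have "((\<lambda>x. (2 * x) *\<^sub>R ?f (x\<^sup>2)) has_integral (integral {0\<^sup>2..1\<^sup>2} ?f)) {0..1}"
    by (rule has_integral_substitution[where c = 0 and d = 1])
       (use cont in \<open>auto intro!: derivative_eq_intros simp: power_le_one\<close>)
  moreover have "integral {0\<^sup>2..1\<^sup>2} ?f = Beta a b"
    using has_integral_Beta_real[of a b] assms by (simp add: integral_unique)
  ultimately have "((\<lambda>x. (2 * x) *\<^sub>R ?f (x\<^sup>2)) has_integral Beta a b) {0..1}" by simp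
  from has_integral_mult_right[OF this, of "1 / 2"]
  have "((\<lambda>x. x * ?f (x\<^sup>2)) has_integral Beta a b / 2) {0..1}" by simp
  thus ?thesis
  proof (rule has_integral_spike[of "{0}", rotated 2])
    fix x :: real assume "x \<in> {0..1} - {0}"
    hence x: "x > 0" by auto
    have "(x\<^sup>2) powr (a - 1) = x powr (2 * (a - 1))"
      using x powr_powr[of x 2 "a - 1"] by (simp add: powr_numeral)
    moreover have "x * x powr (2 * (a - 1)) = x powr (2 * a - 1)"
    proof -
      have "x * x powr (2 * (a - 1)) = x powr 1 * x powr (2 * (a - 1))" using x by simp
      also have "\<dots> = x powr (1 + 2 * (a - 1))" by (rule powr_add[symmetric])
      finally show ?thesis by (simp add: algebra_simps)
    qed
    ultimately show "x powr (2 * a - 1) * (1 - x\<^sup>2) powr (b - 1) = x * ?f (x\<^sup>2)"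
      by (simp add: mult.assoc[symmetric])
  qed auto
qed

text \<open>The value for \<open>rJ\<close> that the formula of the theorem predicts through
  \<open>legendre_triple_theta\<close>. The cubed quotient is the constant \<open>zb_kappa\<close>
  with parameters 1/2 and \<nu> + 1.\<close>

definition rJ_value :: "real \<Rightarrow> real" where
  "rJ_value \<nu> = pi\<^sup>2 / 8 * 2 powr (- 2 * \<nu>) * (gamma_ratio (\<nu> + 1) / sqrt pi) ^ 3 / gamma_ratio ((\<nu> + 1) / 2) ^ 4"

lemma gamma_ratio_pos: "x > 0 \<Longrightarrow> gamma_ratio x > 0"
  by (auto simp: gamma_ratio_def intro!: divide_pos_pos Gamma_real_pos)

lemma gamma_ratio_plus1:
  assumes "x > 0"
  shows "gamma_ratio (x + 1) = gamma_ratio x * (x + 1 / 2) / x"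
proof -
  have "Gamma (x + 1) = x * Gamma x" using assms by (intro Gamma_plus1) auto
  moreover have "Gamma (x + 1 / 2 + 1) = (x + 1 / 2) * Gamma (x + 1 / 2)" using assms by (intro Gamma_plus1) auto
  moreover have "x + 1 + 1 / 2 = x + 1 / 2 + 1" by simp
  ultimately show ?thesis unfolding gamma_ratio_def by (metis mult.commute times_divide_times_eq times_divide_eq_right)
qed

lemma rJ_value_pos: "\<nu> > 0 \<Longrightarrow> rJ_value \<nu> > 0"
  unfolding rJ_value_def by (intro divide_pos_pos mult_pos_pos zero_less_power gamma_ratio_pos) auto

lemma rJ_value_recurrence:
  assumes \<nu>: "\<nu> > 0"
  defines "n \<equiv> \<nu> + 1"
  defines "\<rho> \<equiv> n / (n + 1 / 2)" and "\<rho>' \<equiv> (n + 1) / (n + 3 / 2)"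
  shows "n ^ 4 * rJ_value \<nu> = 16 * (n + 1) ^ 4 * (\<rho> * \<rho>') ^ 3 * rJ_value (\<nu> + 2)"
proof -
  have n: "n > 0" using \<nu> by (simp add: n_def)
  define g g' where "g = gamma_ratio n" and "g' = gamma_ratio (n / 2)"
  have g: "g > 0" "g' > 0" using n by (auto simp: g_def g'_def intro: gamma_ratio_pos)
  have e: "n + 3 / 2 = n + 1 + 1 / 2" by simp
  have "gamma_ratio (n + 1 + 1) = gamma_ratio (n + 1) * (n + 1 + 1 / 2) / (n + 1)"
    by (rule gamma_ratio_plus1) (use n in auto)
  also have "gamma_ratio (n + 1) = g * (n + 1 / 2) / n"
    unfolding g_def by (rule gamma_ratio_plus1[OF n])
  finally have "gamma_ratio (n + 1 + 1) = g / (\<rho> * \<rho>')" unfolding \<rho>_def \<rho>'_def e by simp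
  moreover have "\<nu> + 2 + 1 = n + 1 + 1" by (simp add: n_def)
  ultimately have 1: "gamma_ratio (\<nu> + 2 + 1) = g / (\<rho> * \<rho>')" by (simp only:)
  have "gamma_ratio (n / 2 + 1) = g' * (n + 1) / n"
    using gamma_ratio_plus1[of "n / 2"] n by (simp add: g'_def field_simps)
  moreover have "(\<nu> + 2 + 1) / 2 = n / 2 + 1" by (simp add: n_def)
  ultimately have 2: "gamma_ratio ((\<nu> + 2 + 1) / 2) = g' * (n + 1) / n" by (simp only:)
  have 3: "2 powr (- 2 * (\<nu> + 2)) = 2 powr (- 2 * \<nu>) / (16 :: real)"
    using powr_diff[of 2 "- 2 * \<nu>" 4] by (simp add: powr_numeral)
  define X where "X = \<rho> * \<rho>'"
  have X: "X > 0" using n by (simp add: X_def \<rho>_def \<rho>'_def)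
  have gen: "n ^ 4 * (P * T * (g / p) ^ 3 / g' ^ 4) = 16 * m ^ 4 * X ^ 3 * (P * (T / 16) * (g / X / p) ^ 3 / (g' * m / n) ^ 4)"
    if "p > 0" "m > 0" for P T p m
    using that n g X by (simp add: power_divide power_mult_distrib)
  show ?thesis
    unfolding rJ_value_def 1 2 3 X_def[symmetric] unfolding n_def[symmetric] g_def[symmetric] g'_def[symmetric]
    by (rule gen) (use n in auto)
qed

text \<open>The tangent at t0 lies below the convex function t powr (-3/2).\<close>

lemma inverse_three_halves_tangent:
  fixes t t0 :: real
  assumes "t > 0" "t0 > 0"
  shows "t0 powr (-3 / 2) * (5 / 2 - 3 * t / (2 * t0)) \<le> (t powr (-1 / 2)) ^ 3"
proof -
  \<comment> \<open>In terms of v the claim reads 5 v^3 - 3 v^5 <= 2. The difference has the double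
    root v = 1, the point of tangency, and a positive cofactor.\<close>
  define v where "v = sqrt (t / t0)"
  have v: "v > 0" "t = t0 * v\<^sup>2" using assms by (auto simp: v_def)
  have "0 \<le> (v - 1)\<^sup>2 * (3 * v ^ 3 + 6 * v\<^sup>2 + 4 * v + 2)" using v by (intro mult_nonneg_nonneg) auto
  also have "\<dots> = 2 - v ^ 3 * (5 - 3 * v\<^sup>2)" by (simp add: algebra_simps eval_nat_numeral)
  finally have "v ^ 3 * (5 - 3 * v\<^sup>2) \<le> 2" by simp
  hence 1: "5 / 2 - 3 * v\<^sup>2 / 2 \<le> 1 / v ^ 3" using v by (simp add: field_simps)
  have "(t powr (-1 / 2)) ^ 3 = t powr (-3 / 2)" using assms by (simp add: powr_power)
  also have "\<dots> = t0 powr (-3 / 2) * (v\<^sup>2) powr (-3 / 2)" unfolding v(2) using assms v by (simp add: powr_mult)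
  also have "(v\<^sup>2) powr (-3 / 2) = v powr (-3)"
    using v powr_powr[of v 2 "-3 / 2"] by (simp add: powr_numeral)
  also have "v powr (-3) = 1 / v ^ 3" using v by (simp add: powr_minus_divide powr_numeral)
  finally have 2: "(t powr (-1 / 2)) ^ 3 = t0 powr (-3 / 2) * (1 / v ^ 3)" .
  have "5 / 2 - 3 * t / (2 * t0) = 5 / 2 - 3 * v\<^sup>2 / 2" unfolding v(2) using assms by simp
  thus ?thesis unfolding 2 using 1 by (intro mult_left_mono) auto
qed

text \<open>Cubing the upper estimate of \<open>rF_bounds\<close> gives a Beta integrand at once.
  The lower one gives (1 - r x^2)^(-3/2), which does not; replacing that power by its tangent in t =
  1 - r x^2 leaves two Beta integrals.\<close>

lemma rJ_bounds:
  assumes \<nu>: "\<nu> > 2"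
  shows "rJ \<nu> \<le> Beta (\<nu> + 3 / 2) (\<nu> - 1 / 2) / 2"
    and "((\<nu> + 3 / 2) / (2 * \<nu> + 5 / 2)) powr (-3 / 2) * (Beta (\<nu> + 3 / 2) (\<nu> + 1) / 2) \<le> rJ \<nu>"
proof -
  have x2: "0 \<le> x\<^sup>2" "x\<^sup>2 < 1" if "x \<in> {0..1}" "x \<noteq> 1" for x :: real
    using that by (auto simp: power_less_one_iff abs_square_less_1)
  have B: "((\<lambda>x. x powr (2 * \<nu> + 2) * (1 - x\<^sup>2) powr (\<nu> - 3 / 2)) has_integral Beta (\<nu> + 3 / 2) (\<nu> - 1 / 2) / 2) {0..1}"
    using has_integral_Beta_square[of "\<nu> + 3 / 2" "\<nu> - 1 / 2"] \<nu> by (simp add: algebra_simps)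
  show "rJ \<nu> \<le> Beta (\<nu> + 3 / 2) (\<nu> - 1 / 2) / 2"
  proof (rule has_integral_le[OF rJ_fun_has_integral B])
    fix x :: real assume x: "x \<in> {0..1}"
    show "rJ_fun \<nu> x \<le> x powr (2 * \<nu> + 2) * (1 - x\<^sup>2) powr (\<nu> - 3 / 2)"
    proof (cases "x = 1")
      case False
      note x2 = x2[OF x False]
      have r0: "0 \<le> rF (\<nu> + 1) (x\<^sup>2)"
        using rF_bounds(2)[OF _ x2, of "\<nu> + 1"] \<nu> by (meson order.trans powr_ge_zero add_pos_pos zero_less_one less_trans zero_less_numeral)
      have "rF (\<nu> + 1) (x\<^sup>2) ^ 3 \<le> ((1 - x\<^sup>2) powr (-1 / 2)) ^ 3"
        by (intro power_mono rF_bounds r0 x2) (use \<nu> in auto)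
      also have "\<dots> = (1 - x\<^sup>2) powr (-3 / 2)" using x2 by (simp add: powr_power)
      finally have "rJ_fun \<nu> x \<le> x powr (2 * \<nu> + 2) * (1 - x\<^sup>2) powr (-3 / 2) * (1 - x\<^sup>2) powr \<nu>"
        unfolding rJ_fun_def by (intro mult_right_mono mult_left_mono) auto
      also have "\<dots> = x powr (2 * \<nu> + 2) * (1 - x\<^sup>2) powr (\<nu> - 3 / 2)"
        by (simp add: mult.assoc powr_add[symmetric])
      finally show ?thesis .
    qed (use \<nu> in \<open>auto simp: rJ_fun_def\<close>)
  qed (use \<nu> in auto)
  define r where "r = (\<nu> + 1) / (\<nu> + 3 / 2)"
  \<comment> \<open>The mean of 1 - r x^2 for the weight x^(2\<nu>+2) (1 - x^2)^\<nu>, so that the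
    linear part of the tangent integrates to zero, as in Jensen's inequality. It is the mean of x^2
    as well, because r t0 = 1 - t0.\<close>
  define t0 where "t0 = (\<nu> + 3 / 2) / (2 * \<nu> + 5 / 2)"
  define B0 where "B0 = Beta (\<nu> + 3 / 2) (\<nu> + 1)"
  define B1 where "B1 = Beta (\<nu> + 3 / 2 + 1) (\<nu> + 1)"
  have t0: "t0 > 0" using \<nu> by (simp add: t0_def)
  have r: "0 < r" "r < 1" "\<nu> + 1 + 1 / 2 = \<nu> + 3 / 2" using \<nu> by (auto simp: r_def)
  have B01: "(2 * \<nu> + 5 / 2) * B1 = (\<nu> + 3 / 2) * B0"
  proof -
    have "\<nu> + 3 / 2 + (\<nu> + 1) = 2 * \<nu> + 5 / 2" "\<nu> + 3 / 2 \<notin> \<int>\<^sub>\<le>\<^sub>0" using \<nu> by auto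
    thus ?thesis using Beta_plus1_left[of "\<nu> + 3 / 2" "\<nu> + 1"] unfolding B0_def B1_def by simp
  qed
  have I0: "((\<lambda>x. x powr (2 * \<nu> + 2) * (1 - x\<^sup>2) powr \<nu>) has_integral B0 / 2) {0..1}"
    using has_integral_Beta_square[of "\<nu> + 3 / 2" "\<nu> + 1"] \<nu> by (simp add: B0_def algebra_simps)
  have I1: "((\<lambda>x. x powr (2 * \<nu> + 4) * (1 - x\<^sup>2) powr \<nu>) has_integral B1 / 2) {0..1}"
    using has_integral_Beta_square[of "\<nu> + 3 / 2 + 1" "\<nu> + 1"] \<nu> by (simp add: B1_def algebra_simps)
  let ?c = "t0 powr (-3 / 2)"
  have I: "((\<lambda>x. ?c * ((5 / 2 - 3 / (2 * t0)) * (x powr (2 * \<nu> + 2) * (1 - x\<^sup>2) powr \<nu>) + 3 * r / (2 * t0) * (x powr (2 * \<nu> + 4) * (1 - x\<^sup>2) powr \<nu>)))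
      has_integral (?c * ((5 / 2 - 3 / (2 * t0)) * (B0 / 2) + 3 * r / (2 * t0) * (B1 / 2)))) {0..1}"
    by (intro has_integral_mult_right has_integral_add I0 I1)
  have "?c * ((5 / 2 - 3 / (2 * t0)) * (B0 / 2) + 3 * r / (2 * t0) * (B1 / 2)) \<le> rJ \<nu>"
  proof (rule has_integral_le[OF I rJ_fun_has_integral])
    fix x :: real assume x: "x \<in> {0..1}"
    show "?c * ((5 / 2 - 3 / (2 * t0)) * (x powr (2 * \<nu> + 2) * (1 - x\<^sup>2) powr \<nu>) + 3 * r / (2 * t0) * (x powr (2 * \<nu> + 4) * (1 - x\<^sup>2) powr \<nu>)) \<le> rJ_fun \<nu> x"
    proof (cases "x = 1")
      case False
      note x2 = x2[OF x False]
      have rx: "1 - r * x\<^sup>2 > 0"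
      proof -
        have "r * x\<^sup>2 \<le> 1 * x\<^sup>2" using r x2 by (intro mult_right_mono) auto
        thus ?thesis using x2 by simp
      qed
      have "?c * (5 / 2 - 3 * (1 - r * x\<^sup>2) / (2 * t0)) \<le> ((1 - r * x\<^sup>2) powr (-1 / 2)) ^ 3"
        by (rule inverse_three_halves_tangent[OF rx t0])
      also have "\<dots> \<le> rF (\<nu> + 1) (x\<^sup>2) ^ 3"
        using rF_bounds(2)[OF _ x2, of "\<nu> + 1"] \<nu> unfolding r(3) r_def[symmetric] by (intro power_mono) auto
      finally have "?c * (5 / 2 - 3 * (1 - r * x\<^sup>2) / (2 * t0)) * (x powr (2 * \<nu> + 2) * (1 - x\<^sup>2) powr \<nu>) \<le> rF (\<nu> + 1) (x\<^sup>2) ^ 3 * (x powr (2 * \<nu> + 2) * (1 - x\<^sup>2) powr \<nu>)"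
        by (intro mult_right_mono) auto
      moreover have "x powr (2 * \<nu> + 4) = x\<^sup>2 * x powr (2 * \<nu> + 2)"
      proof (cases "x = 0")
        case False
        hence "x > 0" using x by auto
        have "x powr (2 * \<nu> + 4) = x powr (2 + (2 * \<nu> + 2))" by (rule arg_cong[where f = "\<lambda>t. x powr t"]) simp
        also have "\<dots> = x powr 2 * x powr (2 * \<nu> + 2)" by (rule powr_add)
        finally show ?thesis using \<open>x > 0\<close> by (simp add: powr_numeral)
      qed auto
      ultimately show ?thesis unfolding rJ_fun_def using t0 by (simp add: field_simps)
    qed (use \<nu> in \<open>auto simp: rJ_fun_def\<close>)
  qed (use \<nu> in auto)
  also have "(5 / 2 - 3 / (2 * t0)) * (B0 / 2) + 3 * r / (2 * t0) * (B1 / 2) = B0 / 2"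
  proof -
    have "r * B1 = (1 - t0) * B0"
    proof -
      have "B1 = t0 * B0" using B01 \<nu> by (simp add: t0_def field_simps)
      moreover have "r * t0 = (\<nu> + 1) / (2 * \<nu> + 5 / 2)" using \<nu> by (simp add: r_def t0_def)
      moreover have "1 - t0 = (\<nu> + 1) / (2 * \<nu> + 5 / 2)" using \<nu> by (simp add: t0_def field_simps)
      ultimately show ?thesis by (metis mult.assoc)
    qed
    hence "3 * r / (2 * t0) * (B1 / 2) = 3 / (4 * t0) * ((1 - t0) * B0)" by simp
    thus ?thesis using t0 by (simp add: field_simps)
  qed
  finally show "((\<nu> + 3 / 2) / (2 * \<nu> + 5 / 2)) powr (-3 / 2) * (Beta (\<nu> + 3 / 2) (\<nu> + 1) / 2) \<le> rJ \<nu>"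
    unfolding t0_def B0_def .
qed

lemma Gamma_duplication_real:
  assumes "z > (0 :: real)"
  shows "Gamma z * Gamma (z + 1 / 2) = 2 powr (1 - 2 * z) * sqrt pi * Gamma (2 * z)"
proof -
  have e: "complex_of_real z + 1 / 2 = of_real (z + 1 / 2)" "2 * complex_of_real z = of_real (2 * z)"
      "(1 - complex_of_real (2 * z)) * of_real (ln 2) = of_real ((1 - 2 * z) * ln 2)" by simp_all
  have "complex_of_real z \<notin> \<int>\<^sub>\<le>\<^sub>0" "complex_of_real z + 1 / 2 \<notin> \<int>\<^sub>\<le>\<^sub>0"
    by (rule Re_pos_not_nonpos_Int; use assms in simp)+
  from Gamma_legendre_duplication[OF this]
  have "complex_of_real (Gamma z) * of_real (Gamma (z + 1 / 2)) = of_real (exp ((1 - 2 * z) * ln 2)) * of_real (sqrt pi) * of_real (Gamma (2 * z))"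
    unfolding e Gamma_complex_of_real exp_of_real .
  hence "complex_of_real (Gamma z * Gamma (z + 1 / 2)) = of_real (exp ((1 - 2 * z) * ln 2) * sqrt pi * Gamma (2 * z))"
    by (simp only: of_real_mult)
  thus ?thesis unfolding of_real_eq_iff by (simp add: powr_def)
qed

text \<open>Both Beta values share the factor 2^(-2\<nu>) with \<open>rJ_value\<close>: Legendre
  duplication extracts it and leaves Gamma quotients at arguments a half apart, which
  \<open>gamma_ratio_bounds\<close> replaces by square roots. Both resulting bounds tend to
  1.\<close>

lemma rJ_ratio_bounds:
  assumes \<nu>: "\<nu> > 2"
  shows "rJ \<nu> / rJ_value \<nu> \<le> 4 * (\<nu> + 1 / 2) / ((\<nu> - 1 / 2) * \<nu>) * (sqrt \<nu> * ((\<nu> + 1) / 2)\<^sup>2 / sqrt (\<nu> + 1 / 2) ^ 3)"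
    and "2 * ((\<nu> + 3 / 2) / (2 * \<nu> + 5 / 2)) powr (-3 / 2) * ((\<nu> / 2)\<^sup>2 / (sqrt (2 * \<nu> + 2) * sqrt (\<nu> + 1) ^ 3)) \<le> rJ \<nu> / rJ_value \<nu>"
proof -
  define g1 g2 g3 g4 where "g1 = gamma_ratio (\<nu> + 1)" and "g2 = gamma_ratio ((\<nu> + 1) / 2)"
    and "g3 = gamma_ratio \<nu>" and "g4 = gamma_ratio (2 * \<nu> + 2)"
  have g: "g1 > 0" "g2 > 0" "g3 > 0" "g4 > 0" using \<nu> by (auto simp: g1_def g2_def g3_def g4_def intro: gamma_ratio_pos)
  have b1: "sqrt (\<nu> + 1 / 2) \<le> g1" "g1 \<le> sqrt (\<nu> + 1)" using gamma_ratio_bounds[of "\<nu> + 1"] \<nu> by (auto simp: g1_def add.commute)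
  have b2: "sqrt (\<nu> / 2) \<le> g2" "g2 \<le> sqrt ((\<nu> + 1) / 2)"
  proof -
    have k: "(\<nu> + 1) / 2 - 1 / 2 = \<nu> / 2" by (simp add: field_simps)
    have q: "(\<nu> + 1) / 2 > 1 / 2" using \<nu> by simp
    show "sqrt (\<nu> / 2) \<le> g2" "g2 \<le> sqrt ((\<nu> + 1) / 2)"
      using gamma_ratio_bounds(1,2)[OF q] unfolding k g2_def .
  qed
  have b3: "g3 \<le> sqrt \<nu>" using gamma_ratio_bounds[of "\<nu>"] \<nu> by (auto simp: g3_def)
  have b4: "g4 \<le> sqrt (2 * \<nu> + 2)" using gamma_ratio_bounds[of "2 * \<nu> + 2"] \<nu> by (auto simp: g4_def)
  have g24: "g2 ^ 4 \<le> ((\<nu> + 1) / 2)\<^sup>2" "(\<nu> / 2)\<^sup>2 \<le> g2 ^ 4"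
  proof -
    have "g2 ^ 4 \<le> sqrt ((\<nu> + 1) / 2) ^ 4" using b2 g by (intro power_mono) auto
    also have "\<dots> = (sqrt ((\<nu> + 1) / 2) ^ 2) ^ 2" by (simp flip: power_mult)
    also have "\<dots> = ((\<nu> + 1) / 2)\<^sup>2" using \<nu> by simp
    finally show "g2 ^ 4 \<le> ((\<nu> + 1) / 2)\<^sup>2" .
    have "(\<nu> / 2)\<^sup>2 = (sqrt (\<nu> / 2) ^ 2) ^ 2" using \<nu> by simp
    also have "\<dots> = sqrt (\<nu> / 2) ^ 4" by (simp flip: power_mult)
    also have "\<dots> \<le> g2 ^ 4" using b2 \<nu> by (intro power_mono) auto
    finally show "(\<nu> / 2)\<^sup>2 \<le> g2 ^ 4" .
  qed
  define P where "P = (2 :: real) powr (- 2 * \<nu>)"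
  have P: "P > 0" by (simp add: P_def)
  have sp: "sqrt pi ^ 2 = pi" "sqrt pi > 0" by auto
  have M: "rJ_value \<nu> = pi\<^sup>2 / 8 * P * (g1 / sqrt pi) ^ 3 / g2 ^ 4"
    by (simp add: rJ_value_def P_def g1_def g2_def)
  have Gp: "Gamma \<nu> > 0" "Gamma (2 * \<nu>) > 0" "Gamma (2 * \<nu> + 2) > 0" using \<nu> by (auto intro: Gamma_real_pos)
  have cancel: "x = x / y * y" if "y > 0" for x y :: real using that by simp
  have ratio: "(c * (P * sqrt pi * d)) / rJ_value \<nu> = 8 * c * d * (g2 ^ 4 / g1 ^ 3)" for c d
  proof -
    have "pi = sqrt pi * sqrt pi" by simp
    hence pi4: "pi\<^sup>2 = sqrt pi ^ 4" by (simp add: eval_nat_numeral)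
    show ?thesis unfolding M pi4 using P g sp(2) by (simp add: field_simps eval_nat_numeral)
  qed
  have "Beta (\<nu> + 3 / 2) (\<nu> - 1 / 2) = P * sqrt pi * ((\<nu> + 1 / 2) * g3 / ((\<nu> - 1 / 2) * \<nu>))"
  proof -
    have e1: "Gamma (\<nu> + 3 / 2) = (\<nu> + 1 / 2) * Gamma (\<nu> + 1 / 2)"
    proof -
      have "\<nu> + 3 / 2 = (\<nu> + 1 / 2) + 1" by simp
      moreover have "Gamma (\<nu> + 1 / 2 + 1) = (\<nu> + 1 / 2) * Gamma (\<nu> + 1 / 2)" using \<nu> by (intro Gamma_plus1) auto
      ultimately show ?thesis by metis
    qed
    have e2: "Gamma (\<nu> + 1 / 2) = (\<nu> - 1 / 2) * Gamma (\<nu> - 1 / 2)"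
    proof -
      have "\<nu> + 1 / 2 = (\<nu> - 1 / 2) + 1" by simp
      moreover have "Gamma (\<nu> - 1 / 2 + 1) = (\<nu> - 1 / 2) * Gamma (\<nu> - 1 / 2)" using \<nu> by (intro Gamma_plus1) auto
      ultimately show ?thesis by metis
    qed
    have e3: "Gamma (\<nu> + 3 / 2 + (\<nu> - 1 / 2)) = 2 * \<nu> * Gamma (2 * \<nu>)"
    proof -
      have "\<nu> + 3 / 2 + (\<nu> - 1 / 2) = 2 * \<nu> + 1" by simp
      moreover have "Gamma (2 * \<nu> + 1) = 2 * \<nu> * Gamma (2 * \<nu>)" using \<nu> by (intro Gamma_plus1) auto
      ultimately show ?thesis by metis
    qed
    have e4: "Gamma \<nu> * Gamma (\<nu> + 1 / 2) = 2 * P * sqrt pi * Gamma (2 * \<nu>)"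
      using Gamma_duplication_real[of \<nu>] \<nu> by (simp add: P_def powr_diff powr_minus field_simps)
    have e5: "Gamma (\<nu> + 1 / 2) = g3 * Gamma \<nu>" unfolding g3_def gamma_ratio_def by (rule cancel[OF Gp(1)])
    have e6: "Gamma (\<nu> - 1 / 2) = Gamma (\<nu> + 1 / 2) / (\<nu> - 1 / 2)" using e2 \<nu> by (simp add: field_simps)
    have "Gamma (\<nu> + 3 / 2) * Gamma (\<nu> - 1 / 2) = (\<nu> + 1 / 2) / (\<nu> - 1 / 2) * (g3 * (Gamma \<nu> * Gamma (\<nu> + 1 / 2)))"
      unfolding e1 e6 by (subst (2) e5) simp
    moreover have "a / b * (g * (2 * P * s * G)) / (2 * v * G) = P * s * (a * g / (b * v))" if "G > 0" for a b g s v G :: real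
      using that by simp
    ultimately show ?thesis unfolding Beta_def e3 e4 using Gp(2) by simp
  qed
  hence "rJ \<nu> \<le> 1 / 2 * (P * sqrt pi * ((\<nu> + 1 / 2) * g3 / ((\<nu> - 1 / 2) * \<nu>)))"
    using rJ_bounds(1)[OF \<nu>] by (metis mult.commute mult_1 times_divide_eq_right)
  hence "rJ \<nu> / rJ_value \<nu> \<le> (1 / 2 * (P * sqrt pi * ((\<nu> + 1 / 2) * g3 / ((\<nu> - 1 / 2) * \<nu>)))) / rJ_value \<nu>"
    by (rule divide_right_mono) (use rJ_value_pos[of \<nu>] \<nu> in auto)
  also have "\<dots> = 4 * (\<nu> + 1 / 2) / ((\<nu> - 1 / 2) * \<nu>) * (g3 * g2 ^ 4 / g1 ^ 3)"
    unfolding ratio by simp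
  also have "\<dots> \<le> 4 * (\<nu> + 1 / 2) / ((\<nu> - 1 / 2) * \<nu>) * (sqrt \<nu> * ((\<nu> + 1) / 2)\<^sup>2 / sqrt (\<nu> + 1 / 2) ^ 3)"
    using \<nu> g b1 b3 g24 by (intro mult_left_mono frac_le mult_mono power_mono) auto
  finally show "rJ \<nu> / rJ_value \<nu> \<le> 4 * (\<nu> + 1 / 2) / ((\<nu> - 1 / 2) * \<nu>) * (sqrt \<nu> * ((\<nu> + 1) / 2)\<^sup>2 / sqrt (\<nu> + 1 / 2) ^ 3)" .
  define t where "t = ((\<nu> + 3 / 2) / (2 * \<nu> + 5 / 2)) powr (-3 / 2)"
  have t: "t \<ge> 0" by (simp add: t_def)
  have "Beta (\<nu> + 3 / 2) (\<nu> + 1) = P * sqrt pi * (1 / (2 * g4))"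
  proof -
    have e0: "\<nu> + 3 / 2 + (\<nu> + 1) = 2 * \<nu> + 2 + 1 / 2" "\<nu> + 1 + 1 / 2 = \<nu> + 3 / 2" "2 * (\<nu> + 1) = 2 * \<nu> + 2" "1 - 2 * (\<nu> + 1) = - 2 * \<nu> - 1" by simp_all
    have e1: "Gamma (\<nu> + 1) * Gamma (\<nu> + 3 / 2) = P / 2 * sqrt pi * Gamma (2 * \<nu> + 2)"
    proof -
      have "2 powr (1 - 2 * (\<nu> + 1)) = P / 2" unfolding e0(4) P_def by (simp add: powr_diff)
      with Gamma_duplication_real[of "\<nu> + 1"] \<nu> show ?thesis unfolding e0(2) by (simp only: e0(3))
    qed
    have e2: "Gamma (2 * \<nu> + 2 + 1 / 2) = g4 * Gamma (2 * \<nu> + 2)" unfolding g4_def gamma_ratio_def by (rule cancel[OF Gp(3)])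
    have "P / 2 * s * G / (h * G) = P * s * (1 / (2 * h))" if "G > 0" for s G h :: real using that by simp
    from this[OF Gp(3)] show ?thesis unfolding Beta_def e0(1) e2 mult.commute[of "Gamma (\<nu> + 3 / 2)"] e1 .
  qed
  hence "t / 2 * (P * sqrt pi * (1 / (2 * g4))) \<le> rJ \<nu>"
    using rJ_bounds(2)[OF \<nu>] unfolding t_def[symmetric] by (metis times_divide_eq_left times_divide_eq_right)
  hence "(t / 2 * (P * sqrt pi * (1 / (2 * g4)))) / rJ_value \<nu> \<le> rJ \<nu> / rJ_value \<nu>"
    by (rule divide_right_mono) (use rJ_value_pos[of \<nu>] \<nu> in auto)
  moreover have "(t / 2 * (P * sqrt pi * (1 / (2 * g4)))) / rJ_value \<nu> = 2 * t * (g2 ^ 4 / (g4 * g1 ^ 3))"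
    unfolding ratio by simp
  moreover have "2 * t * ((\<nu> / 2)\<^sup>2 / (sqrt (2 * \<nu> + 2) * sqrt (\<nu> + 1) ^ 3)) \<le> 2 * t * (g2 ^ 4 / (g4 * g1 ^ 3))"
    using \<nu> g b1 b4 g24 t by (intro mult_left_mono frac_le mult_mono power_mono) auto
  ultimately show "2 * ((\<nu> + 3 / 2) / (2 * \<nu> + 5 / 2)) powr (-3 / 2) * ((\<nu> / 2)\<^sup>2 / (sqrt (2 * \<nu> + 2) * sqrt (\<nu> + 1) ^ 3)) \<le> rJ \<nu> / rJ_value \<nu>"
    unfolding t_def by linarith
qed

text \<open>The quotient of the two sides is invariant under \<nu> -> \<nu> + 2, so it equals its
  limit along \<nu> + 2m, which is squeezed to 1.\<close>

theorem rJ_eq: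
  assumes \<nu>: "\<nu> > 0"
  shows "rJ \<nu> = rJ_value \<nu>"
proof -
  define L where "L \<nu> = rJ \<nu> / rJ_value \<nu>" for \<nu>
  have step: "L (\<mu> + 2) = L \<mu>" if \<mu>: "\<mu> > 0" for \<mu>
  proof -
    let ?c = "16 * (\<mu> + 1 + 1) ^ 4 * ((\<mu> + 1) / (\<mu> + 1 + 1 / 2) * ((\<mu> + 1 + 1) / (\<mu> + 1 + 3 / 2))) ^ 3"
    have c: "?c > 0" "(\<mu> + 1) ^ 4 > 0" using \<mu> by auto
    have "(\<mu> + 1) ^ 4 * rJ \<mu> / ((\<mu> + 1) ^ 4 * rJ_value \<mu>) = ?c * rJ (\<mu> + 2) / (?c * rJ_value (\<mu> + 2))"
      unfolding rJ_recurrence[OF \<mu>] rJ_value_recurrence[OF \<mu>] ..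
    thus ?thesis unfolding L_def using c by (simp only: mult_divide_mult_cancel_left less_imp_neq[symmetric] not_False_eq_True)
  qed
  have per: "L (\<nu> + 2 * real m) = L \<nu>" for m
  proof (induction m)
    case (Suc m)
    have "\<nu> + 2 * real (Suc m) = \<nu> + 2 * real m + 2" by simp
    hence "L (\<nu> + 2 * real (Suc m)) = L (\<nu> + 2 * real m + 2)" by (simp only:)
    also have "\<dots> = L (\<nu> + 2 * real m)" by (rule step) (use \<nu> in auto)
    finally show ?case using Suc by simp
  qed auto
  have lim: "filterlim (\<lambda>m. \<nu> + 2 * real m) at_top sequentially" by real_asymp
  have "((\<lambda>\<nu>::real. 4 * (\<nu> + 1 / 2) / ((\<nu> - 1 / 2) * \<nu>) * (sqrt \<nu> * ((\<nu> + 1) / 2)\<^sup>2 / sqrt (\<nu> + 1 / 2) ^ 3)) \<longlongrightarrow> 4 * (1 / 2)\<^sup>2) at_top"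
    by real_asymp
  hence up: "((\<lambda>\<nu>::real. 4 * (\<nu> + 1 / 2) / ((\<nu> - 1 / 2) * \<nu>) * (sqrt \<nu> * ((\<nu> + 1) / 2)\<^sup>2 / sqrt (\<nu> + 1 / 2) ^ 3)) \<longlongrightarrow> 1) at_top"
    by (simp add: power2_eq_square)
  have "((\<lambda>\<nu>::real. 2 * ((\<nu> + 3 / 2) / (2 * \<nu> + 5 / 2)) powr (-3 / 2) * ((\<nu> / 2)\<^sup>2 / (sqrt (2 * \<nu> + 2) * sqrt (\<nu> + 1) ^ 3))) \<longlongrightarrow> 2 * (1 / 2) powr - (3 / 2) * ((1 / 2)\<^sup>2 * inverse (2 powr (1 / 2)))) at_top"
    by real_asymp
  also have "2 * (1 / 2) powr - (3 / 2) * ((1 / 2)\<^sup>2 * inverse (2 powr (1 / 2))) = (1 :: real)"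
  proof -
    have "(1 / 2) powr - (3 / 2) = (2 :: real) powr (1 + 1 / 2)" by (simp add: powr_minus powr_divide)
    also have "\<dots> = 2 powr 1 * 2 powr (1 / 2)" by (rule powr_add)
    finally show ?thesis by (simp add: power2_eq_square)
  qed
  finally have lo: "((\<lambda>\<nu>::real. 2 * ((\<nu> + 3 / 2) / (2 * \<nu> + 5 / 2)) powr (-3 / 2) * ((\<nu> / 2)\<^sup>2 / (sqrt (2 * \<nu> + 2) * sqrt (\<nu> + 1) ^ 3))) \<longlongrightarrow> 1) at_top" .
  have ev: "eventually (\<lambda>m. \<nu> + 2 * real m > 2) sequentially"
    using lim by (rule filterlim_at_top_dense[THEN iffD1, rule_format])
  have "(\<lambda>m. L (\<nu> + 2 * real m)) \<longlonglongrightarrow> 1"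
    unfolding L_def
    by (rule tendsto_sandwich[OF _ _ filterlim_compose[OF lo lim] filterlim_compose[OF up lim]];
        rule eventually_mono[OF ev], erule rJ_ratio_bounds)
  hence "(\<lambda>m :: nat. L \<nu>) \<longlonglongrightarrow> 1" unfolding per .
  hence "L \<nu> = 1" by (simp add: LIMSEQ_const_iff)
  thus ?thesis using rJ_value_pos[OF \<nu>] by (simp add: L_def)
qed

text \<open>Solving for the integral, the cube of \<open>zb_kappa\<close> on the left cancels
  against the same cube in \<open>rJ_value\<close>. The remaining Gamma quotient at (\<nu> + 1)/2 is
  the reciprocal of the one in the theorem.\<close>

theorem legendre_triple_theta_value:
  fixes \<nu> :: real
  assumes \<nu>: "0 < \<nu>" "\<nu> < 1 / 2"
  shows "integral {0..pi} (\<lambda>\<theta>. legendre_P (of_real \<nu>) (cos \<theta>) * legendre_P (of_real \<nu>) (cos \<theta>) * legendre_P (of_real \<nu>) (- cos \<theta>) * of_real (sin \<theta> powr \<nu>)) =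
     of_real (1 / pi * (cos (\<nu> * pi / 2) / 2 powr \<nu>) ^ 3 * (Gamma ((1 + \<nu>) / 2) / Gamma (1 + \<nu> / 2)) ^ 4)"
    (is "?b = _")
proof -
  define g h c T where "g = gamma_ratio (\<nu> + 1)" and "h = gamma_ratio ((\<nu> + 1) / 2)" and "c = cos (\<nu> * pi / 2)" and "T = 2 powr \<nu>"
  have pos: "g > 0" "h > 0" "T > 0" using \<nu> by (auto simp: g_def h_def T_def intro: gamma_ratio_pos)
  have kappa: "zb_kappa (1 / 2) (of_real (\<nu> + 1)) = of_real (g / sqrt pi)"
  proof -
    have "1 / 2 + complex_of_real (\<nu> + 1) = of_real (\<nu> + 1 + 1 / 2)" by simp
    hence "Gamma (1 / 2 + complex_of_real (\<nu> + 1)) = of_real (Gamma (\<nu> + 1 + 1 / 2))"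
      by (simp only: Gamma_complex_of_real)
    moreover have "rGamma (complex_of_real (\<nu> + 1)) = of_real (inverse (Gamma (\<nu> + 1)))"
      unfolding rGamma_inverse_Gamma Gamma_complex_of_real by (rule of_real_inverse[symmetric])
    moreover have "rGamma (1 / 2 :: complex) = of_real (inverse (sqrt pi))"
      unfolding rGamma_inverse_Gamma Gamma_one_half_complex by simp
    ultimately have "zb_kappa (1 / 2) (of_real (\<nu> + 1)) =
        of_real (inverse (sqrt pi)) * of_real (inverse (Gamma (\<nu> + 1))) * complex_of_real (Gamma (\<nu> + 1 + 1 / 2))"
      unfolding zb_kappa_def by (simp only:)
    thus ?thesis unfolding g_def gamma_ratio_def by (simp add: field_simps)
  qed
  have "of_real (T * pi ^ 3) * of_real (g / sqrt pi) ^ 3 * ?b = 8 * of_real c ^ 3 * complex_of_real (rJ_value \<nu>)"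
    using legendre_triple_theta(4)[OF \<nu>] zb_triple_integral_eq_rJ[OF \<nu>(1)] rJ_eq[OF \<nu>(1)]
    unfolding kappa T_def c_def by simp
  hence "of_real (T * pi ^ 3 * (g / sqrt pi) ^ 3) * ?b = complex_of_real (8 * c ^ 3 * rJ_value \<nu>)"
    by simp
  moreover have "T * pi ^ 3 * (g / sqrt pi) ^ 3 > 0" using pos by simp
  hence "complex_of_real (T * pi ^ 3 * (g / sqrt pi) ^ 3) \<noteq> 0" unfolding of_real_eq_0_iff by linarith
  moreover have "y = w / x" if "x * y = w" "x \<noteq> 0" for x y w :: complex using that by auto
  ultimately have "?b = of_real (8 * c ^ 3 * rJ_value \<nu>) / of_real (T * pi ^ 3 * (g / sqrt pi) ^ 3)"
    by blast
  also have "\<dots> = of_real (8 * c ^ 3 * rJ_value \<nu> / (T * pi ^ 3 * (g / sqrt pi) ^ 3))"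
    by (rule of_real_divide[symmetric])
  also have "8 * c ^ 3 * rJ_value \<nu> / (T * pi ^ 3 * (g / sqrt pi) ^ 3) = 1 / pi * (c / T) ^ 3 * (1 / h) ^ 4"
  proof -
    have "2 powr (- 2 * \<nu>) = 1 / T\<^sup>2"
    proof -
      have "T\<^sup>2 = 2 powr (2 * \<nu>)" by (simp add: T_def powr_power mult.commute)
      thus ?thesis by (simp add: powr_minus_divide)
    qed
    hence v: "rJ_value \<nu> = pi\<^sup>2 / 8 * (1 / T\<^sup>2) * (g / sqrt pi) ^ 3 / h ^ 4"
      by (simp add: rJ_value_def g_def h_def)
    define X where "X = (g / sqrt pi) ^ 3"
    have X: "X > 0" using pos by (simp add: X_def)
    show ?thesis unfolding v X_def[symmetric] using X pos by (simp add: field_simps eval_nat_numeral)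
  qed
  also have "1 / h = Gamma ((1 + \<nu>) / 2) / Gamma (1 + \<nu> / 2)"
  proof -
    have "1 / h = Gamma ((\<nu> + 1) / 2) / Gamma ((\<nu> + 1) / 2 + 1 / 2)"
      unfolding h_def gamma_ratio_def by simp
    also have "(\<nu> + 1) / 2 + 1 / 2 = 1 + \<nu> / 2" by (simp add: field_simps)
    also have "(\<nu> + 1) / 2 = (1 + \<nu>) / 2" by simp
    finally show ?thesis .
  qed
  finally show ?thesis unfolding c_def T_def .
qed

section \<open>Uniform bounds and integrability\<close>

text \<open>For d n = n c_n the recurrence is d (n+1) = d n (1 - \<mu>(\<mu>+1) / (n (n+1))). With 1
  + t <= exp t the product is bounded by the exponential of the telescoping sum M (1 - 1/n),
  uniformly in the degree.\<close>

lemma zb_coeff_legendre_bound: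
  assumes M: "norm (\<mu> * (\<mu> + 1)) \<le> M" and n: "n \<ge> 1"
  shows "norm (zb_coeff (-\<mu>) (\<mu> + 1) n) \<le> M * exp M / real n"
proof -
  have M0: "M \<ge> 0" using M norm_ge_zero order.trans by blast
  define d where "d n = of_nat n * zb_coeff (-\<mu>) (\<mu> + 1) n" for n
  have one: "-\<mu> + (\<mu> + 1) \<notin> \<int>\<^sub>\<le>\<^sub>0" by simp
  have "norm (d (Suc n)) \<le> M * exp (M * (1 - 1 / real (Suc n)))" for n
  proof (induction n)
    case 0
    have "norm (d 1) = norm (\<mu> * (\<mu> + 1))" by (simp add: d_def zb_coeff_def norm_mult)
    thus ?case using M by simp
  next
    case (Suc n)
    have "d (Suc (Suc n)) = d (Suc n) + zb_diff (-\<mu>) (\<mu> + 1) (Suc n)"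
      by (simp add: d_def zb_diff_def)
    also have "zb_diff (-\<mu>) (\<mu> + 1) (Suc n) = d (Suc n) * (- (\<mu> * (\<mu> + 1)) / (of_nat (Suc n) * of_nat (Suc (Suc n))))"
    proof -
      have *: "z * (-\<mu> * (\<mu> + 1)) / q = p * z * (- (\<mu> * (\<mu> + 1)) / (p * q))" if "p \<noteq> 0" for p q z :: complex
        using that by (cases "q = 0") (auto simp: field_simps)
      have "-\<mu> + (\<mu> + 1) + of_nat (Suc n) = (of_nat (Suc (Suc n)) :: complex)" by simp
      thus ?thesis unfolding zb_diff_eq[OF one] d_def by (simp only: *[OF of_nat_neq_0])
    qed
    finally have "norm (d (Suc (Suc n))) = norm (d (Suc n)) * norm (1 - \<mu> * (\<mu> + 1) / (of_nat (Suc n) * of_nat (Suc (Suc n))))"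
      by (simp only: norm_mult[symmetric]) (simp only: right_diff_distrib mult_1_right minus_divide_left[symmetric] mult_minus_right diff_conv_add_uminus distrib_left)
    also have "norm (1 - \<mu> * (\<mu> + 1) / (of_nat (Suc n) * of_nat (Suc (Suc n)))) \<le> 1 + M / (real (Suc n) * real (Suc (Suc n)))"
    proof -
      have "norm (1 - \<mu> * (\<mu> + 1) / (of_nat (Suc n) * of_nat (Suc (Suc n)))) \<le> 1 + norm (\<mu> * (\<mu> + 1) / (of_nat (Suc n) * of_nat (Suc (Suc n))))"
        using norm_triangle_ineq4[of 1 "\<mu> * (\<mu> + 1) / (of_nat (Suc n) * of_nat (Suc (Suc n)))"] by simp
      also have "norm (\<mu> * (\<mu> + 1) / (of_nat (Suc n) * of_nat (Suc (Suc n)))) = norm (\<mu> * (\<mu> + 1)) / (real (Suc n) * real (Suc (Suc n)))"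
        by (simp only: norm_divide norm_mult norm_of_nat)
      also have "\<dots> \<le> M / (real (Suc n) * real (Suc (Suc n)))" by (intro divide_right_mono M) auto
      finally show ?thesis by simp
    qed
    also have "1 + M / (real (Suc n) * real (Suc (Suc n))) \<le> exp (M / (real (Suc n) * real (Suc (Suc n))))"
      by (rule exp_ge_add_one_self)
    finally have "norm (d (Suc (Suc n))) \<le> norm (d (Suc n)) * exp (M / (real (Suc n) * real (Suc (Suc n))))"
      by (simp add: mult_left_mono)
    also have "\<dots> \<le> M * exp (M * (1 - 1 / real (Suc n))) * exp (M / (real (Suc n) * real (Suc (Suc n))))"
      by (intro mult_right_mono Suc) auto
    also have "\<dots> = M * exp (M * (1 - 1 / real (Suc n)) + M / (real (Suc n) * real (Suc (Suc n))))"
      by (simp only: exp_add mult.assoc)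
    also have "M * (1 - 1 / real (Suc n)) + M / (real (Suc n) * real (Suc (Suc n))) = M * (1 - 1 / real (Suc (Suc n)))"
    proof -
      have "M * (1 - 1 / p) + M / (p * (p + 1)) = M * (1 - 1 / (p + 1))" if "p > 0" for p :: real
        using that by (simp add: divide_simps) (simp add: algebra_simps)
      from this[of "real (Suc n)"] show ?thesis by (simp only: of_nat_Suc) simp
    qed
    finally show ?case .
  qed
  from this[of "n - 1"] n have "norm (d n) \<le> M * exp (M * (1 - 1 / real n))" by simp
  also have "\<dots> \<le> M * exp M"
  proof -
    have "M * (1 - 1 / real n) \<le> M * 1" using M0 by (intro mult_left_mono) auto
    thus ?thesis using M0 by (intro mult_left_mono) auto
  qed
  finally show ?thesis using n by (simp add: d_def norm_mult field_simps)
qed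

lemma legendre_P_sums:
  assumes "-1 < x" "x < 3"
  shows "(\<lambda>n. zb_coeff (-\<mu>) (\<mu> + 1) n * of_real ((1 - x) / 2) ^ n) sums legendre_P \<mu> x"
proof -
  have "norm (complex_of_real ((1 - x) / 2)) < 1"
    unfolding norm_of_real using assms by (auto simp: abs_if)
  from zb_F_sums[OF _ this, of "-\<mu>" "\<mu> + 1"] show ?thesis
    using assms by (simp add: legendre_P_eq_zb_F)
qed

lemma one_minus_square_pos: "x \<in> {-1<..<1} \<Longrightarrow> 0 < 1 - x\<^sup>2" for x :: real
  by (simp add: abs_square_less_1 abs_less_iff)

text \<open>Apart from the constant term, the series is dominated by a multiple of the logarithm
  series, and a logarithm by any power. One constant serves all degrees with |\<mu>(\<mu> + 1)| <=
  M; domination locally uniform in the degree rests on this.\<close>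

lemma legendre_P_bound:
  fixes M \<epsilon> :: real
  assumes \<epsilon>: "\<epsilon> > 0" and M: "M \<ge> 0"
  obtains C where "C > 0" "\<And>(\<mu>::complex) x. norm (\<mu> * (\<mu> + 1)) \<le> M \<Longrightarrow> x \<in> {-1<..<1} \<Longrightarrow> norm (legendre_P \<mu> x) \<le> C * (1 - x\<^sup>2) powr (- \<epsilon>)"
proof
  define D where "D = M * exp M"
  have D: "D \<ge> 0" using M by (simp add: D_def)
  show "1 + D * (4 powr \<epsilon> / \<epsilon>) > 0" using D \<epsilon> by (intro add_pos_nonneg mult_nonneg_nonneg) auto
  fix \<mu> :: complex and x :: real assume \<mu>: "norm (\<mu> * (\<mu> + 1)) \<le> M" and x: "x \<in> {-1<..<1 :: real}"
  define X where "X = (1 - x) / 2"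
  have X: "0 < X" "X < 1" using x by (auto simp: X_def)
  have Y: "0 < 1 - x\<^sup>2" "1 - x\<^sup>2 \<le> 1" using one_minus_square_pos[OF x] by auto
  have s1: "(\<lambda>n. zb_coeff (-\<mu>) (\<mu> + 1) n * of_real X ^ n) sums legendre_P \<mu> x"
    unfolding X_def by (rule legendre_P_sums) (use x in auto)
  have "(\<lambda>n. - ((- (- X)) ^ n) / real n) sums ln (1 + (- X))" by (rule ln_series') (use X in auto)
  hence "(\<lambda>n. D * (- (- (X ^ n) / real n))) sums (D * (- ln (1 - X)))"
    by (intro sums_mult sums_minus) simp
  \<comment> \<open>The summand 1 at n = 0 stands for the constant term, absent from the logarithm
    series; X^0 / 0 contributes 0.\<close>
  hence s2: "(\<lambda>n. (if n = 0 then 1 else 0) + D * (X ^ n / real n)) sums (1 + D * (- ln (1 - X)))"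
    by (intro sums_add) (use sums_single[of 0 "\<lambda>_. 1 :: real"] in \<open>simp_all\<close>)
  have le: "norm (zb_coeff (-\<mu>) (\<mu> + 1) n * of_real X ^ n) \<le> (if n = 0 then 1 else 0) + D * (X ^ n / real n)" for n
  proof (cases "n = 0")
    case False
    hence "norm (zb_coeff (-\<mu>) (\<mu> + 1) n) * X ^ n \<le> D / real n * X ^ n"
      unfolding D_def using X by (intro mult_right_mono zb_coeff_legendre_bound \<mu>) auto
    thus ?thesis using False X by (simp add: norm_mult norm_power)
  qed auto
  have "norm (legendre_P \<mu> x) \<le> 1 + D * (- ln (1 - X))"
  proof -
    have sn: "summable (\<lambda>n. norm (zb_coeff (-\<mu>) (\<mu> + 1) n * of_real X ^ n))"
      by (rule summable_comparison_test[OF _ sums_summable[OF s2]]) (use le in auto)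
    have "norm (legendre_P \<mu> x) \<le> (\<Sum>n. norm (zb_coeff (-\<mu>) (\<mu> + 1) n * of_real X ^ n))"
      using summable_norm[OF sn] s1 by (simp add: sums_iff)
    also have "\<dots> \<le> (\<Sum>n. (if n = 0 then 1 else 0) + D * (X ^ n / real n))"
      by (intro suminf_le le sn sums_summable[OF s2])
    also have "\<dots> = 1 + D * (- ln (1 - X))" using s2 by (simp add: sums_iff)
    finally show ?thesis .
  qed
  also have "- ln (1 - X) \<le> 4 powr \<epsilon> / \<epsilon> * (1 - x\<^sup>2) powr (- \<epsilon>)"
  proof -
    have "- ln (1 - X) = ln (1 / (1 - X))" using X by (simp add: ln_div)
    also have "\<dots> \<le> (1 / (1 - X)) powr \<epsilon> / \<epsilon>" using X \<epsilon> by (intro ln_powr_bound) auto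
    also have "1 / (1 - X) \<le> 4 / (1 - x\<^sup>2)"
    proof -
      have "1 - x\<^sup>2 = 4 * X * (1 - X)" by (simp add: X_def field_simps power2_eq_square)
      also have "\<dots> \<le> 4 * 1 * (1 - X)" using X by (intro mult_right_mono mult_left_mono) auto
      finally have "1 - x\<^sup>2 \<le> 4 * (1 - X)" by simp
      thus ?thesis using X Y by (simp add: field_simps)
    qed
    hence "(1 / (1 - X)) powr \<epsilon> / \<epsilon> \<le> (4 / (1 - x\<^sup>2)) powr \<epsilon> / \<epsilon>"
      using X \<epsilon> by (intro divide_right_mono powr_mono2) auto
    also have "(4 / (1 - x\<^sup>2)) powr \<epsilon> = 4 powr \<epsilon> * (1 - x\<^sup>2) powr (- \<epsilon>)"
      using Y by (simp add: powr_divide powr_minus field_simps)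
    finally show ?thesis by simp
  qed
  hence "1 + D * (- ln (1 - X)) \<le> 1 + D * (4 powr \<epsilon> / \<epsilon> * (1 - x\<^sup>2) powr (- \<epsilon>))"
    using D by (intro add_left_mono mult_left_mono) auto
  also have "\<dots> \<le> (1 + D * (4 powr \<epsilon> / \<epsilon>)) * (1 - x\<^sup>2) powr (- \<epsilon>)"
  proof -
    have "1 \<le> (1 - x\<^sup>2) powr (- \<epsilon>)"
      using Y \<epsilon> powr_mono2'[of "-\<epsilon>" "1 - x\<^sup>2" 1] by simp
    thus ?thesis by (simp add: algebra_simps)
  qed
  finally show "norm (legendre_P \<mu> x) \<le> (1 + D * (4 powr \<epsilon> / \<epsilon>)) * (1 - x\<^sup>2) powr (- \<epsilon>)" by simp
qed

lemma einterval_m1_1: "einterval (-1) 1 = {-1<..<1 :: real}"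
  using einterval_eq_Icc[of "-1" 1] by (simp add: one_ereal_def)

lemma interval_integral_m1_1:
  fixes f :: "real \<Rightarrow> complex"
  shows "(LBINT x=-1..1. f x) = (LINT x:{-1<..<1}|lborel. f x)"
  unfolding interval_lebesgue_integral_def einterval_m1_1 by (simp add: one_ereal_def)

text \<open>The Beta integral under t = (1 + x)/2, where 1 - x^2 = 4 t (1 - t).\<close>

lemma set_integrable_one_minus_square_powr:
  fixes \<beta> :: real
  assumes "\<beta> > -1"
  shows "set_integrable lborel {-1<..<1} (\<lambda>x. (1 - x\<^sup>2) powr \<beta>)"
proof -
  have "set_integrable lborel {0..1} (\<lambda>t. t powr (\<beta> + 1 - 1) * (1 - t) powr (\<beta> + 1 - 1))"
    by (rule integrable_Beta) (use assms in auto)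
  hence "integrable lborel (\<lambda>t. indicator {0..1} t *\<^sub>R (t powr \<beta> * (1 - t) powr \<beta>))"
    by (simp add: set_integrable_def)
  from lborel_integrable_real_affine[OF this, of "1 / 2" "1 / 2"]
  have "integrable lborel (\<lambda>x. 4 powr \<beta> *\<^sub>R (indicator {0..1} (1 / 2 + 1 / 2 * x) *\<^sub>R ((1 / 2 + 1 / 2 * x) powr \<beta> * (1 - (1 / 2 + 1 / 2 * x)) powr \<beta>)))"
    by (intro integrable_scaleR_right) auto
  hence I: "set_integrable lborel {-1..1} (\<lambda>x. 4 powr \<beta> * ((1 / 2 + 1 / 2 * x) powr \<beta> * (1 - (1 / 2 + 1 / 2 * x)) powr \<beta>))"
    unfolding set_integrable_def
    by (rule Bochner_Integration.integrable_cong[THEN iffD1, rotated -1]) (auto simp: indicator_def)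
  have J: "set_integrable lborel {-1<..<1} (\<lambda>x. 4 powr \<beta> * ((1 / 2 + 1 / 2 * x) powr \<beta> * (1 - (1 / 2 + 1 / 2 * x)) powr \<beta>))"
    by (rule set_integrable_subset[OF I]) auto
  have "4 powr \<beta> * ((1 / 2 + 1 / 2 * x) powr \<beta> * (1 - (1 / 2 + 1 / 2 * x)) powr \<beta>) = (1 - x\<^sup>2) powr \<beta>" if "x \<in> {-1<..<1}" for x
  proof -
    have "1 - x\<^sup>2 = 4 * ((1 / 2 + 1 / 2 * x) * (1 - (1 / 2 + 1 / 2 * x)))" by (simp add: field_simps power2_eq_square)
    thus ?thesis by (simp only: powr_mult)
  qed
  from iffD1[OF set_integrable_cong[OF refl refl this] J] show ?thesis .
qed

lemma continuous_on_legendre_P [continuous_intros]: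
  "continuous_on {-1<..<1} (legendre_P \<mu>)"
proof (rule continuous_at_imp_continuous_on, rule ballI)
  fix x :: real assume "x \<in> {-1<..<1}"
  thus "isCont (legendre_P \<mu>) x"
    by (intro has_vector_derivative_continuous[OF legendre_P_has_field_derivative]) auto
qed

lemma continuous_on_legendre_P_minus [continuous_intros]:
  "continuous_on {-1<..<1} (\<lambda>x. legendre_P \<mu> (- x))"
  by (rule continuous_on_compose2[OF continuous_on_legendre_P]) (auto intro!: continuous_intros)

lemma norm_of_real_powr:
  assumes "x > 0"
  shows "norm (complex_of_real x powr c) = x powr Re c"
  using assms by (subst norm_powr_real_powr) auto

lemma continuous_on_weight [continuous_intros]:
  "continuous_on {-1<..<1} (\<lambda>x. complex_of_real (1 - x\<^sup>2) powr c)"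
proof (rule continuous_on_powr_complex)
  show "{-1<..<1} \<subseteq> {x :: real. Re (complex_of_real (1 - x\<^sup>2)) \<ge> 0 \<or> Im (complex_of_real (1 - x\<^sup>2)) \<noteq> 0}"
    using one_minus_square_pos by (force simp: less_imp_le)
  show "Re c > 0" if "x \<in> {-1<..<1}" "complex_of_real (1 - x\<^sup>2) = 0" for x
    using one_minus_square_pos[OF that(1)] that(2) unfolding of_real_eq_0_iff by simp
qed (intro continuous_intros)+

text \<open>Together with the weight the integrand is of order (1 - x^2) to the power - \<delta> -
  (1 - Re \<nu>)/2, and the last hypothesis says that this exponent exceeds -1.\<close>

lemma weighted_set_integrable:
  fixes g :: "real \<Rightarrow> complex"
  assumes cont: "continuous_on {-1<..<1} g"
    and bound: "\<And>x. x \<in> {-1<..<1} \<Longrightarrow> norm (g x) \<le> C * (1 - x\<^sup>2) powr (- \<delta>)"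
    and \<delta>: "(Re \<nu> + 1) / 2 > \<delta>"
  shows "set_integrable lborel {-1<..<1} (\<lambda>x. g x / of_real (1 - x\<^sup>2) powr ((1 - \<nu>) / 2))"
proof (rule set_integrable_bound)
  have "set_integrable lborel {-1<..<1} (\<lambda>x. (1 - x\<^sup>2) powr (- \<delta> - (1 - Re \<nu>) / 2))"
    by (rule set_integrable_one_minus_square_powr) (use \<delta> in \<open>simp add: field_simps\<close>)
  thus "set_integrable lborel {-1<..<1} (\<lambda>x. C * (1 - x\<^sup>2) powr (- \<delta> - (1 - Re \<nu>) / 2))"
    by (rule set_integrable_mult_right)
  have nz: "complex_of_real (1 - x\<^sup>2) powr ((1 - \<nu>) / 2) \<noteq> 0" if "x \<in> {-1<..<1}" for x
    using one_minus_square_pos[OF that] by (auto simp: powr_def simp del: of_real_diff of_real_power)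
  show "set_borel_measurable lborel {-1<..<1} (\<lambda>x. g x / of_real (1 - x\<^sup>2) powr ((1 - \<nu>) / 2))"
    unfolding set_borel_measurable_def
    using borel_measurable_continuous_on_indicator[of "{-1<..<1}" "\<lambda>x. g x / of_real (1 - x\<^sup>2) powr ((1 - \<nu>) / 2)"]
      continuous_on_divide[OF cont continuous_on_weight] nz by simp
  show "AE x in lborel. x \<in> {-1<..<1} \<longrightarrow> norm (g x / of_real (1 - x\<^sup>2) powr ((1 - \<nu>) / 2)) \<le> norm (C * (1 - x\<^sup>2) powr (- \<delta> - (1 - Re \<nu>) / 2))"
  proof (intro AE_I2 impI)
    fix x :: real assume x: "x \<in> {-1<..<1}"
    have p: "1 - x\<^sup>2 > 0" by (rule one_minus_square_pos[OF x])
    have "norm (g x / of_real (1 - x\<^sup>2) powr ((1 - \<nu>) / 2)) = norm (g x) / (1 - x\<^sup>2) powr ((1 - Re \<nu>) / 2)"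
      unfolding norm_divide norm_of_real_powr[OF p] by simp
    also have "\<dots> \<le> C * (1 - x\<^sup>2) powr (- \<delta>) / (1 - x\<^sup>2) powr ((1 - Re \<nu>) / 2)"
      by (intro divide_right_mono bound x) auto
    also have "\<dots> = C * (1 - x\<^sup>2) powr (- \<delta> - (1 - Re \<nu>) / 2)"
      by (simp add: powr_diff)
    finally show "norm (g x / of_real (1 - x\<^sup>2) powr ((1 - \<nu>) / 2)) \<le> norm (C * (1 - x\<^sup>2) powr (- \<delta> - (1 - Re \<nu>) / 2))"
      by simp
  qed
qed

lemma norm_triple_le:
  fixes a b c :: complex
  assumes "norm a \<le> C * r powr (-\<epsilon>)" "norm b \<le> C * r powr (-\<epsilon>)" "norm c \<le> C * r powr (-\<epsilon>)"
  shows "norm (a * b * c) \<le> C ^ 3 * r powr (- (3 * \<epsilon>))"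
proof -
  have pos: "0 \<le> C * r powr (-\<epsilon>)" using assms(1) norm_ge_zero order.trans by blast
  have "norm (a * b * c) \<le> (C * r powr (-\<epsilon>)) * (C * r powr (-\<epsilon>)) * (C * r powr (-\<epsilon>))"
    unfolding norm_mult
    by (rule mult_mono[OF mult_mono[OF assms(1,2) pos norm_ge_zero] assms(3) mult_nonneg_nonneg[OF pos pos] norm_ge_zero])
  also have "\<dots> = C ^ 3 * (r powr (-\<epsilon>) * r powr (-\<epsilon>) * r powr (-\<epsilon>))" by (simp add: power3_eq_cube mult_ac)
  also have "r powr (-\<epsilon>) * r powr (-\<epsilon>) * r powr (-\<epsilon>) = r powr (- (3 * \<epsilon>))"
    unfolding powr_add[symmetric] by (rule arg_cong[where f = "\<lambda>t. r powr t"]) simp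
  finally show ?thesis .
qed

section \<open>The ladder system in x and the integrals of degree \<nu> + 1\<close>

definition legendre_pair_x :: "complex \<Rightarrow> (real \<Rightarrow> complex) \<Rightarrow> (real \<Rightarrow> complex) \<Rightarrow> bool" where
  "legendre_pair_x n u U \<longleftrightarrow> (\<forall>x\<in>{-1<..<1}.
     (u has_vector_derivative n * (of_real x * u x - U x) / of_real (1 - x\<^sup>2)) (at x) \<and>
     (U has_vector_derivative n * (u x - of_real x * U x) / of_real (1 - x\<^sup>2)) (at x))"

lemma legendre_pair_x_P:
  "legendre_pair_x (\<nu> + 1) (legendre_P \<nu>) (legendre_P (\<nu> + 1))"
  "legendre_pair_x (\<nu> + 1) (\<lambda>x. legendre_P \<nu> (- x)) (\<lambda>x. - legendre_P (\<nu> + 1) (- x))"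
proof -
  show "legendre_pair_x (\<nu> + 1) (legendre_P \<nu>) (legendre_P (\<nu> + 1))"
    using legendre_P_ladder by (auto simp: legendre_pair_x_def)
  show "legendre_pair_x (\<nu> + 1) (\<lambda>x. legendre_P \<nu> (- x)) (\<lambda>x. - legendre_P (\<nu> + 1) (- x))"
    unfolding legendre_pair_x_def
  proof (intro ballI conjI)
    fix x :: real assume x: "x \<in> {-1<..<1}"
    have m: "(uminus has_vector_derivative -1) (at x)"
      by (auto intro!: derivative_eq_intros simp flip: has_real_derivative_iff_has_vector_derivative)
    have x': "-1 < -x" "-x < 1" using x by auto
    note D = legendre_P_ladder[OF x', of \<nu>]
    show "((\<lambda>x. legendre_P \<nu> (- x)) has_vector_derivative (\<nu> + 1) * (of_real x * legendre_P \<nu> (- x) - - legendre_P (\<nu> + 1) (- x)) / of_real (1 - x\<^sup>2)) (at x)"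
      using vector_diff_chain_at[OF m D(1)] by (simp add: o_def minus_divide_left algebra_simps)
    show "((\<lambda>x. - legendre_P (\<nu> + 1) (- x)) has_vector_derivative (\<nu> + 1) * (legendre_P \<nu> (- x) - of_real x * - legendre_P (\<nu> + 1) (- x)) / of_real (1 - x\<^sup>2)) (at x)"
      using has_vector_derivative_minus[OF vector_diff_chain_at[OF m D(2)]] by (simp add: o_def)
  qed
qed

lemma has_vector_derivative_weight:
  assumes x: "x \<in> {-1<..<1}"
  shows "((\<lambda>x. complex_of_real (1 - x\<^sup>2) powr c) has_vector_derivative
           - (2 * c * of_real x) * (of_real (1 - x\<^sup>2) powr c / of_real (1 - x\<^sup>2))) (at x)"
proof -
  have p: "1 - x\<^sup>2 > 0" by (rule one_minus_square_pos[OF x])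
  have V: "((\<lambda>x. complex_of_real (1 - x\<^sup>2)) has_vector_derivative of_real (- 2 * x)) (at x)"
    by (intro has_vector_derivative_of_real) (auto intro!: derivative_eq_intros)
  have "((\<lambda>z. z powr c) has_field_derivative c * complex_of_real (1 - x\<^sup>2) powr (c - 1)) (at (complex_of_real (1 - x\<^sup>2)))"
    using p by (intro has_field_derivative_powr) (auto simp: complex_nonpos_Reals_iff simp del: of_real_diff of_real_power)
  from field_vector_diff_chain_at[unfolded o_def, OF V this] have "((\<lambda>x. complex_of_real (1 - x\<^sup>2) powr c) has_vector_derivative of_real (- 2 * x) * (c * of_real (1 - x\<^sup>2) powr (c - 1))) (at x)" .
  moreover have "complex_of_real (1 - x\<^sup>2) powr (c - 1) = of_real (1 - x\<^sup>2) powr c / of_real (1 - x\<^sup>2)"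
    using p by (simp add: powr_diff del: of_real_diff of_real_power)
  ultimately show ?thesis by (simp add: algebra_simps)
qed

text \<open>Three separate pairs are allowed so that one computation covers both P(x)^3 and P(x)^2
  P(-x). In the antiderivative the coefficient 2 of e3 cancels the terms with one u and two U, and
  the exponent n/2 cancels the terms of e1. Since n/2 - 1 = - (1 - \<nu>)/2, differentiation leaves
  exactly the given weight.\<close>

lemma legendre_ladder_integral:
  fixes \<nu> :: complex
  assumes \<nu>: "Re \<nu> > -1"
    and pairs: "legendre_pair_x (\<nu> + 1) u1 U1" "legendre_pair_x (\<nu> + 1) u2 U2" "legendre_pair_x (\<nu> + 1) u3 U3"
    and \<epsilon>: "0 < \<epsilon>" "3 * \<epsilon> < (Re \<nu> + 1) / 2"
    and bd: "\<And>x u. x \<in> {-1<..<1} \<Longrightarrow> u \<in> {u1, U1, u2, U2, u3, U3} \<Longrightarrow> norm (u x) \<le> C * (1 - x\<^sup>2) powr (- \<epsilon>)"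
  shows "8 * (LBINT x=-1..1. of_real x * (U1 x * U2 x * U3 x) / of_real (1 - x\<^sup>2) powr ((1 - \<nu>) / 2)) =
         3 * (LBINT x=-1..1. u1 x * u2 x * u3 x / of_real (1 - x\<^sup>2) powr ((1 - \<nu>) / 2))"
proof -
  define n where "n = \<nu> + 1"
  have n: "n \<noteq> 0" using \<nu> by (auto simp: n_def complex_eq_iff)
  define w where "w x = complex_of_real (1 - x\<^sup>2) powr ((1 - \<nu>) / 2)" for x :: real
  define p where "p x = complex_of_real (1 - x\<^sup>2)" for x :: real
  define e0 e1 e3 where "e0 x = u1 x * u2 x * u3 x" and "e1 x = U1 x * u2 x * u3 x + u1 x * U2 x * u3 x + u1 x * u2 x * U3 x"
    and "e3 x = U1 x * U2 x * U3 x" for x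
  \<comment> \<open>The ladder system gives \<Phi>' = n (3 e0 - 8 x e3) / w, and \<Phi> vanishes at both endpoints.\<close>
  define \<Phi> where "\<Phi> x = p x powr (n / 2) * (e1 x + 2 * e3 x)" for x
  have cont: "continuous_on {-1<..<1} u" if "u \<in> {u1, U1, u2, U2, u3, U3}" for u
  proof (rule continuous_at_imp_continuous_on, rule ballI)
    fix x :: real assume "x \<in> {-1<..<1}"
    thus "isCont u x" using that pairs unfolding legendre_pair_x_def
      by (auto intro: has_vector_derivative_continuous)
  qed
  have i0: "set_integrable lborel {-1<..<1} (\<lambda>x. e0 x / w x)"
    unfolding w_def e0_def
  proof (rule weighted_set_integrable[where C = "C ^ 3" and \<delta> = "3 * \<epsilon>"])
    show "continuous_on {-1<..<1} (\<lambda>x. u1 x * u2 x * u3 x)" by (intro continuous_intros cont) auto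
    show "norm (u1 x * u2 x * u3 x) \<le> C ^ 3 * (1 - x\<^sup>2) powr (- (3 * \<epsilon>))" if "x \<in> {-1<..<1}" for x
      by (intro norm_triple_le bd that) auto
  qed (use \<epsilon> in auto)
  have i3: "set_integrable lborel {-1<..<1} (\<lambda>x. of_real x * e3 x / w x)"
    unfolding w_def e3_def
  proof (rule weighted_set_integrable[where C = "C ^ 3" and \<delta> = "3 * \<epsilon>"])
    show "continuous_on {-1<..<1} (\<lambda>x. of_real x * (U1 x * U2 x * U3 x))" by (intro continuous_intros cont) auto
    fix x :: real assume x: "x \<in> {-1<..<1}"
    have "norm (of_real x * (U1 x * U2 x * U3 x)) \<le> 1 * norm (U1 x * U2 x * U3 x)"
      unfolding norm_mult[of "of_real x"] norm_of_real using x by (intro mult_right_mono) auto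
    also have "1 * norm (U1 x * U2 x * U3 x) \<le> C ^ 3 * (1 - x\<^sup>2) powr (- (3 * \<epsilon>))"
      unfolding mult_1 by (intro norm_triple_le bd x) auto
    finally show "norm (of_real x * (U1 x * U2 x * U3 x)) \<le> C ^ 3 * (1 - x\<^sup>2) powr (- (3 * \<epsilon>))" .
  qed (use \<epsilon> in auto)
  let ?f = "\<lambda>x. n * (3 * (e0 x / w x) - 8 * (of_real x * e3 x / w x))"
  have "(LBINT x=-1..1. ?f x) = 0 - 0"
  proof (rule interval_integral_FTC_integrable[where F = \<Phi>])
    show "(-1::ereal) < 1" by (simp add: one_ereal_def)
    have mem: "x \<in> {-1<..<1}" if "-1 < ereal x" "ereal x < 1" for x
      using that by (metis einterval_m1_1 einterval_iff)
    have nz: "w x \<noteq> 0" if "x \<in> {-1<..<1}" for x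
      using one_minus_square_pos[OF that] by (auto simp: w_def powr_def simp del: of_real_diff of_real_power)
    have contf: "continuous_on {-1<..<1} ?f"
    proof -
      have "continuous_on {-1<..<1} w" unfolding w_def by (rule continuous_on_weight)
      moreover have "continuous_on {-1<..<1} e0" "continuous_on {-1<..<1} e3"
        unfolding e0_def[abs_def] e3_def[abs_def] by (intro continuous_on_mult cont; simp)+
      ultimately show ?thesis using nz by (intro continuous_intros) auto
    qed
    show "isCont ?f x" if "-1 < ereal x" "ereal x < 1" for x
      using contf mem[OF that] by (simp add: continuous_on_eq_continuous_at)
    show "set_integrable lborel (einterval (-1) 1) ?f"
      unfolding einterval_m1_1 by (intro set_integrable_mult_right set_integral_diff(1) i0 i3)
    show "(\<Phi> has_vector_derivative ?f x) (at x)" if "-1 < ereal x" "ereal x < 1" for x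
    proof -
      have x: "x \<in> {-1<..<1}" by (rule mem[OF that])
      have p0: "p x \<noteq> 0" using one_minus_square_pos[OF x] by (auto simp: p_def simp del: of_real_diff of_real_power)
      have D: "(u1 has_vector_derivative n * (of_real x * u1 x - U1 x) / p x) (at x)" "(U1 has_vector_derivative n * (u1 x - of_real x * U1 x) / p x) (at x)"
           "(u2 has_vector_derivative n * (of_real x * u2 x - U2 x) / p x) (at x)" "(U2 has_vector_derivative n * (u2 x - of_real x * U2 x) / p x) (at x)"
           "(u3 has_vector_derivative n * (of_real x * u3 x - U3 x) / p x) (at x)" "(U3 has_vector_derivative n * (u3 x - of_real x * U3 x) / p x) (at x)"
        using pairs x by (auto simp: legendre_pair_x_def n_def p_def)
      have W: "((\<lambda>x. p x powr (n / 2)) has_vector_derivative - (n * of_real x) * (p x powr (n / 2) / p x)) (at x)"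
        using has_vector_derivative_weight[OF x, of "n / 2"] by (simp add: p_def)
      define P where "P = p x powr (n / 2)"
      have pw: "1 / w x = P / p x"
      proof -
        have "p x powr (n / 2) / p x = p x powr (n / 2 - 1)" using p0 by (simp add: powr_diff)
        also have "n / 2 - 1 = - ((1 - \<nu>) / 2)" by (simp add: n_def field_simps)
        also have "p x powr (- ((1 - \<nu>) / 2)) = 1 / w x" by (simp add: w_def p_def powr_minus_divide)
        finally show ?thesis by (simp add: P_def)
      qed
      note T = has_vector_derivative_mult[OF has_vector_derivative_mult]
      have "(\<Phi> has_vector_derivative (P * ((
          (U1 x * u2 x * (n * (of_real x * u3 x - U3 x) / p x) + (U1 x * (n * (of_real x * u2 x - U2 x) / p x) + (n * (u1 x - of_real x * U1 x) / p x) * u2 x) * u3 x)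
        + (u1 x * U2 x * (n * (of_real x * u3 x - U3 x) / p x) + (u1 x * (n * (u2 x - of_real x * U2 x) / p x) + (n * (of_real x * u1 x - U1 x) / p x) * U2 x) * u3 x)
        + (u1 x * u2 x * (n * (u3 x - of_real x * U3 x) / p x) + (u1 x * (n * (of_real x * u2 x - U2 x) / p x) + (n * (of_real x * u1 x - U1 x) / p x) * u2 x) * U3 x))
        + 2 * (U1 x * U2 x * (n * (u3 x - of_real x * U3 x) / p x) + (U1 x * (n * (u2 x - of_real x * U2 x) / p x) + (n * (u1 x - of_real x * U1 x) / p x) * U2 x) * U3 x))
        + (- (n * of_real x) * (P / p x)) * (e1 x + 2 * e3 x))) (at x)"
        unfolding \<Phi>_def[abs_def] e1_def e3_def P_def
        by (intro has_vector_derivative_mult[OF W] has_vector_derivative_add has_vector_derivative_mult_right T D)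
      also have "(P * ((
          (U1 x * u2 x * (n * (of_real x * u3 x - U3 x) / p x) + (U1 x * (n * (of_real x * u2 x - U2 x) / p x) + (n * (u1 x - of_real x * U1 x) / p x) * u2 x) * u3 x)
        + (u1 x * U2 x * (n * (of_real x * u3 x - U3 x) / p x) + (u1 x * (n * (u2 x - of_real x * U2 x) / p x) + (n * (of_real x * u1 x - U1 x) / p x) * U2 x) * u3 x)
        + (u1 x * u2 x * (n * (u3 x - of_real x * U3 x) / p x) + (u1 x * (n * (of_real x * u2 x - U2 x) / p x) + (n * (of_real x * u1 x - U1 x) / p x) * u2 x) * U3 x))
        + 2 * (U1 x * U2 x * (n * (u3 x - of_real x * U3 x) / p x) + (U1 x * (n * (u2 x - of_real x * U2 x) / p x) + (n * (u1 x - of_real x * U1 x) / p x) * U2 x) * U3 x))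
        + (- (n * of_real x) * (P / p x)) * (e1 x + 2 * e3 x)) = n * (P / p x) * (3 * e0 x - 8 * of_real x * e3 x)"
        unfolding e0_def e1_def e3_def using p0 by (simp add: divide_simps) (simp add: algebra_simps)
      also have "\<dots> = ?f x" unfolding pw[symmetric] by (simp add: algebra_simps)
      finally show ?thesis .
    qed
    \<comment> \<open>The order to which \<Phi> vanishes at the endpoints: the weight contributes
      (Re \<nu> + 1)/2 and the three factors cost 3 \<epsilon>.\<close>
    define \<kappa> where "\<kappa> = (Re \<nu> + 1) / 2 - 3 * \<epsilon>"
    have \<kappa>: "\<kappa> > 0" using \<epsilon> by (simp add: \<kappa>_def)
    have le: "norm (\<Phi> x) \<le> 5 * C ^ 3 * (1 - x\<^sup>2) powr \<kappa>" if x: "x \<in> {-1<..<1}" for x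
    proof -
      have q: "1 - x\<^sup>2 > 0" by (rule one_minus_square_pos[OF x])
      let ?R = "C ^ 3 * (1 - x\<^sup>2) powr (- (3 * \<epsilon>))"
      have N: "norm (U1 x * u2 x * u3 x) \<le> ?R" "norm (u1 x * U2 x * u3 x) \<le> ?R" "norm (u1 x * u2 x * U3 x) \<le> ?R" "norm (e3 x) \<le> ?R"
        unfolding e3_def by (intro norm_triple_le bd x; simp)+
      have "norm (e1 x + 2 * e3 x) \<le> norm (U1 x * u2 x * u3 x) + norm (u1 x * U2 x * u3 x) + norm (u1 x * u2 x * U3 x) + 2 * norm (e3 x)"
        unfolding e1_def by (rule order.trans[OF norm_triangle_ineq] add_mono order_refl)+ (simp add: norm_mult)
      also have "\<dots> \<le> 5 * ?R" using N by linarith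
      finally have "norm (\<Phi> x) \<le> (1 - x\<^sup>2) powr ((Re \<nu> + 1) / 2) * (5 * ?R)"
        unfolding \<Phi>_def norm_mult p_def norm_of_real_powr[OF q] by (intro mult_mono) (auto simp: n_def)
      also have "\<dots> = 5 * C ^ 3 * ((1 - x\<^sup>2) powr ((Re \<nu> + 1) / 2) * (1 - x\<^sup>2) powr (- (3 * \<epsilon>)))" by simp
      also have "(1 - x\<^sup>2) powr ((Re \<nu> + 1) / 2) * (1 - x\<^sup>2) powr (- (3 * \<epsilon>)) = (1 - x\<^sup>2) powr \<kappa>"
        unfolding powr_add[symmetric] \<kappa>_def by simp
      finally show ?thesis .
    qed
    have l1: "((\<lambda>x. 5 * C ^ 3 * (1 - x\<^sup>2) powr \<kappa>) \<longlongrightarrow> 0) (at_right (-1))" using \<kappa> by real_asymp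
    have l2: "((\<lambda>x. 5 * C ^ 3 * (1 - x\<^sup>2) powr \<kappa>) \<longlongrightarrow> 0) (at_left 1)" using \<kappa> by real_asymp
    have e1: "(-1::ereal) = ereal (-1)" "(1::ereal) = ereal 1" by (auto simp: one_ereal_def)
    show "((\<Phi> \<circ> real_of_ereal) \<longlongrightarrow> 0) (at_right (-1))"
      unfolding e1(1) ereal_tendsto_simps
    proof (rule Lim_null_comparison[OF _ l1])
      show "eventually (\<lambda>x. norm (\<Phi> x) \<le> 5 * C ^ 3 * (1 - x\<^sup>2) powr \<kappa>) (at_right (-1))"
        by (rule eventually_mono[OF eventually_at_right_real[of "-1" 1]]) (use le in auto)
    qed
    show "((\<Phi> \<circ> real_of_ereal) \<longlongrightarrow> 0) (at_left 1)"
      unfolding e1(2) ereal_tendsto_simps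
    proof (rule Lim_null_comparison[OF _ l2])
      show "eventually (\<lambda>x. norm (\<Phi> x) \<le> 5 * C ^ 3 * (1 - x\<^sup>2) powr \<kappa>) (at_left 1)"
        by (rule eventually_mono[OF eventually_at_left_real[of "-1" 1]]) (use le in auto)
    qed
  qed
  moreover have "(LBINT x=-1..1. ?f x) = n * (3 * (LBINT x=-1..1. e0 x / w x) - 8 * (LBINT x=-1..1. of_real x * e3 x / w x))"
    unfolding interval_integral_m1_1 set_integral_mult_right
    by (subst set_integral_diff(2)) (intro set_integrable_mult_right i0 i3, intro set_integrable_mult_right i0 i3, simp only: set_integral_mult_right)
  ultimately have "3 * (LBINT x=-1..1. e0 x / w x) = 8 * (LBINT x=-1..1. of_real x * e3 x / w x)"
    using n by simp
  thus ?thesis unfolding e0_def e3_def w_def by simp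
qed

section \<open>Analytic continuation in the degree\<close>

text \<open>Cauchy's inequality on discs of radius r/2 bounds the derivative by 2 B / r. Thus a
  bound on f alone controls its difference quotients.\<close>

lemma norm_diff_le_of_bounded_on_cball:
  fixes f :: "complex \<Rightarrow> complex"
  assumes f: "f holomorphic_on S" and r: "r > 0" "cball \<mu> r \<subseteq> S"
    and B: "\<And>z. z \<in> cball \<mu> r \<Longrightarrow> norm (f z) \<le> B" and z: "z \<in> ball \<mu> (r / 2)"
  shows "norm (f z - f \<mu>) \<le> 2 * B / r * norm (z - \<mu>)"
proof (rule field_differentiable_bound[where S = "ball \<mu> (r / 2)" and f' = "deriv f"])
  fix w assume w: "w \<in> ball \<mu> (r / 2)"
  have sub: "cball w (r / 2) \<subseteq> cball \<mu> r"
  proof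
    fix v assume "v \<in> cball w (r / 2)"
    thus "v \<in> cball \<mu> r" using w dist_triangle[of \<mu> v w] by simp
  qed
  have fw: "f holomorphic_on cball w (r / 2)" using f sub r by (meson holomorphic_on_subset order.trans)
  have "norm ((deriv ^^ 1) f w) \<le> fact 1 * B / (r / 2) ^ 1"
  proof (rule Cauchy_inequality)
    show "f holomorphic_on ball w (r / 2)" using fw ball_subset_cball by (rule holomorphic_on_subset)
    show "continuous_on (cball w (r / 2)) f" using fw by (rule holomorphic_on_imp_continuous_on)
    show "norm (f v) \<le> B" if "norm (w - v) = r / 2" for v
    proof (rule B)
      have "v \<in> cball w (r / 2)" using that by (simp add: dist_norm)
      thus "v \<in> cball \<mu> r" using sub by blast
    qed
  qed (use r in auto)
  thus "norm (deriv f w) \<le> 2 * B / r" by (simp add: mult.commute)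
  have "f holomorphic_on ball \<mu> (r / 2)"
  proof (rule holomorphic_on_subset[OF f], rule order.trans[OF _ r(2)])
    show "ball \<mu> (r / 2) \<subseteq> cball \<mu> r" by (rule order.trans[OF ball_subset_cball subset_cball]) (use r(1) in linarith)
  qed
  thus "(f has_field_derivative deriv f w) (at w within ball \<mu> (r / 2))"
    by (rule has_field_derivative_at_within[OF holomorphic_derivI[OF _ open_ball w]])
next
  show "\<mu> \<in> ball \<mu> (r / 2)" using r(1) by simp
qed (fact convex_ball, fact z)

text \<open>A local integrable bound on f also dominates the difference quotients in the parameter,
  by the preceding estimate. Dominated convergence along sequences then gives the derivative of the
  integral.\<close>

lemma holomorphic_on_set_integral:
  fixes f :: "complex \<Rightarrow> 'a \<Rightarrow> complex"
  assumes S: "open S" and A: "A \<in> sets M"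
    and hol: "\<And>x. x \<in> A \<Longrightarrow> (\<lambda>\<mu>. f \<mu> x) holomorphic_on S"
    and int: "\<And>\<mu>. \<mu> \<in> S \<Longrightarrow> set_integrable M A (f \<mu>)"
    and dom: "\<And>\<mu>. \<mu> \<in> S \<Longrightarrow> \<exists>r>0. \<exists>G. cball \<mu> r \<subseteq> S \<and> set_integrable M A G \<and> (\<forall>z\<in>cball \<mu> r. \<forall>x\<in>A. norm (f z x) \<le> (G x :: real))"
  shows "(\<lambda>\<mu>. LINT x:A|M. f \<mu> x) holomorphic_on S"
  unfolding holomorphic_on_open[OF S]
proof
  fix \<mu> assume \<mu>: "\<mu> \<in> S"
  from dom[OF \<mu>] obtain r G where r: "r > 0" "cball \<mu> r \<subseteq> S" and G: "set_integrable M A G"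
    and le: "\<And>z x. z \<in> cball \<mu> r \<Longrightarrow> x \<in> A \<Longrightarrow> norm (f z x) \<le> G x" by blast
  define q where "q z x = (f z x - f \<mu> x) / (z - \<mu>)" for z x
  define D where "D x = deriv (\<lambda>z. f z x) \<mu>" for x
  have lim: "((\<lambda>z. q z x) \<longlongrightarrow> D x) (at \<mu>)" if "x \<in> A" for x
    using holomorphic_derivI[OF hol[OF that] S \<mu>] by (simp add: has_field_derivative_iff q_def D_def)
  have bd: "norm (q z x) \<le> 2 / r * G x" if "z \<in> ball \<mu> (r / 2)" "x \<in> A" for z x
  proof (cases "z = \<mu>")
    case False
    thus ?thesis using norm_diff_le_of_bounded_on_cball[OF hol[OF that(2)] r le[OF _ that(2)] that(1)]
      by (simp add: q_def norm_divide divide_le_eq)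
  next
    \<comment> \<open>Here q is 0 through division by zero, and only G x >= 0 is left to
      check.\<close>
    case True
    have "0 \<le> G x" using le[OF _ that(2), of \<mu>] r norm_ge_zero order.trans by (metis centre_in_cball less_imp_le)
    thus ?thesis using True r by (simp add: q_def)
  qed
  have qint: "set_integrable M A (q z)" and qval: "(LINT x:A|M. q z x) = ((LINT x:A|M. f z x) - (LINT x:A|M. f \<mu> x)) / (z - \<mu>)" if "z \<in> S" for z
  proof -
    show "set_integrable M A (q z)" unfolding q_def by (intro set_integrable_divide set_integral_diff(1) int that \<mu>)
    show "(LINT x:A|M. q z x) = ((LINT x:A|M. f z x) - (LINT x:A|M. f \<mu> x)) / (z - \<mu>)"
      unfolding q_def set_integral_divide_zero by (simp only: set_integral_diff(2)[OF int[OF that] int[OF \<mu>]])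
  qed
  have "((\<lambda>\<mu>. LINT x:A|M. f \<mu> x) has_field_derivative (LINT x:A|M. D x)) (at \<mu>)"
    unfolding has_field_derivative_iff tendsto_at_iff_sequentially
  proof (intro allI impI)
    fix X :: "nat \<Rightarrow> complex" assume X: "\<forall>i. X i \<in> UNIV - {\<mu>}" "X \<longlonglongrightarrow> \<mu>"
    from X(2) r(1) have "eventually (\<lambda>i. X i \<in> ball \<mu> (r / 2)) sequentially"
      by (intro topological_tendstoD) auto
    then obtain k where k: "\<And>i. i \<ge> k \<Longrightarrow> X i \<in> ball \<mu> (r / 2)" by (auto simp: eventually_sequentially)
    define Y where "Y i = X (i + k)" for i
    have Y: "Y i \<in> ball \<mu> (r / 2)" "Y i \<noteq> \<mu>" for i using k X(1) by (auto simp: Y_def)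
    have YS: "Y i \<in> S" for i
    proof -
      have "Y i \<in> cball \<mu> r" using Y(1)[of i] r(1) by simp
      thus ?thesis using r(2) by blast
    qed
    have Yl: "Y \<longlonglongrightarrow> \<mu>" unfolding Y_def by (rule LIMSEQ_ignore_initial_segment[OF X(2)])
    have lim': "(\<lambda>i. indicator A x *\<^sub>R q (Y i) x) \<longlonglongrightarrow> indicator A x *\<^sub>R D x" for x
    proof (cases "x \<in> A")
      case True
      have "(\<lambda>i. q (Y i) x) \<longlonglongrightarrow> D x"
        using lim[OF True] Y(2) Yl unfolding tendsto_at_iff_sequentially o_def by auto
      thus ?thesis by (intro tendsto_intros)
    qed auto
    have "(\<lambda>i. LINT x:A|M. q (Y i) x) \<longlonglongrightarrow> (LINT x:A|M. D x)"
      unfolding set_lebesgue_integral_def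
    proof (rule integral_dominated_convergence)
      show m: "(\<lambda>x. indicator A x *\<^sub>R q (Y i) x) \<in> borel_measurable M" for i
        using qint[OF YS] unfolding set_integrable_def by (rule borel_measurable_integrable)
      show "(\<lambda>x. indicator A x *\<^sub>R D x) \<in> borel_measurable M"
        by (rule borel_measurable_LIMSEQ_metric[OF m lim'])
      show "integrable M (\<lambda>x. indicator A x *\<^sub>R (2 / r * G x))"
        using set_integrable_mult_right[OF G, of "2 / r"] by (simp add: set_integrable_def)
      show "AE x in M. norm (indicator A x *\<^sub>R q (Y i) x) \<le> indicator A x *\<^sub>R (2 / r * G x)" for i
        using bd[OF Y(1)] by (intro AE_I2) (auto simp: indicator_def)
    qed (use lim' in auto)
    hence "(\<lambda>i. ((LINT x:A|M. f (Y i) x) - (LINT x:A|M. f \<mu> x)) / (Y i - \<mu>)) \<longlonglongrightarrow> (LINT x:A|M. D x)"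
      by (simp only: qval[OF YS])
    thus "((\<lambda>z. ((LINT x:A|M. f z x) - (LINT x:A|M. f \<mu> x)) / (z - \<mu>)) \<circ> X) \<longlonglongrightarrow> (LINT x:A|M. D x)"
      unfolding Y_def o_def by (rule LIMSEQ_offset)
  qed
  thus "\<exists>f'. ((\<lambda>\<mu>. LINT x:A|M. f \<mu> x) has_field_derivative f') (at \<mu>)" by blast
qed

lemma holomorphic_on_legendre_P:
  assumes x: "x \<in> {-1<..<1}"
  shows "(\<lambda>\<mu>. legendre_P \<mu> x) holomorphic_on UNIV"
proof -
  define X where "X = (1 - x) / 2"
  have X: "0 < X" "X < 1" using x by (auto simp: X_def)
  let ?t = "\<lambda>n \<mu>. zb_coeff (-\<mu>) (\<mu> + 1) n * complex_of_real X ^ n"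
  have "(\<lambda>\<mu>. suminf (\<lambda>n. ?t n \<mu>)) holomorphic_on UNIV"
  proof (rule holomorphic_uniform_sequence)
    show "(\<lambda>\<mu>. \<Sum>i<n. ?t i \<mu>) holomorphic_on UNIV" for n
      unfolding zb_coeff_def by (auto intro!: holomorphic_intros simp: pochhammer_fact[symmetric])
    fix \<mu> :: complex
    define M where "M = (norm \<mu> + 1) * (norm \<mu> + 2)"
    have M0: "M \<ge> 0" by (simp add: M_def)
    have "uniform_limit (cball \<mu> 1) (\<lambda>n \<mu>. \<Sum>i<n. ?t i \<mu>) (\<lambda>\<mu>. suminf (\<lambda>n. ?t n \<mu>)) sequentially"
    proof (rule Weierstrass_m_test)
      fix n z assume z: "z \<in> cball \<mu> 1"
      have nz: "norm z \<le> norm \<mu> + 1" using z norm_triangle_ineq2[of z \<mu>] by (simp add: dist_norm norm_minus_commute)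
      have "norm (z * (z + 1)) \<le> M"
        unfolding norm_mult M_def by (intro mult_mono order.trans[OF norm_triangle_ineq]) (use nz in auto)
      hence "n \<ge> 1 \<Longrightarrow> norm (zb_coeff (-z) (z + 1) n) \<le> M * exp M / real n" by (rule zb_coeff_legendre_bound)
      moreover have "M * exp M / real n \<le> 1 + M * exp M" if "n \<ge> 1"
        using that M0 by (intro order.trans[OF divide_left_mono[of 1 "real n"]]) auto
      ultimately have "norm (zb_coeff (-z) (z + 1) n) \<le> 1 + M * exp M" if "n \<ge> 1"
        using that order.trans by blast
      moreover have "norm (zb_coeff (-z) (z + 1) 0) \<le> 1 + M * exp M" using M0 by simp
      ultimately have "norm (zb_coeff (-z) (z + 1) n) \<le> 1 + M * exp M"
        by (cases "n = 0") (simp_all add: Suc_le_eq)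
      thus "norm (?t n z) \<le> (1 + M * exp M) * X ^ n"
        using X unfolding norm_mult by (intro mult_mono) (auto simp: norm_power M0)
    qed (use X in \<open>auto intro!: summable_mult summable_geometric\<close>)
    thus "\<exists>d>0. cball \<mu> d \<subseteq> UNIV \<and> uniform_limit (cball \<mu> d) (\<lambda>n \<mu>. \<Sum>i<n. ?t i \<mu>) (\<lambda>\<mu>. suminf (\<lambda>n. ?t n \<mu>)) sequentially"
      by (intro exI[of _ 1]) auto
  qed auto
  also have "(\<lambda>\<mu>. suminf (\<lambda>n. ?t n \<mu>)) = (\<lambda>\<mu>. legendre_P \<mu> x)"
  proof
    fix \<mu> show "suminf (\<lambda>n. ?t n \<mu>) = legendre_P \<mu> x"
      using legendre_P_sums[of x \<mu>] x unfolding X_def by (auto simp: sums_iff)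
  qed
  finally show ?thesis .
qed

text \<open>The signs stand for reflections of the argument: (1, 1) and (1, -1) are the two
  integrands of degree \<nu> in the theorem, and changing both signs gives the integrand at
  -x.\<close>

definition legendre_triple :: "real \<Rightarrow> real \<Rightarrow> complex \<Rightarrow> real \<Rightarrow> complex" where
  "legendre_triple \<sigma> \<tau> \<nu> x = legendre_P \<nu> (\<sigma> * x) ^ 2 * legendre_P \<nu> (\<tau> * x) / of_real (1 - x\<^sup>2) powr ((1 - \<nu>) / 2)"

lemma continuous_on_legendre_P_sign:
  assumes "\<sigma> \<in> {1, -1}"
  shows "continuous_on {-1<..<1} (\<lambda>x. legendre_P \<mu> (\<sigma> * x))"
  using assms continuous_on_legendre_P[of \<mu>] continuous_on_legendre_P_minus[of \<mu>] by auto

lemma norm_legendre_triple_numerator_le: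
  assumes sg: "\<sigma> \<in> {1, -1}" "\<tau> \<in> {1, -1}" and x: "x \<in> {-1<..<1}"
    and bd: "\<And>x. x \<in> {-1<..<1} \<Longrightarrow> norm (legendre_P \<nu> x) \<le> C * (1 - x\<^sup>2) powr (- \<epsilon>)"
  shows "norm (legendre_P \<nu> (\<sigma> * x) ^ 2 * legendre_P \<nu> (\<tau> * x)) \<le> C ^ 3 * (1 - x\<^sup>2) powr (- (3 * \<epsilon>))"
proof -
  have "norm (legendre_P \<nu> (\<rho> * x)) \<le> C * (1 - x\<^sup>2) powr (- \<epsilon>)" if "\<rho> \<in> {1, -1}" for \<rho>
    using bd[of "\<rho> * x"] that x by auto
  thus ?thesis unfolding power2_eq_square using sg by (intro norm_triple_le) auto
qed

lemma set_integrable_legendre_triple: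
  assumes sg: "\<sigma> \<in> {1, -1}" "\<tau> \<in> {1, -1}" and \<nu>: "Re \<nu> > -1"
  shows "set_integrable lborel {-1<..<1} (legendre_triple \<sigma> \<tau> \<nu>)"
proof -
  \<comment> \<open>With this choice the three factors together use up half of the available
    exponent (Re \<nu> + 1)/2.\<close>
  define \<epsilon> where "\<epsilon> = (Re \<nu> + 1) / 12"
  have \<epsilon>: "\<epsilon> > 0" using \<nu> by (simp add: \<epsilon>_def)
  obtain C where C: "\<And>(\<mu> :: complex) x. norm (\<mu> * (\<mu> + 1)) \<le> norm (\<nu> * (\<nu> + 1)) \<Longrightarrow> x \<in> {-1<..<1} \<Longrightarrow> norm (legendre_P \<mu> x) \<le> C * (1 - x\<^sup>2) powr (- \<epsilon>)"
    using legendre_P_bound[OF \<epsilon>, of "norm (\<nu> * (\<nu> + 1))"] by (metis norm_ge_zero)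
  show ?thesis
    unfolding legendre_triple_def[abs_def]
  proof (rule weighted_set_integrable)
    show "continuous_on {-1<..<1} (\<lambda>x. legendre_P \<nu> (\<sigma> * x) ^ 2 * legendre_P \<nu> (\<tau> * x))"
      by (intro continuous_on_mult continuous_on_power continuous_on_legendre_P_sign sg)
    show "norm (legendre_P \<nu> (\<sigma> * x) ^ 2 * legendre_P \<nu> (\<tau> * x)) \<le> C ^ 3 * (1 - x\<^sup>2) powr (- (3 * \<epsilon>))" if "x \<in> {-1<..<1}" for x
      by (intro norm_legendre_triple_numerator_le sg that C order_refl)
  qed (use \<nu> in \<open>simp add: \<epsilon>_def\<close>)
qed

lemma holomorphic_on_integral_legendre_triple:
  assumes sg: "\<sigma> \<in> {1, -1}" "\<tau> \<in> {1, -1}"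
  shows "(\<lambda>\<nu>. LINT x:{-1<..<1}|lborel. legendre_triple \<sigma> \<tau> \<nu> x) holomorphic_on {\<nu>. Re \<nu> > -1}"
proof (rule holomorphic_on_set_integral)
  show "(\<lambda>\<nu>. legendre_triple \<sigma> \<tau> \<nu> x) holomorphic_on {\<nu>. Re \<nu> > -1}" if "x \<in> {-1<..<1}" for x
  proof -
    have p: "complex_of_real (1 - x\<^sup>2) \<noteq> 0" using one_minus_square_pos[OF that] unfolding of_real_eq_0_iff by simp
    have "(\<lambda>\<nu>. legendre_P \<nu> (\<rho> * x)) holomorphic_on {\<nu>. Re \<nu> > -1}" if "\<rho> \<in> {1, -1}" for \<rho>
      using holomorphic_on_subset[OF holomorphic_on_legendre_P[of "\<rho> * x"]] that \<open>x \<in> {-1<..<1}\<close> by force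
    thus ?thesis unfolding legendre_triple_def using sg p
      by (intro holomorphic_on_divide holomorphic_on_mult holomorphic_on_power holomorphic_on_powr_right holomorphic_intros)
         (auto simp: powr_def simp del: of_real_diff of_real_power)
  qed
  fix \<mu> assume "\<mu> \<in> {\<nu>. Re \<nu> > -1}"
  define s where "s = Re \<mu> + 1"
  have s: "s > 0" using \<open>\<mu> \<in> _\<close> by (simp add: s_def)
  \<comment> \<open>On the disc of radius s/2 one has Re z + 1 >= s/2, so - 3 \<epsilon> - (1 - Re
    z)/2 >= - s/8 + s/4 - 1 = s/8 - 1, which is still an integrable exponent.\<close>
  define \<epsilon> where "\<epsilon> = s / 24"
  have \<epsilon>: "\<epsilon> > 0" using s by (simp add: \<epsilon>_def)
  define M where "M = (norm \<mu> + s / 2) * (norm \<mu> + s / 2 + 1)"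
  have M: "M \<ge> 0" using s by (auto simp: M_def intro!: mult_nonneg_nonneg add_nonneg_nonneg)
  obtain C where C0: "C > 0" and C: "\<And>(\<mu> :: complex) x. norm (\<mu> * (\<mu> + 1)) \<le> M \<Longrightarrow> x \<in> {-1<..<1} \<Longrightarrow> norm (legendre_P \<mu> x) \<le> C * (1 - x\<^sup>2) powr (- \<epsilon>)"
    using legendre_P_bound[OF \<epsilon> M] by metis
  show "\<exists>r>0. \<exists>G. cball \<mu> r \<subseteq> {\<nu>. Re \<nu> > -1} \<and> set_integrable lborel {-1<..<1} G \<and> (\<forall>z\<in>cball \<mu> r. \<forall>x\<in>{-1<..<1}. norm (legendre_triple \<sigma> \<tau> z x) \<le> G x)"
  proof (intro exI conjI ballI)
    show "s / 2 > 0" using s by simp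
    have Rez: "Re z + 1 \<ge> s / 2" if "z \<in> cball \<mu> (s / 2)" for z
      using that abs_Re_le_cmod[of "\<mu> - z"] by (simp add: dist_norm s_def)
    show "cball \<mu> (s / 2) \<subseteq> {\<nu>. Re \<nu> > -1}" using Rez s by force
    show "set_integrable lborel {-1<..<1} (\<lambda>x. C ^ 3 * (1 - x\<^sup>2) powr (s / 8 - 1))"
      by (intro set_integrable_mult_right set_integrable_one_minus_square_powr) (use s in auto)
    fix z x assume z: "z \<in> cball \<mu> (s / 2)" and x: "x \<in> {-1<..<1 :: real}"
    have p: "0 < 1 - x\<^sup>2" "1 - x\<^sup>2 \<le> 1" using one_minus_square_pos[OF x] by auto
    have "norm z \<le> norm \<mu> + s / 2" using z norm_triangle_ineq2[of z \<mu>] by (simp add: dist_norm norm_minus_commute)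
    hence "norm (z * (z + 1)) \<le> M"
      unfolding norm_mult M_def using s by (intro mult_mono order.trans[OF norm_triangle_ineq]) auto
    note N = norm_legendre_triple_numerator_le[OF sg x C[OF this]]
    have "norm (legendre_triple \<sigma> \<tau> z x) = norm (legendre_P z (\<sigma> * x) ^ 2 * legendre_P z (\<tau> * x)) / (1 - x\<^sup>2) powr ((1 - Re z) / 2)"
      unfolding legendre_triple_def norm_divide norm_of_real_powr[OF p(1)] by simp
    also have "\<dots> \<le> C ^ 3 * (1 - x\<^sup>2) powr (- (3 * \<epsilon>)) / (1 - x\<^sup>2) powr ((1 - Re z) / 2)"
      by (intro divide_right_mono N) auto
    also have "\<dots> = C ^ 3 * (1 - x\<^sup>2) powr (- (3 * \<epsilon>) - (1 - Re z) / 2)" by (simp add: powr_diff)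
    also have "\<dots> \<le> C ^ 3 * (1 - x\<^sup>2) powr (s / 8 - 1)"
      using C0 Rez[OF z] p by (intro mult_left_mono powr_mono') (auto simp: \<epsilon>_def field_simps)
    finally show "norm (legendre_triple \<sigma> \<tau> z x) \<le> C ^ 3 * (1 - x\<^sup>2) powr (s / 8 - 1)" .
  qed
qed (use set_integrable_legendre_triple[OF sg] in \<open>auto simp: open_halfspace_Re_gt\<close>)

text \<open>The substitution x = - cos \<theta> is used because it is increasing, as the
  substitution rule wants a nonnegative derivative; the reflected integrand f makes up for the sign.
  The Jacobian sin \<theta> divided by (1 - x^2)^((1 - \<nu>)/2) = sin^(1-\<nu>) \<theta> leaves
  sin^\<nu> \<theta>.\<close>

lemma integral_legendre_triple_theta:
  fixes \<nu> :: real
  defines "h \<equiv> \<lambda>\<tau> \<theta>. legendre_P \<nu> (cos \<theta>) * legendre_P \<nu> (cos \<theta>) * legendre_P \<nu> (\<tau> * cos \<theta>) * of_real (sin \<theta> powr \<nu>)"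
  assumes \<nu>: "\<nu> > -1" and \<tau>: "\<tau> \<in> {1, -1}" and int: "h \<tau> absolutely_integrable_on {0..pi}"
  shows "(LINT x:{-1<..<1}|lborel. legendre_triple 1 \<tau> (of_real \<nu>) x) = integral {0..pi} (h \<tau>)"
proof -
  define f where "f = legendre_triple (-1) (-\<tau>) (of_real \<nu>)"
  have f: "f (-x) = legendre_triple 1 \<tau> (of_real \<nu>) x" for x
    by (simp add: f_def legendre_triple_def)
  have cos_mem: "cos \<theta> \<in> {-1<..<1}" if "\<theta> \<in> {0<..<pi}" for \<theta>
    using that cos_monotone_0_pi[of 0 \<theta>] cos_monotone_0_pi[of \<theta> pi] by auto
  have nz: "complex_of_real (1 - x\<^sup>2) powr c \<noteq> 0" if "x \<in> {-1<..<1}" for x c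
    using one_minus_square_pos[OF that] by (auto simp: powr_def simp del: of_real_diff of_real_power)
  have contf: "continuous_on {-1<..<1} f"
    unfolding f_def legendre_triple_def[abs_def]
    by (intro continuous_on_divide continuous_on_weight continuous_on_mult continuous_on_power continuous_on_legendre_P_sign ballI nz)
       (use \<tau> in auto)
  have conth: "continuous_on {0<..<pi} (h \<tau>)"
  proof -
    have "continuous_on {0<..<pi} (\<lambda>\<theta>. legendre_P \<nu> (\<rho> * cos \<theta>))" if "\<rho> \<in> {1, -1}" for \<rho>
      by (rule continuous_on_compose2[OF continuous_on_legendre_P_sign[OF that] continuous_on_cos[OF continuous_on_id]]) (use cos_mem in auto)
    from this[of 1] this[OF \<tau>] show ?thesis unfolding h_def
      by (intro continuous_on_mult continuous_on_of_real continuous_on_powr continuous_on_sin continuous_on_id continuous_on_const)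
         (auto simp: less_imp_neq[OF sin_gt_zero, symmetric])
  qed
  have subst: "sin \<theta> *\<^sub>R f (- cos \<theta>) = h \<tau> \<theta>" if "\<theta> \<in> {0<..<pi}" for \<theta>
  proof -
    have s: "sin \<theta> > 0" using that by (intro sin_gt_zero) auto
    have "1 - (cos \<theta>)\<^sup>2 = sin \<theta> powr 2" using s by (simp add: sin_squared_eq)
    from arg_cong[OF this, of "\<lambda>y. y powr ((1 - \<nu>) / 2)"] have "(1 - (cos \<theta>)\<^sup>2) powr ((1 - \<nu>) / 2) = sin \<theta> powr (2 * ((1 - \<nu>) / 2))" by (simp only: powr_powr)
    also have "2 * ((1 - \<nu>) / 2) = 1 - \<nu>" by simp
    finally have w: "(1 - (cos \<theta>)\<^sup>2) powr ((1 - \<nu>) / 2) = sin \<theta> powr (1 - \<nu>)" .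
    have e: "(1 - complex_of_real \<nu>) / 2 = of_real ((1 - \<nu>) / 2)" by simp
    have "complex_of_real (1 - (cos \<theta>)\<^sup>2) powr ((1 - complex_of_real \<nu>) / 2) = of_real ((1 - (cos \<theta>)\<^sup>2) powr ((1 - \<nu>) / 2))"
      unfolding e by (rule powr_of_real) (simp add: abs_square_le_1)
    also have "\<dots> = of_real (sin \<theta> powr (1 - \<nu>))" unfolding w ..
    finally have W: "complex_of_real (1 - (cos \<theta>)\<^sup>2) powr ((1 - complex_of_real \<nu>) / 2) = of_real (sin \<theta> powr (1 - \<nu>))" .
    have "sin \<theta> / sin \<theta> powr (1 - \<nu>) = sin \<theta> powr \<nu>" using s by (simp add: powr_diff field_simps)
    hence "complex_of_real (sin \<theta>) / of_real (sin \<theta> powr (1 - \<nu>)) = of_real (sin \<theta> powr \<nu>)" by (metis of_real_divide)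
    moreover have "sin \<theta> *\<^sub>R f (- cos \<theta>) = legendre_P \<nu> (cos \<theta>) ^ 2 * legendre_P \<nu> (\<tau> * cos \<theta>) * (complex_of_real (sin \<theta>) / of_real (sin \<theta> powr (1 - \<nu>)))"
      unfolding f legendre_triple_def W by (simp add: scaleR_conv_of_real)
    ultimately show ?thesis by (simp add: h_def power2_eq_square)
  qed
  have "set_integrable lebesgue {0<..<pi} (h \<tau>)"
    by (rule set_integrable_subset[OF int]) auto
  hence hint: "set_integrable lborel {0<..<pi} (h \<tau>)"
    unfolding set_integrable_def
    using borel_measurable_continuous_on_indicator[OF _ conth] by (subst (asm) integrable_completion) auto
  have e1: "(-1::ereal) = ereal (-1)" "(1::ereal) = ereal 1" by (auto simp: one_ereal_def)
  have "(LINT x:{-1<..<1}|lborel. legendre_triple 1 \<tau> (of_real \<nu>) x) = (LBINT x=-1..1. f (- x))"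
    by (simp only: interval_integral_m1_1 f)
  also have "\<dots> = (LBINT x=-1..1. f x)"
    using interval_integral_reflect[of "-1" 1 f] by simp
  also have "\<dots> = (LBINT \<theta>=ereal 0..ereal pi. sin \<theta> *\<^sub>R f (- cos \<theta>))"
  proof (rule interval_integral_substitution_integrable)
    fix \<theta> assume \<theta>: "ereal 0 < ereal \<theta>" "ereal \<theta> < ereal pi"
    show "((\<lambda>\<theta>. - cos \<theta>) has_real_derivative sin \<theta>) (at \<theta>)" by (auto intro!: derivative_eq_intros)
    have "- cos \<theta> \<in> {-1<..<1}" using cos_mem[of \<theta>] \<theta> by auto
    thus "isCont f (- cos \<theta>)" using contf by (simp add: continuous_on_eq_continuous_at)
    show "isCont sin \<theta>" by simp
  next
    show "0 \<le> sin \<theta>" if "ereal 0 \<le> ereal \<theta>" "ereal \<theta> \<le> ereal pi" for \<theta> using that by (simp add: sin_ge_zero)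
    have "((\<lambda>\<theta>. - cos \<theta> :: real) \<longlongrightarrow> -1) (at_right 0)" by (auto intro!: tendsto_eq_intros)
    thus "((ereal \<circ> (\<lambda>\<theta>. - cos \<theta>) \<circ> real_of_ereal) \<longlongrightarrow> -1) (at_right (ereal 0))"
      unfolding e1(1) by (simp only: ereal_tendsto_simps)
    have "((\<lambda>\<theta>. - cos \<theta> :: real) \<longlongrightarrow> 1) (at_left pi)" by (auto intro!: tendsto_eq_intros)
    thus "((ereal \<circ> (\<lambda>\<theta>. - cos \<theta>) \<circ> real_of_ereal) \<longlongrightarrow> 1) (at_left (ereal pi))"
      unfolding e1(2) by (simp only: ereal_tendsto_simps)
    have "set_integrable lborel {0<..<pi} (\<lambda>\<theta>. sin \<theta> *\<^sub>R f (- cos \<theta>))"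
      by (rule iffD1[OF set_integrable_cong[OF refl refl subst[symmetric]] hint])
    thus "set_integrable lborel (einterval (ereal 0) (ereal pi)) (\<lambda>\<theta>. sin \<theta> *\<^sub>R f (- cos \<theta>))"
      unfolding einterval_eq_Icc .
    show "set_integrable lborel (einterval (-1) 1) (\<lambda>x. f x)"
      unfolding einterval_m1_1 f_def by (rule set_integrable_legendre_triple) (use \<tau> \<nu> in auto)
  qed simp
  also have "\<dots> = (LINT \<theta>:{0<..<pi}|lborel. sin \<theta> *\<^sub>R f (- cos \<theta>))"
    by (simp add: interval_lebesgue_integral_def)
  also have "\<dots> = (LINT \<theta>:{0<..<pi}|lborel. h \<tau> \<theta>)"
    by (rule set_lebesgue_integral_cong) (use subst in auto)
  also have "\<dots> = integral {0<..<pi} (h \<tau>)" by (rule set_borel_integral_eq_integral(2)[OF hint])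
  also have "\<dots> = integral {0..pi} (h \<tau>)" using integral_open_interval_real[of 0 pi "h \<tau>"] by simp
  finally show ?thesis .
qed

section \<open>Continuation from the interval (0, 1/2) to the half-plane\<close>

lemma holomorphic_identity_right_half_plane:
  assumes f: "f holomorphic_on {\<nu>. Re \<nu> > -1}" and 0: "\<And>\<nu>. 0 < \<nu> \<Longrightarrow> \<nu> < 1 / 2 \<Longrightarrow> f (complex_of_real \<nu>) = 0"
    and w: "Re w > -1"
  shows "f w = 0"
proof (rule analytic_continuation[OF f, where U = "complex_of_real ` {0<..<1/2}" and \<xi> = "of_real (1 / 4)"])
  show "connected {\<nu>. Re \<nu> > -1}" by (intro convex_connected convex_halfspace_Re_gt)
  show "complex_of_real (1 / 4) islimpt complex_of_real ` {0<..<1/2}"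
    unfolding islimpt_approachable
  proof (intro allI impI)
    fix e :: real assume e: "e > 0"
    define t where "t = 1 / 4 + min (e / 2) (1 / 8)"
    have t: "t \<in> {0<..<1/2}" "t \<noteq> 1 / 4" "dist t (1 / 4) < e" using e by (auto simp: t_def dist_real_def)
    have "dist (complex_of_real t) (of_real (1 / 4)) = dist t (1 / 4)" by (rule dist_of_real)
    thus "\<exists>x'\<in>complex_of_real ` {0<..<1/2}. x' \<noteq> of_real (1 / 4) \<and> dist x' (of_real (1 / 4)) < e"
      using t by (intro bexI[of _ "of_real t"]) (auto simp del: of_real_divide)
  qed
qed (use 0 w in \<open>auto simp: open_halfspace_Re_gt\<close>)

lemma legendre_triple_ratio:
  assumes "Re \<nu> > -1"
  shows "(LINT x:{-1<..<1}|lborel. legendre_triple 1 1 \<nu> x) =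
           (3 - 2 * cos (\<nu> * of_real pi)) * (LINT x:{-1<..<1}|lborel. legendre_triple 1 (-1) \<nu> x)"
proof -
  let ?f = "\<lambda>\<nu>. (LINT x:{-1<..<1}|lborel. legendre_triple 1 1 \<nu> x) -
           (3 - 2 * cos (\<nu> * of_real pi)) * (LINT x:{-1<..<1}|lborel. legendre_triple 1 (-1) \<nu> x)"
  have "?f \<nu> = 0"
  proof (rule holomorphic_identity_right_half_plane[of ?f, OF _ _ assms])
    show "?f holomorphic_on {\<nu>. Re \<nu> > -1}"
      by (intro holomorphic_on_diff holomorphic_on_mult holomorphic_on_integral_legendre_triple holomorphic_on_cos' holomorphic_on_const holomorphic_on_ident) auto
    fix t :: real assume t: "0 < t" "t < 1 / 2"
    have "cos (complex_of_real t * of_real pi) = of_real (cos (t * pi))" by (metis cos_of_real of_real_mult)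
    thus "?f (of_real t) = 0"
      using legendre_triple_theta[OF t] integral_legendre_triple_theta[of t 1] integral_legendre_triple_theta[of t "-1"] t by simp
  qed
  thus ?thesis by simp
qed

lemma legendre_triple_value:
  assumes "Re \<nu> > -1"
  shows "(LINT x:{-1<..<1}|lborel. legendre_triple 1 (-1) \<nu> x) =
           1 / of_real pi * (cos (\<nu> * of_real pi / 2) / 2 powr \<nu>) ^ 3 * (Gamma ((1 + \<nu>) / 2) / Gamma (1 + \<nu> / 2)) ^ 4"
    (is "?L \<nu> = ?R \<nu>")
proof -
  have "?L \<nu> - ?R \<nu> = 0"
  proof (rule holomorphic_identity_right_half_plane[of "\<lambda>\<nu>. ?L \<nu> - ?R \<nu>", OF _ _ assms])
    have "(1 + z) / 2 \<notin> \<int>\<^sub>\<le>\<^sub>0" "1 + z / 2 \<notin> \<int>\<^sub>\<le>\<^sub>0" if "Re z > -1" for z :: complex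
      using that by (intro Re_pos_not_nonpos_Int; simp)+
    thus "(\<lambda>\<nu>. ?L \<nu> - ?R \<nu>) holomorphic_on {\<nu>. Re \<nu> > -1}"
      by (intro holomorphic_on_diff holomorphic_on_mult holomorphic_on_power holomorphic_on_divide holomorphic_on_add
            holomorphic_on_integral_legendre_triple holomorphic_on_powr_right holomorphic_Gamma' holomorphic_on_cos'
            holomorphic_on_const holomorphic_on_ident)
         (auto simp: Gamma_eq_zero_iff)
    fix t :: real assume t: "0 < t" "t < 1 / 2"
    have "cos (complex_of_real t * of_real pi / 2) = of_real (cos (t * pi / 2))"
      by (metis cos_of_real of_real_mult of_real_divide of_real_numeral)
    moreover have "2 powr complex_of_real t = of_real (2 powr t)" using powr_of_real[of 2 t] by simp
    moreover have "Gamma ((1 + complex_of_real t) / 2) = of_real (Gamma ((1 + t) / 2))"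
      using Gamma_complex_of_real[of "(1 + t) / 2"] by simp
    moreover have "Gamma (1 + complex_of_real t / 2) = of_real (Gamma (1 + t / 2))"
      using Gamma_complex_of_real[of "1 + t / 2"] by simp
    ultimately show "?L (of_real t) - ?R (of_real t) = 0"
      using legendre_triple_theta(2)[OF t] legendre_triple_theta_value[OF t] integral_legendre_triple_theta[of t "-1"] t by simp
  qed
  thus ?thesis by simp
qed

text \<open>The solution pair at -x has the second component - P_(\<nu>+1)(-x). This minus sign
  turns 3 - 2 cos(\<nu> pi) into 2 cos(\<nu> pi) - 3 in the second chain of identities.\<close>

lemma legendre_triple_ladder:
  assumes \<nu>: "Re \<nu> > -1"
  shows "set_integrable lborel {-1<..<1} (\<lambda>x. of_real x * legendre_P (\<nu> + 1) x ^ 3 / of_real (1 - x\<^sup>2) powr ((1 - \<nu>) / 2))" (is ?A)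
    and "set_integrable lborel {-1<..<1} (\<lambda>x. of_real x * legendre_P (\<nu> + 1) x ^ 2 * legendre_P (\<nu> + 1) (- x) / of_real (1 - x\<^sup>2) powr ((1 - \<nu>) / 2))" (is ?B)
    and "(LINT x:{-1<..<1}|lborel. of_real x * legendre_P (\<nu> + 1) x ^ 3 / of_real (1 - x\<^sup>2) powr ((1 - \<nu>) / 2)) =
           3 / 8 * (LINT x:{-1<..<1}|lborel. legendre_triple 1 1 \<nu> x)" (is ?C)
    and "(LINT x:{-1<..<1}|lborel. of_real x * legendre_P (\<nu> + 1) x ^ 2 * legendre_P (\<nu> + 1) (- x) / of_real (1 - x\<^sup>2) powr ((1 - \<nu>) / 2)) =
           - (3 / 8) * (LINT x:{-1<..<1}|lborel. legendre_triple 1 (-1) \<nu> x)" (is ?D)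
proof -
  define \<epsilon> where "\<epsilon> = (Re \<nu> + 1) / 12"
  have \<epsilon>: "0 < \<epsilon>" "3 * \<epsilon> < (Re \<nu> + 1) / 2" using \<nu> by (auto simp: \<epsilon>_def)
  define M where "M = max (norm (\<nu> * (\<nu> + 1))) (norm ((\<nu> + 1) * (\<nu> + 1 + 1)))"
  have "M \<ge> 0" unfolding M_def by (rule max.coboundedI1) simp
  from legendre_P_bound[OF \<epsilon>(1) this] obtain C where C: "\<And>(\<mu> :: complex) x. norm (\<mu> * (\<mu> + 1)) \<le> M \<Longrightarrow> x \<in> {-1<..<1} \<Longrightarrow> norm (legendre_P \<mu> x) \<le> C * (1 - x\<^sup>2) powr (- \<epsilon>)"
    by metis
  have C1: "norm (legendre_P \<mu> x) \<le> C * (1 - x\<^sup>2) powr (- \<epsilon>)" "norm (legendre_P \<mu> (- x)) \<le> C * (1 - x\<^sup>2) powr (- \<epsilon>)"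
    if "\<mu> \<in> {\<nu>, \<nu> + 1}" "x \<in> {-1<..<1}" for \<mu> x
  proof -
    have "norm (\<mu> * (\<mu> + 1)) \<le> M" using that(1) by (auto simp: M_def)
    from C[OF this, of x] C[OF this, of "-x"] that(2)
    show "norm (legendre_P \<mu> x) \<le> C * (1 - x\<^sup>2) powr (- \<epsilon>)" "norm (legendre_P \<mu> (- x)) \<le> C * (1 - x\<^sup>2) powr (- \<epsilon>)" by auto
  qed
  have int: "set_integrable lborel {-1<..<1} (\<lambda>x. of_real x * (legendre_P (\<nu> + 1) x ^ 2 * legendre_P (\<nu> + 1) (\<tau> * x)) / of_real (1 - x\<^sup>2) powr ((1 - \<nu>) / 2))"
    if \<tau>: "\<tau> \<in> {1, -1}" for \<tau>
  proof (rule weighted_set_integrable)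
    show "continuous_on {-1<..<1} (\<lambda>x. of_real x * (legendre_P (\<nu> + 1) x ^ 2 * legendre_P (\<nu> + 1) (\<tau> * x)))"
      by (intro continuous_on_mult continuous_on_power continuous_on_legendre_P_sign \<tau> continuous_on_legendre_P continuous_on_of_real continuous_on_id)
    fix x :: real assume x: "x \<in> {-1<..<1}"
    have "norm (legendre_P (\<nu> + 1) (1 * x) ^ 2 * legendre_P (\<nu> + 1) (\<tau> * x)) \<le> C ^ 3 * (1 - x\<^sup>2) powr (- (3 * \<epsilon>))"
      by (rule norm_legendre_triple_numerator_le) (use C1 \<tau> x in auto)
    moreover have "norm (of_real x * z) \<le> 1 * norm z" for z :: complex
      unfolding norm_mult norm_of_real using x by (intro mult_right_mono) auto
    ultimately show "norm (of_real x * (legendre_P (\<nu> + 1) x ^ 2 * legendre_P (\<nu> + 1) (\<tau> * x))) \<le> C ^ 3 * (1 - x\<^sup>2) powr (- (3 * \<epsilon>))"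
      by (metis mult_1 order.trans)
  qed (use \<epsilon> in auto)
  from int[of 1] int[of "-1"] show ?A ?B by (simp_all add: power3_eq_cube power2_eq_square mult.assoc)
  have scale: "8 * a = 3 * b \<Longrightarrow> a = 3 / 8 * b" "8 * - a = 3 * b \<Longrightarrow> a = - (3 / 8) * b" for a b :: complex
  proof -
    assume "8 * a = 3 * b"
    moreover have "a = 8 * a / 8" by simp
    ultimately show "a = 3 / 8 * b" by simp
  next
    assume "8 * - a = 3 * b"
    moreover have "a = - (8 * - a / 8)" by simp
    ultimately show "a = - (3 / 8) * b" by simp
  qed
  note L = legendre_ladder_integral[OF \<nu> legendre_pair_x_P(1) legendre_pair_x_P(1) _ \<epsilon>, unfolded interval_integral_m1_1]
  have "8 * (LINT x:{-1<..<1}|lborel. of_real x * (legendre_P (\<nu> + 1) x * legendre_P (\<nu> + 1) x * legendre_P (\<nu> + 1) x) / of_real (1 - x\<^sup>2) powr ((1 - \<nu>) / 2)) =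
        3 * (LINT x:{-1<..<1}|lborel. legendre_P \<nu> x * legendre_P \<nu> x * legendre_P \<nu> x / of_real (1 - x\<^sup>2) powr ((1 - \<nu>) / 2))"
    by (rule L[OF legendre_pair_x_P(1)]) (use C1 in auto)
  hence "8 * (LINT x:{-1<..<1}|lborel. of_real x * legendre_P (\<nu> + 1) x ^ 3 / of_real (1 - x\<^sup>2) powr ((1 - \<nu>) / 2)) =
      3 * (LINT x:{-1<..<1}|lborel. legendre_triple 1 1 \<nu> x)"
    by (simp only: legendre_triple_def power3_eq_cube power2_eq_square mult_1)
  thus ?C by (rule scale(1))
  have "8 * (LINT x:{-1<..<1}|lborel. of_real x * (legendre_P (\<nu> + 1) x * legendre_P (\<nu> + 1) x * (- legendre_P (\<nu> + 1) (- x))) / of_real (1 - x\<^sup>2) powr ((1 - \<nu>) / 2)) =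
        3 * (LINT x:{-1<..<1}|lborel. legendre_P \<nu> x * legendre_P \<nu> x * legendre_P \<nu> (- x) / of_real (1 - x\<^sup>2) powr ((1 - \<nu>) / 2))"
    by (rule L[OF legendre_pair_x_P(2)]) (use C1 in auto)
  moreover have "(LINT x:{-1<..<1}|lborel. of_real x * (legendre_P (\<nu> + 1) x * legendre_P (\<nu> + 1) x * (- legendre_P (\<nu> + 1) (- x))) / of_real (1 - x\<^sup>2) powr ((1 - \<nu>) / 2)) =
      - (LINT x:{-1<..<1}|lborel. of_real x * legendre_P (\<nu> + 1) x ^ 2 * legendre_P (\<nu> + 1) (- x) / of_real (1 - x\<^sup>2) powr ((1 - \<nu>) / 2))"
    using set_integral_mult_right[of lborel "{-1<..<1}" "-1" "\<lambda>x. of_real x * legendre_P (\<nu> + 1) x ^ 2 * legendre_P (\<nu> + 1) (- x) / of_real (1 - x\<^sup>2) powr ((1 - \<nu>) / 2)"]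
    by (simp add: power2_eq_square mult.assoc)
  moreover have "(LINT x:{-1<..<1}|lborel. legendre_P \<nu> x * legendre_P \<nu> x * legendre_P \<nu> (- x) / of_real (1 - x\<^sup>2) powr ((1 - \<nu>) / 2)) =
      (LINT x:{-1<..<1}|lborel. legendre_triple 1 (-1) \<nu> x)"
    by (simp only: legendre_triple_def power2_eq_square mult_1 mult_minus1)
  ultimately have "8 * - (LINT x:{-1<..<1}|lborel. of_real x * legendre_P (\<nu> + 1) x ^ 2 * legendre_P (\<nu> + 1) (- x) / of_real (1 - x\<^sup>2) powr ((1 - \<nu>) / 2)) =
      3 * (LINT x:{-1<..<1}|lborel. legendre_triple 1 (-1) \<nu> x)"
    by (simp only:)
  thus ?D by (rule scale(2))
qed

theorem mainTheorem1:
  fixes \<nu> :: complex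
  assumes "Re \<nu> > -1"
  shows
    "interval_lebesgue_integrable lborel (-1) 1
       (\<lambda>x. legendre_P \<nu> x ^ 3 / of_real (1 - x\<^sup>2) powr ((1 - \<nu>) / 2)) \<and>
     interval_lebesgue_integrable lborel (-1) 1
       (\<lambda>x. legendre_P \<nu> x ^ 2 * legendre_P \<nu> (- x) / of_real (1 - x\<^sup>2) powr ((1 - \<nu>) / 2)) \<and>
     (LBINT x=-1..1. legendre_P \<nu> x ^ 3 / of_real (1 - x\<^sup>2) powr ((1 - \<nu>) / 2)) =
       (3 - 2 * cos (\<nu> * of_real pi)) *
       (LBINT x=-1..1. legendre_P \<nu> x ^ 2 * legendre_P \<nu> (- x) /
                         of_real (1 - x\<^sup>2) powr ((1 - \<nu>) / 2)) \<and>
     (3 - 2 * cos (\<nu> * of_real pi)) *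
       (LBINT x=-1..1. legendre_P \<nu> x ^ 2 * legendre_P \<nu> (- x) /
                         of_real (1 - x\<^sup>2) powr ((1 - \<nu>) / 2)) =
       (3 - 2 * cos (\<nu> * of_real pi)) / of_real pi *
       (cos (\<nu> * of_real pi / 2) / 2 powr \<nu>) ^ 3 *
       (Gamma ((1 + \<nu>) / 2) / Gamma (1 + \<nu> / 2)) ^ 4 \<and>
     interval_lebesgue_integrable lborel (-1) 1
       (\<lambda>x. of_real x * legendre_P (\<nu> + 1) x ^ 3 / of_real (1 - x\<^sup>2) powr ((1 - \<nu>) / 2)) \<and>
     interval_lebesgue_integrable lborel (-1) 1
       (\<lambda>x. of_real x * legendre_P (\<nu> + 1) x ^ 2 * legendre_P (\<nu> + 1) (- x) /
              of_real (1 - x\<^sup>2) powr ((1 - \<nu>) / 2)) \<and>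
     (LBINT x=-1..1. of_real x * legendre_P (\<nu> + 1) x ^ 3 /
                       of_real (1 - x\<^sup>2) powr ((1 - \<nu>) / 2)) =
       (2 * cos (\<nu> * of_real pi) - 3) *
       (LBINT x=-1..1. of_real x * legendre_P (\<nu> + 1) x ^ 2 * legendre_P (\<nu> + 1) (- x) /
                         of_real (1 - x\<^sup>2) powr ((1 - \<nu>) / 2)) \<and>
     (2 * cos (\<nu> * of_real pi) - 3) *
       (LBINT x=-1..1. of_real x * legendre_P (\<nu> + 1) x ^ 2 * legendre_P (\<nu> + 1) (- x) /
                         of_real (1 - x\<^sup>2) powr ((1 - \<nu>) / 2)) =
       3 / 8 * ((3 - 2 * cos (\<nu> * of_real pi)) / of_real pi) *
       (cos (\<nu> * of_real pi / 2) / 2 powr \<nu>) ^ 3 *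
       (Gamma ((1 + \<nu>) / 2) / Gamma (1 + \<nu> / 2)) ^ 4"
proof -
  have i: "interval_lebesgue_integrable lborel (-1) 1 f \<longleftrightarrow> set_integrable lborel {-1<..<1} f" for f :: "real \<Rightarrow> complex"
    unfolding interval_lebesgue_integrable_def einterval_m1_1 by (simp add: one_ereal_def)
  have t: "legendre_triple 1 1 \<nu> = (\<lambda>x. legendre_P \<nu> x ^ 3 / of_real (1 - x\<^sup>2) powr ((1 - \<nu>) / 2))"
    "legendre_triple 1 (-1) \<nu> = (\<lambda>x. legendre_P \<nu> x ^ 2 * legendre_P \<nu> (- x) / of_real (1 - x\<^sup>2) powr ((1 - \<nu>) / 2))"
    by (auto simp: legendre_triple_def fun_eq_iff power3_eq_cube power2_eq_square)
  have int: "set_integrable lborel {-1<..<1} (legendre_triple 1 1 \<nu>)" "set_integrable lborel {-1<..<1} (legendre_triple 1 (-1) \<nu>)"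
    by (intro set_integrable_legendre_triple assms; simp)+
  note F = legendre_triple_ratio[OF assms] legendre_triple_value[OF assms]
  note G = legendre_triple_ladder[OF assms]
  show ?thesis
    unfolding i interval_integral_m1_1
  proof (intro conjI int[unfolded t] G(1,2))
    show "(LINT x:{-1<..<1}|lborel. legendre_P \<nu> x ^ 3 / of_real (1 - x\<^sup>2) powr ((1 - \<nu>) / 2)) =
       (3 - 2 * cos (\<nu> * of_real pi)) * (LINT x:{-1<..<1}|lborel. legendre_P \<nu> x ^ 2 * legendre_P \<nu> (- x) / of_real (1 - x\<^sup>2) powr ((1 - \<nu>) / 2))"
      using F(1) by (simp only: t)
  next
    show "(3 - 2 * cos (\<nu> * of_real pi)) * (LINT x:{-1<..<1}|lborel. legendre_P \<nu> x ^ 2 * legendre_P \<nu> (- x) / of_real (1 - x\<^sup>2) powr ((1 - \<nu>) / 2)) =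
       (3 - 2 * cos (\<nu> * of_real pi)) / of_real pi * (cos (\<nu> * of_real pi / 2) / 2 powr \<nu>) ^ 3 * (Gamma ((1 + \<nu>) / 2) / Gamma (1 + \<nu> / 2)) ^ 4"
      using F(2) by (simp add: t)
  next
    show "(LINT x:{-1<..<1}|lborel. of_real x * legendre_P (\<nu> + 1) x ^ 3 / of_real (1 - x\<^sup>2) powr ((1 - \<nu>) / 2)) =
       (2 * cos (\<nu> * of_real pi) - 3) * (LINT x:{-1<..<1}|lborel. of_real x * legendre_P (\<nu> + 1) x ^ 2 * legendre_P (\<nu> + 1) (- x) / of_real (1 - x\<^sup>2) powr ((1 - \<nu>) / 2))"
    proof -
      have *: "3 / 8 * ((3 - 2 * c) * y) = (2 * c - 3) * (- (3 / 8) * y)" for c y :: complex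
        by (simp add: field_simps)
      show ?thesis unfolding G(3,4) F(1) by (rule *)
    qed
  next
    show "(2 * cos (\<nu> * of_real pi) - 3) * (LINT x:{-1<..<1}|lborel. of_real x * legendre_P (\<nu> + 1) x ^ 2 * legendre_P (\<nu> + 1) (- x) / of_real (1 - x\<^sup>2) powr ((1 - \<nu>) / 2)) =
       3 / 8 * ((3 - 2 * cos (\<nu> * of_real pi)) / of_real pi) * (cos (\<nu> * of_real pi / 2) / 2 powr \<nu>) ^ 3 * (Gamma ((1 + \<nu>) / 2) / Gamma (1 + \<nu> / 2)) ^ 4"
    proof -
      have *: "(2 * c - 3) * (- (3 / 8) * (1 / p * x * y)) = 3 / 8 * ((3 - 2 * c) / p) * x * y" for c p x y :: complex
        by (simp add: divide_simps) (simp add: algebra_simps)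
      show ?thesis unfolding G(4) F(2) by (rule *)
    qed
  qed
qed

end
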